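(* Let $\Phi,\Psi$ be complementary $N$-functions both satisfying the $\Delta_2^0$-condition, let $\varphi=\{\varphi_k\}_{k=0}^\infty$ and $\psi=\{\psi_k\}_{k=0}^\infty$ be weight sequences in $\mathcal{W}$, and suppose there is a constant $M\in(0,\infty)$ such that $k\le M\varphi_k\psi_k$ for all $k\in\mathbb{Z}_+$. Put $\mathbb{A}:=W\cap F\ell_{\varphi,\psi}^{\Phi,\Psi}$. Let $a\in\mathbb{A}$ satisfy $a(t)\neq 0$ for all $t\in\mathbb{T}$ and $\operatorname{ind} a=0$. Then: (a) there exist functions $a_-,a_+$ with $a=a_-a_+$, $a_-^{\pm1}\in\mathbb{A}\cap H_-^\infty$ and $a_+^{\pm1}\in\mathbb{A}\cap H_+^\infty$; (c) if, with $a_\pm$ as in (a), we put $b:=a_-a_+^{-1}$ and $c:=a_-^{-1}a_+$, then for every $\kappa\in\mathbb{N}$, as $n\to\infty$, \[ D_n[a(t)t^{-\kappa}]=G(a)^{n+1}E(a)\{1+\delta_1(n)\}(-1)^{(n+\kappa)\kappa}G(c)^\kappa\Big\{\det\big(b_{n+1+j-k}\big)_{j,k=0}^{\kappa-1}+\delta_2(n)\Big\} \] and \[ D_n[a(t)t^{\kappa}]=G(a)^{n+1}E(a)\{1+\delta_1(n)\}(-1)^{(n+\kappa)\kappa}G(b)^\kappa\Big\{\det\big(c_{-n-1-j+k}\big)_{j,k=0}^{\kappa-1}+\delta_3(n)\Big\}, \] where $\delta_1(n)=o(1)$, $\delta_2(n)=o(1/\psi_n)$ and $\delta_3(n)=o(1/\varphi_n)$.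 (Here the first matrix has first row $b_{n+1},\dots,b_{n-\kappa+2}$ and last row $b_{n+\kappa},\dots,b_{n+1}$; the second has first row $c_{-n-1},\dots,c_{-n+\kappa-2}$ and last row $c_{-n-\kappa},\dots,c_{-n-1}$.)
   Context: $\mathbb{T}$ is the unit circle. For $f\in L^1(\mathbb{T})$, $f_k=\frac1{2\pi}\int_0^{2\pi}f(e^{i\theta})e^{-ik\theta}d\theta$ are its Fourier coefficients. $D_n(f)=\det(f_{j-k})_{j,k=0}^n$ for $n\in\mathbb{Z}_+$; $D_n[a(t)t^{m}]$ denotes $D_n$ of the function $t\mapsto a(t)t^m$. $G(f)=\exp((\log f)_0)$ and $E(f)=\exp\big(\sum_{k=1}^\infty k(\log f)_k(\log f)_{-k}\big)$, where $\log f$ is a continuous logarithm of $f$. $\operatorname{ind}a$ is the winding number (Cauchy index) of the continuous function $a$. $W$ is the Wiener algebra of functions $a(t)=\sum_k a_kt^k$ with $\sum_k|a_k|<\infty$. $H_\pm^\infty=\{f\in L^\infty(\mathbb{T}): f_{\mp n}=0 \text{ for all } n\in\mathbb{N}\}$. An $N$-function pair: let $p:[0,\infty)\to[0,\infty)$ be right-continuous, non-decreasing, $p(0)=0$, $p(t)>0$ for $t>0$, $p(t)\to\infty$ as $t\to\infty$; let $q(s)=\sup\{t:p(t)\le s\}$; then $\Phi(x)=\int_0^xp$, $\Psi(x)=\int_0^xq$ are complementary $N$-functions. $\Phi$ satisfies the $\Delta_2^0$-condition if $\limsup_{x\to0}\Phi(2x)/\Phi(x)<\infty$. $\mathcal{W}$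 is the set of sequences $\{\nu_k\}_{k\ge0}$ of positive numbers with $\nu_0=1$, $\nu_{k-1}\le\nu_k$ for $k\in\mathbb{N}$, and $\nu_{2k}\le C_\nu\nu_k$ for all $k\in\mathbb{N}$ with some constant $C_\nu$. $F\ell_{\varphi,\psi}^{\Phi,\Psi}$ is the set of $a\in L^1(\mathbb{T})$ with $\sum_{k=1}^\infty\Phi(|a_{-k}|\varphi_k)+\sum_{k=0}^\infty\Psi(|a_k|\psi_k)<\infty$. *)

theory Defs
  imports "HOL-Complex_Analysis.Complex_Analysis"
begin

text \<open>Functions on the unit circle are modelled as complex functions; only their
values on the unit circle (sphere 0 1) matter.\<close>

definition circle :: "complex set" where
  "circle = sphere 0 1"

definition L1T :: "(complex \<Rightarrow> complex) \<Rightarrow> bool" where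
  "L1T f \<longleftrightarrow> set_integrable lborel {0..2*pi} (\<lambda>\<theta>. f (cis \<theta>))"

definition LinfT :: "(complex \<Rightarrow> complex) \<Rightarrow> bool" where
  "LinfT f \<longleftrightarrow> (\<lambda>\<theta>. f (cis \<theta>)) \<in> borel_measurable (restrict_space lborel {0..2*pi}) \<and>
     (\<exists>C. AE \<theta> in lborel. \<theta> \<in> {0..2*pi} \<longrightarrow> norm (f (cis \<theta>)) \<le> C)"

definition fc :: "(complex \<Rightarrow> complex) \<Rightarrow> int \<Rightarrow> complex" where
  "fc f k = complex_of_real (1 / (2*pi)) *
     (LINT \<theta>:{0..2*pi}|lborel. f (cis \<theta>) * cis (- (of_int k * \<theta>)))"

definition ldet :: "nat \<Rightarrow> (nat \<Rightarrow> nat \<Rightarrow> complex) \<Rightarrow> complex" where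
  "ldet n A = (\<Sum>p | p permutes {..<n}. of_int (sign p) * (\<Prod>i<n. A i (p i)))"

definition Dn :: "nat \<Rightarrow> (complex \<Rightarrow> complex) \<Rightarrow> complex" where
  "Dn n f = ldet (Suc n) (\<lambda>j k. fc f (int j - int k))"

definition clog :: "(complex \<Rightarrow> complex) \<Rightarrow> complex \<Rightarrow> complex" where
  "clog f = (SOME L. continuous_on circle L \<and> (\<forall>z\<in>circle. exp (L z) = f z))"

definition Gc :: "(complex \<Rightarrow> complex) \<Rightarrow> complex" where
  "Gc f = exp (fc (clog f) 0)"

definition Ec :: "(complex \<Rightarrow> complex) \<Rightarrow> complex" where
  "Ec f = exp (\<Sum>k. of_nat (Suc k) * fc (clog f) (int (Suc k)) * fc (clog f) (- int (Suc k)))"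

definition cind :: "(complex \<Rightarrow> complex) \<Rightarrow> complex" where
  "cind a = winding_number (\<lambda>s. a (cis (2 * pi * s))) 0"

definition Wiener :: "(complex \<Rightarrow> complex) set" where
  "Wiener = {a. L1T a \<and> (\<lambda>k. norm (fc a k)) summable_on UNIV \<and>
      (\<forall>t\<in>circle. a t = (\<Sum>\<^sub>\<infinity>k. fc a k * t powi k))}"

definition Hplus :: "(complex \<Rightarrow> complex) set" where
  "Hplus = {f. LinfT f \<and> (\<forall>n::nat. n \<ge> 1 \<longrightarrow> fc f (- int n) = 0)}"

definition Hminus :: "(complex \<Rightarrow> complex) set" where
  "Hminus = {f. LinfT f \<and> (\<forall>n::nat. n \<ge> 1 \<longrightarrow> fc f (int n) = 0)}"

definition N_pair :: "(real \<Rightarrow> real) \<Rightarrow> (real \<Rightarrow> real) \<Rightarrow> (real \<Rightarrow> real) \<Rightarrow> bool" where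
  "N_pair p Phi Psi \<longleftrightarrow>
     (\<forall>t\<ge>0. p t \<ge> 0) \<and>
     (\<forall>t\<ge>0. continuous (at_right t) p) \<and> mono_on {0..} p \<and> p 0 = 0 \<and>
     (\<forall>t>0. p t > 0) \<and> filterlim p at_top at_top \<and>
     (\<forall>x\<ge>0. Phi x = integral {0..x} p) \<and>
     (\<forall>x\<ge>0. Psi x = integral {0..x} (\<lambda>s. Sup {t. t \<ge> 0 \<and> p t \<le> s}))"

definition Delta2_0 :: "(real \<Rightarrow> real) \<Rightarrow> bool" where
  "Delta2_0 Phi \<longleftrightarrow> Limsup (at_right 0) (\<lambda>x. ereal (Phi (2*x) / Phi x)) < \<infinity>"

definition weights :: "(nat \<Rightarrow> real) set" where
  "weights = {\<nu>. (\<forall>k. \<nu> k > 0) \<and> \<nu> 0 = 1 \<and> (\<forall>k\<ge>1. \<nu> (k-1) \<le> \<nu> k) \<and>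
      (\<exists>C. \<forall>k\<ge>1. \<nu> (2*k) \<le> C * \<nu> k)}"

definition Fl :: "(real \<Rightarrow> real) \<Rightarrow> (real \<Rightarrow> real) \<Rightarrow> (nat \<Rightarrow> real) \<Rightarrow> (nat \<Rightarrow> real)
    \<Rightarrow> (complex \<Rightarrow> complex) set" where
  "Fl Phi Psi \<phi> \<psi> = {a. L1T a \<and>
      summable (\<lambda>k. Phi (norm (fc a (- int (Suc k))) * \<phi> (Suc k))) \<and>
      summable (\<lambda>k. Psi (norm (fc a (int k)) * \<psi> k))}"

end

theory Submission
  imports Defs "Jordan_Normal_Form.Determinant"
begin

text \<open>
  Part (a). Approximating \<open>a\<close> by a trigonometric polynomial \<open>q\<close>, the norm of \<open>q\<^sup>-\<^sup>k\<close> in the Wiener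
  algebra exceeds its supremum only by a factor of order \<open>k\<^sup>2\<close>; hence \<open>log a = log q + log (a / q)\<close>
  lies in the Wiener algebra, and splitting its Fourier series gives \<open>a\<^sub>- = exp P\<^sub>-(log a)\<close> and
  \<open>a\<^sub>+ = exp P\<^sub>+(log a)\<close>. Since \<open>a\<^sub>+ = a\<^sub>-\<^sup>-\<^sup>1 a\<close> and the weights increase, the coefficients of
  \<open>a\<^sub>+\<close> are averages of those of \<open>a\<close>, so Jensen's inequality puts \<open>a\<^sub>+\<close> into the weighted class;
  the inverse follows from the doubling property of the weights.

  Part (c). The coefficients of \<open>b\<close> are \<open>o(1 / \<psi>\<^sub>n)\<close>, hence so is the determinant of \<open>b\<close> on the
  right-hand side, and the formula (even with \<open>\<delta>\<^sub>1 = 0\<close>) is equivalent to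
  \<open>D\<^sub>n[a t\<^sup>-\<^sup>\<kappa>] = o(G(a)\<^sup>n / \<psi>\<^sub>n)\<close>. This determinant is, up to sign, \<open>D\<^sub>n\<^sub>+\<^sub>\<kappa>(a)\<close> times a minor of
  size \<open>\<kappa>\<close> of the inverse Toeplitz matrix. Solutions of \<open>T\<^sub>n(a) x = y\<close> have the form
  \<open>x = a\<^sup>-\<^sup>1 y + a\<^sub>+\<^sup>-\<^sup>1 \<xi> + a\<^sub>-\<^sup>-\<^sup>1 \<zeta>\<close> where \<open>\<xi>\<close> and \<open>\<zeta>\<close> solve a system coupled only through the tails
  of \<open>b\<close> and \<open>c\<close>. This bounds the minor, and it gives
  \<open>G(a) D\<^sub>n\<^sub>-\<^sub>1(a) / D\<^sub>n(a) = 1 + e\<^sub>n\<close> with \<open>\<Sum> |e\<^sub>n| < \<infinity>\<close>, so that \<open>D\<^sub>n(a) / G(a)\<^sup>n\<close> is bounded; the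
  summability of \<open>e\<^sub>n\<close> is where \<open>k \<le> M \<phi>\<^sub>k \<psi>\<^sub>k\<close> and Young's inequality enter. The second formula is
  the first one for \<open>a(1/t)\<close>.
\<close>

text \<open>The delicate point is the bound on D_n(a) / G(a)^n. For a single n the coupled system
  shows only that e_n is at most a constant times a tail of the coefficients of c, and such tails
  need not be summable. So the sum over n is estimated as a whole. The coefficient of zeta at
  frequency p vanishes unless n < p, so each p occurs at most p times; this is the factor that k <=
  M phi_k psi_k splits between c on one side and U, b on the other. The other terms feed zeta back
  into itself through a tail of b and a tail of c, each of norm at most 1/2, and are absorbed.

  The N-functions enter through a line of support with nonnegative slope at every point
  (monotonicity, Jensen), doubling near 0, and Young's inequality up to a factor 2, which doubling
  makes harmless. Negative frequencies are treated by the substitution t -> 1/t, so that all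
  weighted estimates are one-sided.

  The correction delta_2 is found by solving the asymptotic formula for it. What has to be proved is
  therefore an upper bound for the shifted determinant.\<close>

section \<open>Absolutely summable sequences of Fourier coefficients\<close>

text \<open>The Wiener algebra as a type of its own: once it is an instance of the Banach algebra
  classes, \<open>exp\<close> and absolutely convergent series are available, and functions that
  agree on the circle become equal elements.\<close>

typedef l1z = "{f :: int \<Rightarrow> complex. (\<lambda>k. norm (f k)) summable_on UNIV}"
  morphisms coef Abs_l1z by (intro exI[of _ "\<lambda>_. 0"]) auto

setup_lifting type_definition_l1z

lemma coef_abs_summable [simp, intro]: "(\<lambda>k. norm (coef w k)) summable_on A"
  using coef[of w] summable_on_subset_banach[of "\<lambda>k. norm (coef w k)" UNIV A] by auto

lemma l1z_eqI: "(\<And>k. coef v k = coef w k) \<Longrightarrow> v = w" by (simp add: coef_inject[symmetric] ext)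

instantiation l1z :: real_vector
begin

lift_definition zero_l1z :: l1z is "\<lambda>_. 0" by simp

lift_definition plus_l1z :: "l1z \<Rightarrow> l1z \<Rightarrow> l1z" is "\<lambda>f g k. f k + g k"
  subgoal for f g by (rule summable_on_comparison_test[of "\<lambda>k. norm (f k) + norm (g k)"])
      (auto intro: summable_on_add norm_triangle_ineq)
  done

lift_definition uminus_l1z :: "l1z \<Rightarrow> l1z" is "\<lambda>f k. - f k" by simp

lift_definition minus_l1z :: "l1z \<Rightarrow> l1z \<Rightarrow> l1z" is "\<lambda>f g k. f k - g k"
  subgoal for f g by (rule summable_on_comparison_test[of "\<lambda>k. norm (f k) + norm (g k)"])
      (auto intro: summable_on_add norm_triangle_ineq4)
  done

lift_definition scaleR_l1z :: "real \<Rightarrow> l1z \<Rightarrow> l1z" is "\<lambda>r f k. r *\<^sub>R f k"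
  by (simp add: summable_on_cmult_right)

instance by standard (transfer, auto simp: algebra_simps)+

end

lemma coef_simps [simp]:
  "coef 0 k = 0" "coef (v + w) k = coef v k + coef w k" "coef (- v) k = - coef v k"
  "coef (v - w) k = coef v k - coef w k" "coef (r *\<^sub>R v) k = r *\<^sub>R coef v k" by (transfer, simp)+

lemma coef_sum [simp]: "coef (\<Sum>i\<in>I. f i) k = (\<Sum>i\<in>I. coef (f i) k)"
  by (induction I rule: infinite_finite_induct) auto

instantiation l1z :: real_normed_vector
begin

definition norm_l1z :: "l1z \<Rightarrow> real" where
  "norm_l1z w = (\<Sum>\<^sub>\<infinity>k. norm (coef w k))"

definition dist_l1z :: "l1z \<Rightarrow> l1z \<Rightarrow> real" where
  "dist_l1z v w = norm (v - w)"

definition sgn_l1z :: "l1z \<Rightarrow> l1z" where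
  "sgn_l1z w = inverse (norm w) *\<^sub>R w"

definition uniformity_l1z :: "(l1z \<times> l1z) filter" where
  "uniformity_l1z = (INF e\<in>{0<..}. principal {(x, y). dist x y < e})"

definition open_l1z :: "l1z set \<Rightarrow> bool" where
  "open_l1z S \<longleftrightarrow> (\<forall>x\<in>S. \<forall>\<^sub>F (x', y) in uniformity. x' = x \<longrightarrow> y \<in> S)"

instance
proof
  fix v w :: l1z and r :: real
  have "coef w k = 0" if "norm w = 0" for k
    using nonneg_infsum_le_0D[of "\<lambda>k. norm (coef w k)" UNIV k] that by (simp add: norm_l1z_def)
  moreover have "norm (0 :: l1z) = 0" by (simp add: norm_l1z_def)
  ultimately show "norm w = 0 \<longleftrightarrow> w = 0" by (metis coef_simps(1) l1z_eqI)
  have "norm (v + w) \<le> (\<Sum>\<^sub>\<infinity>k. norm (coef v k) + norm (coef w k))" unfolding norm_l1z_def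
    by (rule infsum_mono[OF coef_abs_summable summable_on_add[OF coef_abs_summable coef_abs_summable]])
      (simp add: norm_triangle_ineq)
  also have "\<dots> = norm v + norm w"
    unfolding norm_l1z_def by (rule infsum_add[OF coef_abs_summable coef_abs_summable])
  finally show "norm (v + w) \<le> norm v + norm w" .
  show "norm (r *\<^sub>R w) = \<bar>r\<bar> * norm w" unfolding norm_l1z_def by (simp add: infsum_cmult_right')
qed (rule dist_l1z_def sgn_l1z_def uniformity_l1z_def open_l1z_def)+

end

lemma norm_coef_sum_le: "(\<Sum>\<^sub>\<infinity>k\<in>A. norm (coef w k)) \<le> norm w"
  unfolding norm_l1z_def by (intro infsum_mono_neutral) auto

lemma norm_coef_le: "norm (coef w k) \<le> norm w" using norm_coef_sum_le[of w "{k}"] by simp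

lemma sum_norm_coef_le: "finite F \<Longrightarrow> (\<Sum>k\<in>F. norm (coef w k)) \<le> norm w"
  using norm_coef_sum_le[of w F] by simp

lemma l1z_norm_leI:
  assumes "\<And>F. finite F \<Longrightarrow> (\<Sum>k\<in>F. norm (coef w k)) \<le> B"
  shows "norm w \<le> B" unfolding norm_l1z_def by (rule infsum_le_finite_sums) (use assms in auto)

lemma l1z_finite_sums_imp_ex:
  assumes "\<And>F. finite F \<Longrightarrow> (\<Sum>k\<in>F. norm (f k)) \<le> B"
  obtains w where "coef w = f"
proof -
  have "(\<lambda>k. norm (f k)) summable_on UNIV"
    by (subst abs_summable_iff_bdd_above) (use assms in \<open>auto intro!: bdd_aboveI2\<close>)
  then show ?thesis using that[of "Abs_l1z f"] Abs_l1z_inverse by blast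
qed

lemma bounded_linear_coef: "bounded_linear (\<lambda>w. coef w k)"
  by (rule bounded_linear_intro[where K = 1]) (auto simp: norm_coef_le)

instance l1z :: banach
proof
  fix X :: "nat \<Rightarrow> l1z"
  assume X: "Cauchy X"
  have "convergent (\<lambda>n. coef (X n) k)" for k
    using bounded_linear.Cauchy[OF bounded_linear_coef X] by (simp add: Cauchy_convergent_iff)
  then obtain l where l: "\<And>k. (\<lambda>n. coef (X n) k) \<longlonglongrightarrow> l k" unfolding convergent_def by metis
  obtain B where B: "\<And>n. norm (X n) \<le> B" using Cauchy_Bseq[OF X] unfolding Bseq_def by auto
  \<comment> \<open>Each finite partial sum of the coefficientwise limit is a limit of sums below
    the common bound \<open>B\<close>, so the limit is again absolutely summable.\<close>
  have "(\<Sum>k\<in>F. norm (l k)) \<le> B" if "finite F" for F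
  proof (rule tendsto_upperbound)
    show "(\<lambda>n. \<Sum>k\<in>F. norm (coef (X n) k)) \<longlonglongrightarrow> (\<Sum>k\<in>F. norm (l k))"
      by (intro tendsto_sum tendsto_norm l)
    show "\<forall>\<^sub>F n in sequentially. (\<Sum>k\<in>F. norm (coef (X n) k)) \<le> B"
      by (intro always_eventually allI order.trans[OF sum_norm_coef_le[OF that] B])
  qed simp
  then obtain w where w: "coef w = l" by (rule l1z_finite_sums_imp_ex)
  have "X \<longlonglongrightarrow> w"
  proof (rule metric_LIMSEQ_I)
    fix e :: real assume e: "e > 0"
    obtain M where M: "\<And>m n. m \<ge> M \<Longrightarrow> n \<ge> M \<Longrightarrow> dist (X m) (X n) < e / 2"
      using metric_CauchyD[OF X, of "e / 2"] e by auto
    \<comment> \<open>The Cauchy estimate is tested on finite sets of frequencies, where m may tend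
      to infinity coefficient by coefficient.\<close>
    have "dist (X n) w \<le> e / 2" if n: "n \<ge> M" for n unfolding dist_norm
    proof (rule l1z_norm_leI)
      fix F :: "int set" assume F: "finite F"
      show "(\<Sum>k\<in>F. norm (coef (X n - w) k)) \<le> e / 2"
      proof (rule tendsto_upperbound)
        show "(\<lambda>m. \<Sum>k\<in>F. norm (coef (X n - X m) k)) \<longlonglongrightarrow> (\<Sum>k\<in>F. norm (coef (X n - w) k))"
          unfolding coef_simps w by (intro tendsto_sum tendsto_norm tendsto_diff tendsto_const l)
        show "\<forall>\<^sub>F m in sequentially. (\<Sum>k\<in>F. norm (coef (X n - X m) k)) \<le> e / 2"
          using eventually_ge_at_top[of M]
        proof eventually_elim
          case (elim m)
          show ?case
            using sum_norm_coef_le[OF F, of "X n - X m"] M[OF n elim] by (simp add: dist_norm)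
        qed
      qed simp
    qed
    then show "\<exists>N. \<forall>n\<ge>N. dist (X n) w < e" using e by (intro exI[of _ M]) fastforce
  qed
  then show "convergent X" by (auto simp: convergent_def)
qed

lift_definition restr :: "int set \<Rightarrow> l1z \<Rightarrow> l1z" is "\<lambda>A f k. if k \<in> A then f k else 0"
  subgoal for A f by (rule summable_on_comparison_test[of "\<lambda>k. norm (f k)"]) auto
  done

lemma coef_restr [simp]: "coef (restr A w) k = (if k \<in> A then coef w k else 0)" by transfer simp

lemma norm_restr: "norm (restr A w) = (\<Sum>\<^sub>\<infinity>k\<in>A. norm (coef w k))"
  unfolding norm_l1z_def by (intro infsum_cong_neutral) auto

lemma norm_restr_le: "norm (restr A w) \<le> norm w" by (simp add: norm_restr norm_coef_sum_le)

lemma restr_approx: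
  assumes "e > 0" "finite K"
  obtains F where "finite F" "K \<subseteq> F" "\<And>A. F \<inter> A = {} \<Longrightarrow> norm (restr A w) < e"
proof -
  obtain F where F: "finite F" "dist (\<Sum>k\<in>F. norm (coef w k)) (norm w) \<le> e / 2"
    using infsum_finite_approximation[of "\<lambda>k. norm (coef w k)" UNIV "e / 2"] assms(1)
    unfolding norm_l1z_def by auto
  have "norm (restr A w) < e" if "(F \<union> K) \<inter> A = {}" for A
  proof -
    have "(\<Sum>k\<in>F. norm (coef w k)) + (\<Sum>\<^sub>\<infinity>k\<in>A. norm (coef w k)) = (\<Sum>\<^sub>\<infinity>k\<in>F \<union> A. norm (coef w k))"
      using that F(1) by (subst infsum_Un_disjoint) auto
    moreover have "norm w - (\<Sum>k\<in>F. norm (coef w k)) \<le> e / 2"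
      using F(2) unfolding dist_real_def by linarith
    ultimately show ?thesis
      using norm_coef_sum_le[of w "F \<union> A"] assms(1) unfolding norm_restr by linarith
  qed
  then show ?thesis using F(1) that[of "F \<union> K"] assms(2) by auto
qed

section \<open>Evaluation on the unit circle\<close>

definition ev :: "l1z \<Rightarrow> complex \<Rightarrow> complex" where
  "ev w t = (\<Sum>\<^sub>\<infinity>k. coef w k * t powi k)"

lemma norm_circle_powi [simp]: "t \<in> circle \<Longrightarrow> norm (t powi k) = 1"
  by (simp add: circle_def norm_power_int)

lemma cis_circle [simp]: "cis x \<in> circle" by (simp add: circle_def)

lemma circle_nonzero: "t \<in> circle \<Longrightarrow> t \<noteq> 0" by (auto simp: circle_def)

lemma circle_eq_cis: "t \<in> circle \<longleftrightarrow> (\<exists>x\<in>{0..2*pi}. t = cis x)"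
proof
  assume t: "t \<in> circle"
  then have "t = cis (Arg2pi t)" using Arg2pi_eq[of t] by (simp add: circle_def cis_conv_exp)
  then show "\<exists>x\<in>{0..2*pi}. t = cis x" using Arg2pi[of t] by (intro bexI[of _ "Arg2pi t"]) auto
qed auto

lemma cis_powi: "cis x powi k = cis (of_int k * x)" by (simp add: cis_power_int)

lemma ev_has_sum:
  assumes "t \<in> circle"
  shows "((\<lambda>k. coef w k * t powi k) has_sum ev w t) UNIV" unfolding ev_def
  by (rule has_sum_infsum, rule abs_summable_summable) (use assms in \<open>simp add: norm_mult\<close>)

lemma norm_ev_le:
  assumes "t \<in> circle"
  shows "norm (ev w t) \<le> norm w" unfolding norm_l1z_def
  by (rule norm_infsum_le[OF ev_has_sum[OF assms] has_sum_infsum])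
    (use assms in \<open>auto simp: norm_mult\<close>)

lemma ev_simps:
  assumes "t \<in> circle"
  shows "ev 0 t = 0" "ev (v + w) t = ev v t + ev w t" "ev (- v) t = - ev v t"
    "ev (v - w) t = ev v t - ev w t" "ev (r *\<^sub>R v) t = r *\<^sub>R ev v t"
proof -
  note S = ev_has_sum[OF assms]
  show "ev 0 t = 0" by (simp add: ev_def)
  show add: "ev (v + w) t = ev v t + ev w t" for v w by (rule has_sum_unique[OF S[of "v + w"]])
      (use has_sum_add[OF S[of v] S[of w]] in \<open>simp add: ring_distribs\<close>)
  show minus: "ev (- v) t = - ev v t" for v
    by (rule has_sum_unique[OF S[of "- v"]]) (use has_sum_uminusI[OF S[of v]] in simp)
  show "ev (v - w) t = ev v t - ev w t"
    using add[of v "- w"] minus[of w] add_uminus_conv_diff by metis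
  show "ev (r *\<^sub>R v) t = r *\<^sub>R ev v t" by (rule has_sum_unique[OF S[of "r *\<^sub>R v"]])
      (use has_sum_scaleR[OF S[of v], of r] in simp)
qed

text \<open>Lets evaluation pass through norm-convergent series, such as those of the exponential
  and the logarithm.\<close>

lemma bounded_linear_ev: "t \<in> circle \<Longrightarrow> bounded_linear (\<lambda>w. ev w t)"
  by (rule bounded_linear_intro[where K = 1]) (auto simp: ev_simps norm_ev_le)

lemma continuous_on_ev: "continuous_on circle (ev w)"
proof (rule uniform_limit_theorem)
  show "uniform_limit circle (\<lambda>F t. \<Sum>k\<in>F. coef w k * t powi k) (ev w) (finite_subsets_at_top UNIV)"
    by (rule Weierstrass_m_test_general'[where M = "\<lambda>k. norm (coef w k)"])
      (auto simp: norm_mult ev_has_sum)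
  show "\<forall>\<^sub>F F in finite_subsets_at_top UNIV. continuous_on circle (\<lambda>t. \<Sum>k\<in>F. coef w k * t powi k)"
    by (intro always_eventually allI continuous_intros) (auto simp: circle_nonzero)
qed simp

section \<open>Fourier coefficients of continuous functions\<close>

lemma continuous_on_cis_comp:
  "continuous_on circle f \<Longrightarrow> continuous_on A (\<lambda>x. f (cis x))"
  by (rule continuous_on_compose2[of circle f]) (auto intro!: continuous_intros)

lemma L1T_continuous: "continuous_on circle f \<Longrightarrow> L1T f" unfolding L1T_def set_integrable_def
  using borel_integrable_compact[of "{0..2*pi}" "\<lambda>x. f (cis x)"] continuous_on_cis_comp
  by (auto simp: indicator_def if_distrib cong: if_cong)

text \<open>Moves from the Lebesgue integral in \<open>fc\<close> to the gauge integral, for which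
  the fundamental theorem of calculus is at hand.\<close>

lemma fc_continuous:
  assumes "continuous_on circle f"
  shows "fc f k = complex_of_real (1 / (2*pi)) * integral {0..2*pi} (\<lambda>x. f (cis x) * cis (- (of_int k * x)))"
proof -
  have "continuous_on {0..2*pi} (\<lambda>x. f (cis x) * cis (- (of_int k * x)))"
    by (intro continuous_intros continuous_on_cis_comp assms)
  then have "set_integrable lborel {0..2*pi} (\<lambda>x. f (cis x) * cis (- (of_int k * x)))"
    unfolding set_integrable_def
    using borel_integrable_compact[of "{0..2*pi}" "\<lambda>x. f (cis x) * cis (- (of_int k * x))"]
    by (auto simp: indicator_def if_distrib cong: if_cong)
  then show ?thesis unfolding fc_def by (subst set_borel_integral_eq_integral(2)) auto
qed

lemma fc_integrable:
  assumes "continuous_on circle f"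
  shows "(\<lambda>x. f (cis x) * cis (- (of_int k * x))) integrable_on {0..2*pi}"
  by (intro integrable_continuous_real continuous_intros continuous_on_cis_comp assms)

lemma fc_cong: "(\<And>t. t \<in> circle \<Longrightarrow> f t = g t) \<Longrightarrow> fc f k = fc g k" by (simp add: fc_def)

lemma fc_add:
  assumes "continuous_on circle f" "continuous_on circle g"
  shows "fc (\<lambda>t. f t + g t) k = fc f k + fc g k"
  using assms fc_integrable[OF assms(1), of k] fc_integrable[OF assms(2), of k]
  by (simp add: fc_continuous continuous_on_add integral_add ring_distribs)

lemma fc_diff:
  assumes "continuous_on circle f" "continuous_on circle g"
  shows "fc (\<lambda>t. f t - g t) k = fc f k - fc g k"
  using assms fc_integrable[OF assms(1), of k] fc_integrable[OF assms(2), of k]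
  by (simp add: fc_continuous continuous_on_diff integral_diff left_diff_distrib right_diff_distrib)

lemma fc_cmult:
  assumes "continuous_on circle f"
  shows "fc (\<lambda>t. c * f t) k = c * fc f k" using assms fc_integrable[OF assms(1), of k]
  by (simp add: fc_continuous continuous_on_mult_left mult.assoc)

lemma continuous_on_powi: "continuous_on circle (\<lambda>t. t powi m)"
  by (intro continuous_intros) (auto simp: circle_nonzero)

lemma fc_powi: "fc (\<lambda>t. t powi m) k = (if m = k then 1 else 0)"
proof -
  have eq: "cis x powi m * cis (- (of_int k * x)) = cis (of_int (m - k) * x)" for x
    by (simp add: cis_powi cis_mult algebra_simps)
  have fc: "fc (\<lambda>t. t powi m) k = complex_of_real (1 / (2*pi)) * integral {0..2*pi} (\<lambda>x. cis (of_int (m - k) * x))"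
    by (subst fc_continuous[OF continuous_on_powi]) (simp only: eq)
  show ?thesis
  proof (cases "m = k")
    case True
    then show ?thesis unfolding fc by (simp add: scaleR_conv_of_real)
  next
    case False
    define j where "j = m - k"
    have j: "j \<noteq> 0" using False by (simp add: j_def)
    have ii: "\<i> * (E * \<i>) = - E" for E by (simp add: complex_eq_iff)
    have "((\<lambda>x. cis (of_int j * x)) has_integral
       cis (of_int j * (2*pi)) / (\<i> * of_int j) - cis (of_int j * 0) / (\<i> * of_int j)) {0..2*pi}"
      using j unfolding cis_conv_exp by (intro fundamental_theorem_of_calculus)
        (auto intro!: derivative_eq_intros has_vector_derivative_real_field simp: ii exp_of_real[symmetric] scaleR_conv_of_real)
    moreover have "cis (of_int j * (2*pi)) = 1"
      using cis_multiple_2pi[of "of_int j"] by (simp add: mult.commute)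
    ultimately show ?thesis using False unfolding fc by (simp add: j_def integral_unique)
  qed
qed

lemma norm_fc_le:
  assumes "continuous_on circle f" "\<And>t. t \<in> circle \<Longrightarrow> norm (f t) \<le> B"
  shows "norm (fc f k) \<le> B"
proof -
  have "norm (integral {0..2*pi} (\<lambda>x. f (cis x) * cis (- (of_int k * x)))) \<le> B * (2*pi - 0)"
    by (intro integral_bound continuous_intros continuous_on_cis_comp assms)
      (auto simp: norm_mult assms(2))
  then show ?thesis
    by (simp add: fc_continuous assms(1) norm_mult norm_divide pos_divide_le_eq mult.commute)
qed

lemma ev_restr_finite:
  assumes "finite F"
  shows "ev (restr F w) t = (\<Sum>k\<in>F. coef w k * t powi k)"
proof -
  have "ev (restr F w) t = (\<Sum>\<^sub>\<infinity>k\<in>F. coef w k * t powi k)"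
    unfolding ev_def by (rule infsum_cong_neutral) auto
  then show ?thesis using assms by simp
qed

lift_definition monomial :: "complex \<Rightarrow> int \<Rightarrow> l1z" is "\<lambda>c m k. if k = m then c else 0"
  subgoal for c m
    by (rule finite_nonzero_values_imp_summable_on, rule finite_subset[of _ "{m}"]) auto
  done

lemma coef_monomial [simp]: "coef (monomial c m) k = (if k = m then c else 0)" by transfer simp

lemma ev_monomial [simp]: "ev (monomial c m) t = c * t powi m"
proof -
  have "ev (monomial c m) t = (\<Sum>\<^sub>\<infinity>k\<in>{m}. c * t powi m)"
    unfolding ev_def by (rule infsum_cong_neutral) auto
  then show ?thesis by simp
qed

lemma fc_mult_powi: "fc (\<lambda>t. f t * t powi m) k = fc f (k - m)"
proof -
  have "f (cis x) * cis x powi m * cis (- (of_int k * x)) = f (cis x) * cis (- (of_int (k - m) * x))" for x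
    by (simp add: cis_powi mult.assoc cis_mult algebra_simps)
  then show ?thesis by (simp only: fc_def)
qed

lemma circle_bounded:
  assumes "continuous_on circle f"
  obtains B where "B > 0" "\<And>t. t \<in> circle \<Longrightarrow> norm (f t) \<le> B"
proof -
  have "bounded (f ` circle)"
    by (intro compact_imp_bounded compact_continuous_image assms) (simp add: circle_def)
  then show ?thesis using that unfolding bounded_pos by auto
qed

text \<open>Finite sums of monomials are dense in norm. This replaces every interchange of an
  integral with an infinite sum: it suffices to check monomials.\<close>

lemma l1z_functional_eqI:
  fixes S T :: "l1z \<Rightarrow> complex"
  assumes "bounded_linear S" "bounded_linear T"
    and eq: "\<And>z m. S (monomial z m) = T (monomial z m)"
  shows "S w = T w"
proof -
  interpret D: bounded_linear "\<lambda>w. S w - T w" by (rule bounded_linear_sub[OF assms(1,2)])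
  obtain K where K: "K > 0" "\<And>w. norm (S w - T w) \<le> norm w * K" using D.pos_bounded by auto
  have "norm (S w - T w) \<le> e" if e: "e > 0" for e
  proof -
    obtain F where F: "finite F" "\<And>A. F \<inter> A = {} \<Longrightarrow> norm (restr A w) < e / K"
      using restr_approx[of "e / K" "{}" w] e K(1) by auto
    define v where "v = (\<Sum>k\<in>F. monomial (coef w k) k)"
    have "w = v + restr (-F) w" unfolding v_def by (rule l1z_eqI) (simp add: F(1))
    then have "S w - T w = S (restr (-F) w) - T (restr (-F) w)"
      using D.add[of v "restr (-F) w"] by (simp add: v_def D.sum eq)
    also have "norm \<dots> \<le> norm (restr (-F) w) * K" by (rule K(2))
    also have "\<dots> \<le> e" using F(2)[of "-F"] K(1) by (simp add: field_simps)
    finally show ?thesis .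
  qed
  then have "norm (S w - T w) \<le> 0" by (rule field_le_epsilon) auto
  then show ?thesis by simp
qed

lemma bounded_linear_fc_mult_ev:
  assumes f: "continuous_on circle f"
  shows "bounded_linear (\<lambda>w. fc (\<lambda>t. f t * ev w t) k)"
proof -
  obtain B where B: "B > 0" "\<And>t. t \<in> circle \<Longrightarrow> norm (f t) \<le> B" using circle_bounded[OF f] by metis
  have c: "continuous_on circle (\<lambda>t. f t * ev w t)" for w
    by (intro continuous_intros f continuous_on_ev)
  show ?thesis
  proof (rule bounded_linear_intro[where K = B])
    fix v w :: l1z and r :: real
    have "fc (\<lambda>t. f t * ev (v + w) t) k = fc (\<lambda>t. f t * ev v t + f t * ev w t) k"
      by (rule fc_cong) (simp add: ev_simps distrib_left)
    then show "fc (\<lambda>t. f t * ev (v + w) t) k = fc (\<lambda>t. f t * ev v t) k + fc (\<lambda>t. f t * ev w t) k"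
      by (simp add: fc_add c)
    have "fc (\<lambda>t. f t * ev (r *\<^sub>R v) t) k = fc (\<lambda>t. of_real r * (f t * ev v t)) k"
      by (rule fc_cong) (simp add: ev_simps scaleR_conv_of_real)
    then show "fc (\<lambda>t. f t * ev (r *\<^sub>R v) t) k = r *\<^sub>R fc (\<lambda>t. f t * ev v t) k"
      by (simp add: fc_cmult c scaleR_conv_of_real)
    show "norm (fc (\<lambda>t. f t * ev v t) k) \<le> norm v * B"
    proof (rule norm_fc_le[OF c])
      fix t assume t: "t \<in> circle"
      have "norm (ev v t) * norm (f t) \<le> norm v * B" by (intro mult_mono norm_ev_le t B) auto
      then show "norm (f t * ev v t) \<le> norm v * B" by (simp add: norm_mult mult.commute)
    qed
  qed
qed

lemma fc_ev: "fc (ev w) k = coef w k"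
proof -
  have "fc (\<lambda>t. 1 * ev w t) k = coef w k"
  proof (rule l1z_functional_eqI[OF bounded_linear_fc_mult_ev bounded_linear_coef])
    show "fc (\<lambda>t. 1 * ev (monomial z m) t) k = coef (monomial z m) k" for z m
      using fc_cmult[OF continuous_on_powi, of z m k] by (simp add: fc_powi)
  qed simp
  then show ?thesis by simp
qed

text \<open>Reduces identities between coefficient sequences to pointwise identities on the circle;
  the ring laws of the convolution product are obtained in this way.\<close>

lemma ev_inject:
  assumes "\<And>t. t \<in> circle \<Longrightarrow> ev v t = ev w t"
  shows "v = w" by (rule l1z_eqI) (metis fc_ev fc_cong assms)

lemma Wiener_iff: "f \<in> Wiener \<longleftrightarrow> (\<exists>w. \<forall>t\<in>circle. f t = ev w t)"
proof
  assume f: "f \<in> Wiener"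
  then have "coef (Abs_l1z (fc f)) = fc f" by (intro Abs_l1z_inverse) (auto simp: Wiener_def)
  then show "\<exists>w. \<forall>t\<in>circle. f t = ev w t"
    using f by (auto simp: Wiener_def ev_def intro!: exI[of _ "Abs_l1z (fc f)"])
next
  assume "\<exists>w. \<forall>t\<in>circle. f t = ev w t"
  then obtain w where w: "\<And>t. t \<in> circle \<Longrightarrow> f t = ev w t" by blast
  have "fc f k = coef w k" for k using fc_cong[OF w] by (simp add: fc_ev)
  moreover have "L1T f"
    by (intro L1T_continuous) (use w continuous_on_ev continuous_on_cong in blast)
  ultimately show "f \<in> Wiener" by (simp add: Wiener_def w ev_def)
qed

section \<open>Convolution\<close>

text \<open>The bijection (k, m) -> (k + m, k) carries the double series of a product of two sums to
  the convolution.\<close>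

lemma convolution_summable:
  fixes V W :: "int \<Rightarrow> 'a :: {real_normed_field, banach}"
  assumes V: "(\<lambda>k. norm (V k)) summable_on UNIV" and W: "(\<lambda>k. norm (W k)) summable_on UNIV"
  shows "(\<lambda>(n, k). norm (V k * W (n - k))) summable_on UNIV"
proof -
  have "(\<lambda>x. norm ((\<lambda>(k, m). V k * W m) x)) summable_on (UNIV \<times> UNIV)"
    by (subst Infinite_Sum.abs_summable_on_Sigma_iff)
      (simp add: norm_mult summable_on_cmult_right summable_on_cmult_left V W
        infsum_cmult_right' infsum_nonneg)
  then have *: "(\<lambda>(k, m). norm (V k * W m)) summable_on UNIV" by (simp add: case_prod_unfold)
  show ?thesis
    by (rule iffD2[OF summable_on_reindex_bij_witness[of UNIV "\<lambda>(k, m). (k + m, k)" "\<lambda>(n, k). (k, n - k)"] *])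
      auto
qed

text \<open>Polymorphic because it serves twice: with complex terms it makes evaluation
  multiplicative, with real norms it makes the norm submultiplicative.\<close>

lemma convolution_infsum:
  fixes V W :: "int \<Rightarrow> 'a :: {real_normed_field, banach}"
  assumes V: "(\<lambda>k. norm (V k)) summable_on UNIV" and W: "(\<lambda>k. norm (W k)) summable_on UNIV"
  shows "((\<lambda>n. \<Sum>\<^sub>\<infinity>k. V k * W (n - k)) has_sum (\<Sum>\<^sub>\<infinity>k. V k) * (\<Sum>\<^sub>\<infinity>k. W k)) UNIV"
proof -
  have s: "(\<lambda>(n, k). V k * W (n - k)) summable_on UNIV \<times> UNIV"
    by (rule abs_summable_summable) (use convolution_summable[OF V W] in \<open>simp add: case_prod_unfold\<close>)
  then have s': "(\<lambda>(k, m). V k * W m) summable_on UNIV \<times> UNIV"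
    by (subst (asm) summable_on_reindex_bij_witness[of _ "\<lambda>(k, m). (k + m, k)" "\<lambda>(n, k). (k, n - k)"
      "UNIV \<times> UNIV" "\<lambda>(k, m). V k * W m"]) auto
  have "(\<Sum>\<^sub>\<infinity>n. \<Sum>\<^sub>\<infinity>k. V k * W (n - k)) = (\<Sum>\<^sub>\<infinity>(n, k)\<in>UNIV \<times> UNIV. V k * W (n - k))"
    by (rule infsum_Sigma'_banach[OF s])
  also have "\<dots> = (\<Sum>\<^sub>\<infinity>(k, m)\<in>UNIV \<times> UNIV. V k * W m)"
    by (rule infsum_reindex_bij_witness[of _ "\<lambda>(k, m). (k + m, k)" "\<lambda>(n, k). (k, n - k)"]) auto
  also have "\<dots> = (\<Sum>\<^sub>\<infinity>k. \<Sum>\<^sub>\<infinity>m. V k * W m)" by (rule infsum_Sigma'_banach[OF s', symmetric])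
  also have "\<dots> = (\<Sum>\<^sub>\<infinity>k. V k) * (\<Sum>\<^sub>\<infinity>k. W k)" by (simp add: infsum_cmult_right' infsum_cmult_left')
  finally show ?thesis using summable_on_Sigma_banach[OF s] by (simp add: has_sum_iff)
qed

instantiation l1z :: "{one, times}"
begin

lift_definition one_l1z :: l1z is "\<lambda>k. if k = 0 then 1 else 0"
  by (rule finite_nonzero_values_imp_summable_on) (auto intro: finite_subset[of _ "{0}"])

lift_definition times_l1z :: "l1z \<Rightarrow> l1z \<Rightarrow> l1z" is "\<lambda>V W n. \<Sum>\<^sub>\<infinity>k. V k * W (n - k)"
proof -
  fix V W :: "int \<Rightarrow> complex"
  assume VW: "(\<lambda>k. norm (V k)) summable_on UNIV" "(\<lambda>k. norm (W k)) summable_on UNIV"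
  have s: "(\<lambda>(n, k). norm (V k * W (n - k))) summable_on UNIV \<times> UNIV"
    using convolution_summable[OF VW] by simp
  have s': "(\<lambda>k. norm (V k * W (n - k))) summable_on UNIV" for n
    using summable_on_SigmaD1[OF s, of n] by simp
  show "(\<lambda>n. norm (\<Sum>\<^sub>\<infinity>k. V k * W (n - k))) summable_on UNIV"
    by (rule summable_on_comparison_test[OF summable_on_Sigma_banach[OF s]])
      (auto intro!: norm_infsum_bound s')
qed

instance ..

end

lemma coef_one: "coef 1 k = (if k = 0 then 1 else 0)" by transfer simp

lemma coef_mult: "coef (v * w) n = (\<Sum>\<^sub>\<infinity>k. coef v k * coef w (n - k))" by transfer simp

lemma coef_mult_abs_summable: "(\<lambda>k. norm (coef v k * coef w (n - k))) summable_on A"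
proof -
  have "(\<lambda>(n, k). norm (coef v k * coef w (n - k))) summable_on UNIV \<times> UNIV"
    using convolution_summable[of "coef v" "coef w"] by simp
  from summable_on_SigmaD1[OF this, of n] show ?thesis
    using summable_on_subset_banach[of _ UNIV A] by auto
qed

lemma coef_mult_has_sum: "((\<lambda>k. coef v k * coef w (n - k)) has_sum coef (v * w) n) UNIV"
  unfolding coef_mult by (rule has_sum_infsum, rule abs_summable_summable, rule coef_mult_abs_summable)

lemma norm_coef_mult_le: "norm (coef (v * w) n) \<le> (\<Sum>\<^sub>\<infinity>k. norm (coef v k) * norm (coef w (n - k)))"
  using norm_infsum_bound[OF coef_mult_abs_summable, of v w n UNIV] by (simp add: coef_mult norm_mult)

lemma ev_mult:
  assumes "t \<in> circle"
  shows "ev (v * w) t = ev v t * ev w t"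
proof -
  have "((\<lambda>n. \<Sum>\<^sub>\<infinity>k. (coef v k * t powi k) * (coef w (n - k) * t powi (n - k))) has_sum
    ev v t * ev w t) UNIV"
    unfolding ev_def by (rule convolution_infsum) (use assms in \<open>simp_all add: norm_mult\<close>)
  also have "(\<lambda>n. \<Sum>\<^sub>\<infinity>k. (coef v k * t powi k) * (coef w (n - k) * t powi (n - k))) =
    (\<lambda>n. coef (v * w) n * t powi n)" using circle_nonzero[OF assms]
    by (simp add: fun_eq_iff coef_mult power_int_diff mult.assoc flip: infsum_cmult_left')
  finally show ?thesis using has_sum_unique ev_has_sum[OF assms] by blast
qed

lemma ev_one [simp]: "ev 1 t = 1"
proof -
  have "ev 1 t = (\<Sum>\<^sub>\<infinity>k\<in>{0::int}. 1)"
    unfolding ev_def by (rule infsum_cong_neutral) (auto simp: coef_one)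
  then show ?thesis by simp
qed

instance l1z :: comm_ring_1
proof
  show "(0 :: l1z) \<noteq> 1" by (metis coef_one coef_simps(1) zero_neq_one)
qed (rule ev_inject, simp add: ev_mult ev_simps algebra_simps)+

instance l1z :: real_normed_algebra_1
proof
  fix v w :: l1z and r :: real
  show "norm (1 :: l1z) = 1"
  proof -
    have "norm (1 :: l1z) = (\<Sum>\<^sub>\<infinity>k\<in>{0 :: int}. 1)"
      unfolding norm_l1z_def by (rule infsum_cong_neutral) (auto simp: coef_one)
    then show ?thesis by simp
  qed
  show "r *\<^sub>R v * w = r *\<^sub>R (v * w)" "v * r *\<^sub>R w = r *\<^sub>R (v * w)"
    by (rule ev_inject, simp add: ev_mult ev_simps)+
  show "norm (v * w) \<le> norm v * norm w"
  proof -
    have "((\<lambda>n. \<Sum>\<^sub>\<infinity>k. norm (coef v k) * norm (coef w (n - k))) has_sum norm v * norm w) UNIV"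
      unfolding norm_l1z_def by (rule convolution_infsum) simp_all
    moreover have "((\<lambda>n. norm (coef (v * w) n)) has_sum norm (v * w)) UNIV"
      unfolding norm_l1z_def by (rule has_sum_infsum) simp
    ultimately show ?thesis using has_sum_mono norm_coef_mult_le by blast
  qed
qed

section \<open>Fourier coefficients of smooth functions\<close>

lemma ev_power: "t \<in> circle \<Longrightarrow> ev (w ^ n) t = ev w t ^ n" by (induction n) (auto simp: ev_mult)

lemma ev_exp:
  assumes "t \<in> circle"
  shows "ev (exp w) t = exp (ev w t)"
proof -
  have "(\<lambda>n. ev (w ^ n /\<^sub>R fact n) t) sums ev (exp w) t"
    by (rule bounded_linear.sums[OF bounded_linear_ev[OF assms] exp_converges])
  then have "(\<lambda>n. ev w t ^ n /\<^sub>R fact n) sums ev (exp w) t" by (simp add: ev_simps ev_power assms)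
  then show ?thesis using exp_converges sums_unique2 by blast
qed

lemma norm_monomial [simp]: "norm (monomial c m) = norm c"
proof -
  have "norm (monomial c m) = (\<Sum>\<^sub>\<infinity>k\<in>{m}. norm c)"
    unfolding norm_l1z_def by (rule infsum_cong_neutral) auto
  then show ?thesis by simp
qed

text \<open>On the circle conjugation is inversion, so Re t and Im t are combinations of t and 1/t.
  This connects the real polynomials of the Stone-Weierstrass theorem with Fourier series.\<close>

lemma real_polynomial_on_circle:
  assumes "real_polynomial_function p"
  shows "\<exists>w. \<forall>t\<in>circle. ev w t = complex_of_real (p t)" using assms
proof induction
  case (linear h)
  interpret bounded_linear h by fact
  define w where "w = monomial ((h 1 - \<i> * h \<i>) / 2) 1 + monomial ((h 1 + \<i> * h \<i>) / 2) (-1)"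
  have "ev w t = complex_of_real (h t)" if t: "t \<in> circle" for t
  proof -
    have "h t = h (Re t *\<^sub>R 1 + Im t *\<^sub>R \<i>)" by (rule arg_cong[of _ _ h]) (simp add: complex_eq_iff)
    also have "\<dots> = Re t * h 1 + Im t * h \<i>" by (simp add: add scaleR)
    finally have h: "h t = Re t * h 1 + Im t * h \<i>" .
    have "inverse t = cnj t"
      using t by (simp add: circle_def inverse_complex_def complex_eq_iff cmod_def)
    then have "ev w t = (h 1 - \<i> * h \<i>) / 2 * t + (h 1 + \<i> * h \<i>) / 2 * cnj t"
      using t by (simp add: w_def ev_simps power_int_minus)
    also have "\<dots> = complex_of_real (h t)" by (simp add: h complex_eq_iff field_simps)
    finally show ?thesis .
  qed
  then show ?case by blast
next
  case (const c)
  show ?case by (intro exI[of _ "monomial c 0"]) simp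
next
  case (add f g)
  then obtain v w where "\<forall>t\<in>circle. ev v t = complex_of_real (f t)" "\<forall>t\<in>circle. ev w t = complex_of_real (g t)"
    by blast
  then show ?case by (intro exI[of _ "v + w"]) (simp add: ev_simps)
next
  case (mult f g)
  then obtain v w where "\<forall>t\<in>circle. ev v t = complex_of_real (f t)" "\<forall>t\<in>circle. ev w t = complex_of_real (g t)"
    by blast
  then show ?case by (intro exI[of _ "v * w"]) (simp add: ev_mult)
qed

lemma ev_dense:
  assumes "continuous_on circle f" "e > 0"
  obtains w where "\<And>t. t \<in> circle \<Longrightarrow> norm (f t - ev w t) < e"
proof -
  obtain g where g: "polynomial_function g" "\<forall>t\<in>circle. norm (f t - g t) < e"
    using Stone_Weierstrass_polynomial_function[OF _ assms] by (auto simp: circle_def)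
  have "real_polynomial_function (Re \<circ> g)" "real_polynomial_function (Im \<circ> g)"
    using g(1) bounded_linear_Re bounded_linear_Im unfolding polynomial_function_def by auto
  then obtain u v where uv: "\<forall>t\<in>circle. ev u t = complex_of_real (Re (g t))"
      "\<forall>t\<in>circle. ev v t = complex_of_real (Im (g t))"
    using real_polynomial_on_circle unfolding o_def by meson
  have "ev (u + monomial \<i> 0 * v) t = g t" if "t \<in> circle" for t
    using that uv by (simp add: ev_simps ev_mult complex_eq_iff)
  then show ?thesis using that g(2) by metis
qed

lemma fc_mult_ev_eq_0:
  assumes f: "continuous_on circle f" and z: "\<And>k. fc f k = 0"
  shows "fc (\<lambda>t. f t * ev w t) 0 = 0"
proof (rule l1z_functional_eqI[OF bounded_linear_fc_mult_ev[OF f] bounded_linear_zero])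
  fix c m
  have "continuous_on circle (\<lambda>t. f t * t powi m)"
    by (intro continuous_on_mult f continuous_on_powi)
  from fc_cmult[OF this, of c 0] show "fc (\<lambda>t. f t * ev (monomial c m) t) 0 = 0"
    by (simp add: fc_mult_powi z mult_ac)
qed

text \<open>Uniqueness of Fourier coefficients: f is orthogonal to every \<open>ev w\<close>, the
  conjugate of f is a uniform limit of such functions, hence the integral of the square of its
  modulus vanishes.\<close>

lemma fc_eq_0_imp:
  assumes f: "continuous_on circle f" and z: "\<And>k. fc f k = 0" and t: "t \<in> circle"
  shows "f t = 0"
proof -
  obtain B where B: "\<And>t. t \<in> circle \<Longrightarrow> norm (f t) \<le> B" "B > 0" using circle_bounded[OF f] by metis
  have c: "continuous_on circle (\<lambda>t. cnj (f t))" by (intro continuous_intros f)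
  have "norm (fc (\<lambda>t. f t * cnj (f t)) 0) \<le> e" if e: "e > 0" for e
  proof -
    obtain w where w: "\<And>t. t \<in> circle \<Longrightarrow> norm (cnj (f t) - ev w t) < e / B"
      using ev_dense[OF c, of "e / B"] e B(2) by auto
    have "fc (\<lambda>t. f t * cnj (f t)) 0 = fc (\<lambda>t. f t * (cnj (f t) - ev w t) + f t * ev w t) 0"
      by (rule fc_cong) (simp add: algebra_simps)
    also have "\<dots> = fc (\<lambda>t. f t * (cnj (f t) - ev w t)) 0" using fc_mult_ev_eq_0[OF f z, of w]
      by (subst fc_add) (auto intro!: continuous_intros f continuous_on_ev)
    also have "norm \<dots> \<le> B * (e / B)"
    proof (rule norm_fc_le)
      show "continuous_on circle (\<lambda>t. f t * (cnj (f t) - ev w t))"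
        by (intro continuous_intros f continuous_on_ev)
      show "norm (f t * (cnj (f t) - ev w t)) \<le> B * (e / B)" if "t \<in> circle" for t
        unfolding norm_mult using B w[OF that] that by (intro mult_mono) auto
    qed
    finally show ?thesis using B(2) by simp
  qed
  then have "norm (fc (\<lambda>t. f t * cnj (f t)) 0) \<le> 0" by (rule field_le_epsilon) auto
  then have "fc (\<lambda>t. complex_of_real ((norm (f t))\<^sup>2)) 0 = 0"
    by (simp add: complex_norm_square del: of_real_power)
  then have "integral {0..2*pi} (\<lambda>x. complex_of_real ((norm (f (cis x)))\<^sup>2)) = 0"
    by (subst (asm) fc_continuous) (auto intro!: continuous_intros f)
  moreover have cn: "continuous_on {0..2*pi} (\<lambda>x. (norm (f (cis x)))\<^sup>2)"
    by (intro continuous_intros continuous_on_cis_comp f)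
  ultimately have "integral {0..2*pi} (\<lambda>x. (norm (f (cis x)))\<^sup>2) = 0"
    using integral_linear[OF integrable_continuous_real[OF cn] bounded_linear_of_real[where 'a = complex]]
    by (simp add: o_def)
  then have "\<forall>x\<in>{0..2*pi}. (norm (f (cis x)))\<^sup>2 = 0" using integral_eq_0_iff[OF cn] by simp
  then show ?thesis using t unfolding circle_eq_cis by auto
qed

lemma summable_inverse_squares_int: "(\<lambda>k::int. 1 / (of_int k)\<^sup>2 :: real) summable_on UNIV"
proof -
  have "summable (\<lambda>n. norm (1 / (real n)\<^sup>2))"
    using inverse_power_summable[of 2, where 'a = real] by (simp add: inverse_eq_divide)
  then have *: "(\<lambda>n. 1 / (real n)\<^sup>2) summable_on UNIV" by (rule norm_summable_imp_summable_on)
  have "(\<lambda>k::int. 1 / (of_int k)\<^sup>2 :: real) summable_on range int"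
    using * by (subst summable_on_reindex) (auto simp: o_def)
  moreover have "(\<lambda>k::int. 1 / (of_int k)\<^sup>2 :: real) summable_on range (\<lambda>n. - int n)"
    using * by (subst summable_on_reindex) (auto simp: o_def inj_on_def)
  ultimately have "(\<lambda>k::int. 1 / (of_int k)\<^sup>2 :: real) summable_on (range int \<union> range (\<lambda>n. - int n))"
    by (rule summable_on_union)
  moreover have "k \<in> range int \<union> range (\<lambda>n. - int n)" for k by (cases k rule: int_cases2) auto
  then have "range int \<union> range (\<lambda>n. - int n) = UNIV" by blast
  ultimately show ?thesis by simp
qed

text \<open>Twice the value of the Riemann zeta function at 2, since the term for k = 0 is 1/0 =
  0.\<close>

definition zeta2 :: real where "zeta2 = (\<Sum>\<^sub>\<infinity>k::int. 1 / (of_int k)\<^sup>2)"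

lemma l1z_norm_le_inverse_squares:
  assumes "norm (coef w 0) \<le> A" "\<And>k. k \<noteq> 0 \<Longrightarrow> norm (coef w k) \<le> B / (of_int k)\<^sup>2" "B \<ge> 0"
  shows "norm w \<le> A + B * zeta2"
proof -
  have B: "(\<lambda>k::int. B * (1 / (of_int k)\<^sup>2)) summable_on UNIV"
    by (intro summable_on_cmult_right summable_inverse_squares_int)
  have "restr {0} w = monomial (coef w 0) 0" by (rule l1z_eqI) simp
  then have 1: "norm (restr {0} w) \<le> A" using assms(1) by simp
  have "norm (restr (-{0}) w) \<le> (\<Sum>\<^sub>\<infinity>k::int. B * (1 / (of_int k)\<^sup>2))" unfolding norm_l1z_def
    by (rule infsum_mono[OF coef_abs_summable B]) (use assms in auto)
  also have "\<dots> = B * zeta2" by (simp add: zeta2_def infsum_cmult_right' del: times_divide_eq_right)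
  finally have 2: "norm (restr (-{0}) w) \<le> B * zeta2" .
  have "restr {0} w + restr (-{0}) w = w" by (rule l1z_eqI) auto
  then show ?thesis using norm_triangle_ineq[of "restr {0} w" "restr (-{0}) w"] 1 2 by simp
qed

lemma fc_C2_bound:
  fixes F1 F2 :: "real \<Rightarrow> complex"
  assumes f: "continuous_on circle f"
    and F1: "\<And>x. ((\<lambda>x. f (cis x)) has_vector_derivative F1 x) (at x)"
    and F2: "\<And>x. (F1 has_vector_derivative F2 x) (at x)"
    and per: "F1 (2*pi) = F1 0" and cont: "continuous_on UNIV F2"
    and B: "\<And>x. norm (F2 x) \<le> B" and k: "k \<noteq> 0"
  shows "norm (fc f k) \<le> B / (of_int k)\<^sup>2"
proof -
  define E where "E x = cis (- (of_int k * x))" for x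
  have E: "(E has_vector_derivative - \<i> * of_int k * E x) (at x)" for x unfolding E_def cis_conv_exp
    by (auto intro!: derivative_eq_intros has_vector_derivative_real_field simp: exp_of_real[symmetric] scaleR_conv_of_real)
  have per': "cis (2 * pi) = 1" "E (2*pi) = 1" "E 0 = 1"
    using cis_multiple_2pi[of "of_int (-k)"] cis_2pi by (simp_all add: E_def mult.commute del: cis_2pi)
  \<comment> \<open>A single antiderivative performs both integrations by parts: differentiating it,
    the two terms with \<open>F1\<close> cancel, and by periodicity its boundary values
    agree.\<close>
  have "((\<lambda>x. E x * (F1 x + \<i> * of_int k * f (cis x))) has_vector_derivative
    E x * F2 x + (of_int k)\<^sup>2 * (f (cis x) * E x)) (at x)" for x
    by (rule has_vector_derivative_eq_rhs, rule has_vector_derivative_mult[OF E],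
        rule has_vector_derivative_add[OF F2], rule has_vector_derivative_mult_right[OF F1])
      (simp add: algebra_simps power2_eq_square)
  then have "((\<lambda>x. E x * F2 x + (of_int k)\<^sup>2 * (f (cis x) * E x)) has_integral
     (E (2*pi) * (F1 (2*pi) + \<i> * of_int k * f (cis (2*pi))) - E 0 * (F1 0 + \<i> * of_int k * f (cis 0)))) {0..2*pi}"
    by (intro fundamental_theorem_of_calculus) (auto intro: has_vector_derivative_at_within)
  then have 1: "((\<lambda>x. E x * F2 x + (of_int k)\<^sup>2 * (f (cis x) * E x)) has_integral 0) {0..2*pi}"
    by (simp add: per per')
  have i: "(\<lambda>x. E x * F2 x) integrable_on {0..2*pi}" unfolding E_def
    by (intro integrable_continuous_real continuous_intros continuous_on_subset[OF cont]) auto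
  have j: "(\<lambda>x. f (cis x) * E x) integrable_on {0..2*pi}"
    unfolding E_def by (rule fc_integrable[OF f])
  have "0 = integral {0..2*pi} (\<lambda>x. E x * F2 x) + (of_int k)\<^sup>2 * integral {0..2*pi} (\<lambda>x. f (cis x) * E x)"
    using integral_unique[OF 1] i j
    by (subst (asm) integral_add) (auto intro: integrable_on_mult_right)
  then have "(of_int k)\<^sup>2 * (2 * complex_of_real pi * fc f k) = - integral {0..2*pi} (\<lambda>x. E x * F2 x)"
    by (simp add: fc_continuous[OF f] E_def eq_neg_iff_add_eq_0 add.commute)
  then have "norm ((of_int k)\<^sup>2 * (2 * complex_of_real pi * fc f k)) = norm (integral {0..2*pi} (\<lambda>x. E x * F2 x))"
    by simp
  also have "\<dots> \<le> B * (2*pi - 0)" unfolding E_def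
    by (intro integral_bound continuous_intros continuous_on_subset[OF cont]) (auto simp: norm_mult B)
  finally have "2 * pi * ((of_int k)\<^sup>2 * norm (fc f k)) \<le> 2 * pi * B"
    by (simp add: norm_mult norm_power algebra_simps)
  then have "(of_int k)\<^sup>2 * norm (fc f k) \<le> B" by simp
  then show ?thesis using k by (simp add: pos_le_divide_eq mult.commute)
qed

text \<open>Coefficients of order 1/k^2 define an element of \<open>l1z\<close>; the difference of f
  and its evaluation is continuous with vanishing coefficients, hence zero.\<close>

lemma C2_imp_ev:
  fixes F1 F2 :: "real \<Rightarrow> complex"
  assumes f: "continuous_on circle f"
    and F1: "\<And>x. ((\<lambda>x. f (cis x)) has_vector_derivative F1 x) (at x)"
    and F2: "\<And>x. (F1 has_vector_derivative F2 x) (at x)"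
    and per: "F1 (2*pi) = F1 0" and cont: "continuous_on UNIV F2"
    and B: "\<And>x. norm (F2 x) \<le> B"
  obtains w where "\<And>t. t \<in> circle \<Longrightarrow> ev w t = f t"
proof -
  have 1: "(\<lambda>k::int. if k = 0 then 1 else 0 :: real) summable_on UNIV"
    by (rule finite_nonzero_values_imp_summable_on, rule finite_subset[of _ "{0}"]) auto
  have "(\<lambda>k::int. norm (fc f 0) * (if k = 0 then 1 else 0) + B * (1 / (of_int k)\<^sup>2)) summable_on UNIV"
    by (intro summable_on_add summable_on_cmult_right summable_inverse_squares_int 1)
  then have "(\<lambda>k. norm (fc f k)) summable_on UNIV"
  proof (rule summable_on_comparison_test)
    show "norm (fc f k) \<le> norm (fc f 0) * (if k = 0 then 1 else 0) + B * (1 / (of_int k)\<^sup>2)" for k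
      using fc_C2_bound[OF assms] by (cases "k = 0") simp_all
  qed simp
  then have w: "coef (Abs_l1z (fc f)) = fc f" by (intro Abs_l1z_inverse) auto
  have "f t - ev (Abs_l1z (fc f)) t = 0" if "t \<in> circle" for t
  proof (rule fc_eq_0_imp[OF _ _ that])
    show "continuous_on circle (\<lambda>t. f t - ev (Abs_l1z (fc f)) t)"
      by (intro continuous_on_diff f continuous_on_ev)
  qed (simp add: fc_diff f continuous_on_ev fc_ev w)
  then show ?thesis using that by auto
qed

section \<open>Logarithms in the Wiener algebra\<close>

definition trig_sum :: "int set \<Rightarrow> (int \<Rightarrow> complex) \<Rightarrow> real \<Rightarrow> complex" where
  "trig_sum F c x = (\<Sum>k\<in>F. c k * cis (of_int k * x))"

text \<open>The coefficients of the derivative of \<open>trig_sum\<close> with respect to the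
  angle.\<close>

definition dcoef :: "(int \<Rightarrow> complex) \<Rightarrow> int \<Rightarrow> complex" where
  "dcoef c k = \<i> * of_int k * c k"

lemma has_vector_derivative_trig_sum:
  "(trig_sum F c has_vector_derivative trig_sum F (dcoef c) x) (at x)"
  unfolding trig_sum_def[abs_def] dcoef_def
proof (rule has_vector_derivative_sum)
  fix k
  have "((\<lambda>x. cis (of_int k * x)) has_vector_derivative \<i> * of_int k * cis (of_int k * x)) (at x)"
    unfolding cis_conv_exp
    by (auto intro!: derivative_eq_intros has_vector_derivative_real_field simp: exp_of_real[symmetric] scaleR_conv_of_real)
  then show "((\<lambda>x. c k * cis (of_int k * x)) has_vector_derivative (\<i> * of_int k * c k) * cis (of_int k * x)) (at x)"
    by (rule has_vector_derivative_eq_rhs[OF has_vector_derivative_mult_right]) (simp add: algebra_simps)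
qed

lemma trig_sum_periodic: "trig_sum F c (2*pi) = trig_sum F c 0"
proof -
  have "cis (of_int k * (2*pi)) = 1" for k
    using cis_multiple_2pi[of "of_int k"] by (simp add: mult.commute)
  then show ?thesis by (simp add: trig_sum_def)
qed

lemma continuous_on_trig_sum: "continuous_on S (trig_sum F c)"
  unfolding trig_sum_def[abs_def] by (intro continuous_intros)

lemma norm_trig_sum_le: "norm (trig_sum F c x) \<le> (\<Sum>k\<in>F. norm (c k))"
  unfolding trig_sum_def by (rule sum_norm_le) (simp add: norm_mult)

text \<open>With 1/|q| <= s, two differentiations of q^(-n) cost a factor of order n^2 and leave a
  supremum of order s^n; the 1/k^2 decay of Fourier coefficients then bounds the norm. The
  polynomial factor is harmless in geometric series.\<close>

lemma inverse_power_bound: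
  fixes w :: l1z and F :: "int set"
  defines "q \<equiv> restr F w"
  assumes F: "finite F" and s: "s > 0" and lower: "\<And>t. t \<in> circle \<Longrightarrow> 1 / s \<le> norm (ev q t)"
  obtains v K where "\<And>t. t \<in> circle \<Longrightarrow> ev v t = inverse (ev q t)" "K \<ge> 0"
    "\<And>n. norm (v ^ n) \<le> s ^ n * (1 + (real n)\<^sup>2 * K)"
proof -
  define Q Q1 Q2 where "Q = trig_sum F (coef w)" and "Q1 = trig_sum F (dcoef (coef w))"
    and "Q2 = trig_sum F (dcoef (dcoef (coef w)))"
  have Q: "(Q has_vector_derivative Q1 x) (at x)" "(Q1 has_vector_derivative Q2 x) (at x)" for x
    unfolding Q_def Q1_def Q2_def by (rule has_vector_derivative_trig_sum)+
  have per: "Q (2*pi) = Q 0" "Q1 (2*pi) = Q1 0" unfolding Q_def Q1_def by (rule trig_sum_periodic)+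
  define B1 B2 where "B1 = (\<Sum>k\<in>F. norm (dcoef (coef w) k))"
    and "B2 = (\<Sum>k\<in>F. norm (dcoef (dcoef (coef w)) k))"
  have Qb: "norm (Q1 x) \<le> B1" "norm (Q2 x) \<le> B2" for x
    unfolding Q1_def Q2_def B1_def B2_def by (rule norm_trig_sum_le)+
  have B: "B1 \<ge> 0" "B2 \<ge> 0" unfolding B1_def B2_def by (simp_all add: sum_nonneg)
  have evQ: "ev q (cis x) = Q x" for x
    by (simp add: q_def Q_def trig_sum_def ev_restr_finite F cis_powi)
  define P where "P x = inverse (Q x)" for x
  have Qlow: "1 / s \<le> norm (Q x)" for x using lower[of "cis x"] by (simp add: evQ)
  have Qnz: "Q x \<noteq> 0" for x using s Qlow[of x] by auto
  have Pb: "norm (P x) \<le> s" for x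
    using le_imp_inverse_le[OF Qlow[of x]] s by (simp add: P_def norm_inverse)
  define P1 where "P1 x = - Q1 x * (P x)\<^sup>2" for x
  define P2 where "P2 x = - Q2 x * (P x)\<^sup>2 - 2 * Q1 x * P x * P1 x" for x
  have Pd: "((\<lambda>x. P x ^ n) has_vector_derivative of_nat n * P x ^ (n - 1) * P1 x) (at x)" for n x
  proof -
    have "((\<lambda>z. inverse z ^ n) has_field_derivative of_nat n * inverse (Q x) ^ (n - 1) * (- (inverse (Q x))\<^sup>2)) (at (Q x))"
      using Qnz[of x] by (auto intro!: derivative_eq_intros simp: power2_eq_square)
    from field_vector_diff_chain_at[OF Q(1) this] show ?thesis
      by (simp add: o_def P_def P1_def algebra_simps)
  qed
  have P1d: "(P1 has_vector_derivative P2 x) (at x)" for x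
  proof -
    have "((\<lambda>x. - (Q1 x * (P x)\<^sup>2)) has_vector_derivative - (Q1 x * (of_nat 2 * P x ^ (2 - 1) * P1 x) + Q2 x * (P x)\<^sup>2)) (at x)"
      by (rule has_vector_derivative_minus[OF has_vector_derivative_mult[OF Q(2) Pd]])
    then show ?thesis by (simp add: P1_def[abs_def] P2_def algebra_simps)
  qed
  define C1 where "C1 = B1 * s\<^sup>2"
  define C2 where "C2 = B2 * s\<^sup>2 + 2 * B1 * s * C1"
  have C: "C1 \<ge> 0" "C2 \<ge> 0" using B s by (simp_all add: C1_def C2_def)
  have P1b: "norm (P1 x) \<le> C1" for x unfolding P1_def C1_def norm_mult norm_power norm_minus_cancel
    by (intro mult_mono power_mono Qb Pb) (use B in auto)
  have P2b: "norm (P2 x) \<le> C2" for x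
  proof -
    have "norm (P2 x) \<le> norm (Q2 x * (P x)\<^sup>2) + norm (2 * Q1 x * P x * P1 x)"
      unfolding P2_def using norm_triangle_ineq4[of "- Q2 x * (P x)\<^sup>2" "2 * Q1 x * P x * P1 x"] by simp
    also have "\<dots> \<le> B2 * s\<^sup>2 + 2 * B1 * s * C1" unfolding norm_mult norm_power
      by (intro add_mono mult_mono power_mono Qb Pb P1b) (use B s C in auto)
    finally show ?thesis unfolding C2_def .
  qed
  \<comment> \<open>The first two derivatives of P^n, where P = 1/Q. For n <= 1 the truncated
    exponents do no harm, because the factor n or n - 1 vanishes.\<close>
  define F1 where "F1 n x = of_nat n * P x ^ (n - 1) * P1 x" for n x
  define F2 where "F2 n x = of_nat n * (P x ^ (n - 1) * P2 x + of_nat (n - 1) * P x ^ (n - 1 - 1) * P1 x * P1 x)" for n x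
  have F1d: "((\<lambda>x. inverse (ev q (cis x)) ^ n) has_vector_derivative F1 n x) (at x)" for n x
    using Pd[of n x] by (simp add: evQ P_def[abs_def] F1_def)
  have F2d: "(F1 n has_vector_derivative F2 n x) (at x)" for n x
    unfolding F1_def[abs_def] F2_def mult.assoc by (rule has_vector_derivative_mult_right)
      (use has_vector_derivative_mult[OF Pd P1d, of "n - 1" x] in \<open>simp add: mult.assoc\<close>)
  have Fper: "F1 n (2*pi) = F1 n 0" for n by (simp add: F1_def P_def P1_def per)
  have cont: "continuous_on UNIV Q" "continuous_on UNIV Q1" "continuous_on UNIV Q2"
    unfolding Q_def Q1_def Q2_def by (rule continuous_on_trig_sum)+
  have contP: "continuous_on UNIV P" "continuous_on UNIV P1" "continuous_on UNIV P2"
    unfolding P1_def[abs_def] P2_def[abs_def] P_def[abs_def]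
    by (intro continuous_intros cont; simp add: Qnz)+
  have F2c: "continuous_on UNIV (F2 n)" for n
    unfolding F2_def[abs_def] by (intro continuous_intros contP)
  \<comment> \<open>Write s^(n-1) and s^(n-2) as s^n / s and s^n / s^2, and bound n and n (n - 1) by
    n^2.\<close>
  define K where "K = C2 / s + C1\<^sup>2 / s\<^sup>2"
  have K: "K \<ge> 0" using C s by (simp add: K_def)
  have F2b: "norm (F2 n x) \<le> (real n)\<^sup>2 * s ^ n * K" for n x
  proof -
    have "norm (F2 n x) \<le> real n * (norm (P x ^ (n - 1) * P2 x) + norm (of_nat (n - 1) * P x ^ (n - 1 - 1) * P1 x * P1 x))"
      unfolding F2_def norm_mult[of "of_nat n"] norm_of_nat
      by (intro mult_left_mono norm_triangle_ineq) simp
    also have "\<dots> \<le> real n * (s ^ (n - 1) * C2 + real (n - 1) * s ^ (n - 1 - 1) * C1 * C1)"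
      unfolding norm_mult norm_power norm_of_nat
      by (intro mult_mono add_mono power_mono Pb P1b P2b) (use s C in auto)
    also have "\<dots> = real n * s ^ n * (C2 / s) + real n * real (n - 1) * s ^ n * (C1\<^sup>2 / s\<^sup>2)"
      using s by (cases n; cases "n - 1") (auto simp: field_simps power2_eq_square)
    also have "\<dots> \<le> (real n)\<^sup>2 * s ^ n * (C2 / s) + (real n)\<^sup>2 * s ^ n * (C1\<^sup>2 / s\<^sup>2)"
    proof -
      have "real n \<le> (real n)\<^sup>2" "real n * real (n - 1) \<le> (real n)\<^sup>2"
        by (cases n; simp add: power2_eq_square algebra_simps)+
      then show ?thesis using s C by (intro add_mono mult_right_mono) auto
    qed
    also have "\<dots> = (real n)\<^sup>2 * s ^ n * K" by (simp add: K_def algebra_simps)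
    finally show ?thesis .
  qed
  have qnz: "ev q t \<noteq> 0" if "t \<in> circle" for t using that evQ Qnz unfolding circle_eq_cis by auto
  have fcont: "continuous_on circle (\<lambda>t. inverse (ev q t) ^ n)" for n
    by (intro continuous_intros continuous_on_ev) (simp add: qnz)
  obtain v where v: "\<And>t. t \<in> circle \<Longrightarrow> ev v t = inverse (ev q t) ^ 1"
    using C2_imp_ev[OF fcont F1d F2d Fper F2c F2b] by blast
  have "norm (v ^ n) \<le> s ^ n + (real n)\<^sup>2 * s ^ n * K * zeta2" for n
  proof (rule l1z_norm_le_inverse_squares)
    have "coef (v ^ n) k = fc (\<lambda>t. inverse (ev q t) ^ n) k" for k
      unfolding fc_ev[symmetric] by (rule fc_cong) (simp add: ev_power v)
    then show "norm (coef (v ^ n) k) \<le> (real n)\<^sup>2 * s ^ n * K / (of_int k)\<^sup>2" if "k \<noteq> 0" for k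
      using fc_C2_bound[OF fcont F1d F2d Fper F2c F2b that] by simp
    have "norm (inverse (ev q t)) \<le> s" if "t \<in> circle" for t
      using le_imp_inverse_le[OF lower[OF that]] s by (simp add: norm_inverse)
    then have "norm (fc (\<lambda>t. inverse (ev q t) ^ n) 0) \<le> s ^ n"
      by (intro norm_fc_le[OF fcont]) (simp add: norm_power power_mono)
    then show "norm (coef (v ^ n) 0) \<le> s ^ n"
      using \<open>\<And>k. coef (v ^ n) k = fc (\<lambda>t. inverse (ev q t) ^ n) k\<close> by simp
  qed (use K s in simp)
  moreover have "zeta2 \<ge> 0" unfolding zeta2_def by (rule infsum_nonneg) simp
  ultimately show ?thesis using that[of v "K * zeta2"] v K by (simp add: algebra_simps)
qed

text \<open>Near x the increment of l has imaginary part below pi in modulus. It is therefore the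
  principal logarithm of Q y / Q x, which is differentiable because the quotient is close to
  1.\<close>

lemma has_vector_derivative_log:
  fixes l Q :: "real \<Rightarrow> complex"
  assumes l: "continuous_on UNIV l" "\<And>x. exp (l x) = Q x"
    and Q: "(Q has_vector_derivative Q1) (at x)"
  shows "(l has_vector_derivative Q1 / Q x) (at x)"
proof -
  have "isCont l x" using l(1) continuous_on_eq_continuous_at by blast
  then obtain d where d: "d > 0" "\<And>y. dist y x < d \<Longrightarrow> dist (l y) (l x) < pi"
    using pi_gt_zero unfolding continuous_at_eps_delta by meson
  have Qx: "Q x \<noteq> 0" using l(2)[of x] by auto
  have "((\<lambda>y. Q y / Q x) has_vector_derivative Q1 / Q x) (at x)"
    using has_vector_derivative_mult_left[OF Q, of "inverse (Q x)"] by (simp add: divide_inverse)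
  moreover have "(Ln has_field_derivative 1) (at (Q x / Q x))"
    using Qx by (auto intro!: derivative_eq_intros)
  ultimately have "((\<lambda>y. Ln (Q y / Q x)) has_vector_derivative Q1 / Q x) (at x)"
    using field_vector_diff_chain_at[of "\<lambda>y. Q y / Q x" "Q1 / Q x" x Ln 1] by (simp add: o_def)
  then have "((\<lambda>y. l x + Ln (Q y / Q x)) has_vector_derivative 0 + Q1 / Q x) (at x)"
    by (intro has_vector_derivative_add has_vector_derivative_const)
  then have "(l has_vector_derivative 0 + Q1 / Q x) (at x)"
  proof (rule has_vector_derivative_transform_within[OF _ d(1)])
    fix y assume "dist y x < d"
    then have "\<bar>Im (l y - l x)\<bar> < pi"
      using d(2) abs_Im_le_cmod[of "l y - l x"] unfolding dist_norm by fastforce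
    then have "Ln (exp (l y - l x)) = l y - l x" by (intro Ln_exp) auto
    then show "l x + Ln (Q y / Q x) = l y" by (simp add: exp_diff l(2))
  qed simp
  then show ?thesis by simp
qed

theorem wiener_levy_log:
  assumes L: "continuous_on circle L" "\<And>t. t \<in> circle \<Longrightarrow> exp (L t) = ev A t"
  obtains w where "\<And>t. t \<in> circle \<Longrightarrow> ev w t = L t"
proof -
  have "compact ((\<lambda>t. norm (ev A t)) ` circle)"
    by (intro compact_continuous_image continuous_intros continuous_on_ev) (simp add: circle_def)
  moreover have "circle \<noteq> {}" using cis_circle by blast
  ultimately obtain t0 where t0: "t0 \<in> circle" "\<And>t. t \<in> circle \<Longrightarrow> norm (ev A t0) \<le> norm (ev A t)"
    using compact_attains_inf[of "(\<lambda>t. norm (ev A t)) ` circle"] by auto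
  define d where "d = norm (ev A t0)"
  have d: "d > 0" unfolding d_def zero_less_norm_iff by (metis L(2) t0(1) exp_not_eq_zero)
  obtain F where F: "finite F" "\<And>S. F \<inter> S = {} \<Longrightarrow> norm (restr S A) < d / 3"
    using restr_approx[of "d / 3" "{}" A] d by auto
  define q where "q = restr F A"
  have "A - q = restr (-F) A" unfolding q_def by (rule l1z_eqI) simp
  then have qA: "norm (q - A) < d / 3" using F(2)[of "-F"] by (simp add: norm_minus_commute)
  \<comment> \<open>Since |q| >= d - d/3 = 2d/3, this makes 1/s a lower bound of |q|, while norm (q
    - A) * s < 1/2.\<close>
  define s where "s = 3 / (2 * d)"
  have s: "s > 0" using d by (simp add: s_def)
  have lower: "1 / s \<le> norm (ev q t)" if t: "t \<in> circle" for t
  proof -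
    have "norm (ev A t) - norm (ev q t) \<le> norm (ev (A - q) t)"
      using norm_triangle_ineq2 by (simp add: ev_simps t)
    also have "\<dots> \<le> d / 3" using norm_ev_le[OF t, of "A - q"] qA by (simp add: norm_minus_commute)
    finally show ?thesis using t0(2)[OF t] by (simp add: s_def d_def field_simps)
  qed
  obtain v K where v: "\<And>t. t \<in> circle \<Longrightarrow> ev v t = inverse (ev q t)" "K \<ge> 0"
      "\<And>n. norm (v ^ n) \<le> s ^ n * (1 + (real n)\<^sup>2 * K)"
    using inverse_power_bound[OF F(1) s, of A] lower unfolding q_def by metis
  have qnz: "ev q t \<noteq> 0" if "t \<in> circle" for t using lower[OF that] s by auto
  have Anz: "ev A t \<noteq> 0" if "t \<in> circle" for t by (metis L(2) that exp_not_eq_zero)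
  \<comment> \<open>The element 1 - A/q. Its norm may exceed 1, as the norm of 1/q is not controlled
    by s; only its powers decay, which is why all powers of \<open>v\<close> had to be
    bounded.\<close>
  define r where "r = (q - A) * v"
  have rn: "norm (r ^ n) \<le> (1 / 2) ^ n * (1 + (real n)\<^sup>2 * K)" for n
  proof -
    have "norm (r ^ n) \<le> norm (q - A) ^ n * norm (v ^ n)" unfolding r_def power_mult_distrib
      by (rule order.trans[OF norm_mult_ineq]) (intro mult_right_mono norm_power_ineq norm_ge_zero)
    also have "\<dots> \<le> (d / 3) ^ n * (s ^ n * (1 + (real n)\<^sup>2 * K))"
      using qA d by (intro mult_mono power_mono v) auto
    also have "\<dots> = (d / 3 * s) ^ n * (1 + (real n)\<^sup>2 * K)"
      by (simp only: power_mult_distrib mult.assoc)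
    also have "d / 3 * s = 1 / 2" using d by (simp add: s_def)
    finally show ?thesis .
  qed
  have "summable (\<lambda>n. (1 / 2) ^ n * (1 + (real n)\<^sup>2 * K))"
  \<comment> \<open>From n = 5 on, 2 (n + 1)^2 <= 3 n^2; together with the factor 1/2 this gives the
    ratio 3/4.\<close>
  proof (rule summable_ratio_test[of "3 / 4" 5])
    fix n :: nat assume n: "n \<ge> 5"
    have "5 * real n \<le> real n * real n" using n by (intro mult_right_mono) auto
    moreover have "2 \<le> real n" using n by simp
    moreover have "(real (Suc n))\<^sup>2 = real n * real n + 2 * real n + 1"
      by (simp add: power2_eq_square algebra_simps)
    ultimately have "2 * (real (Suc n))\<^sup>2 \<le> 3 * (real n)\<^sup>2" unfolding power2_eq_square by linarith
    then have "2 * ((real (Suc n))\<^sup>2 * K) \<le> 3 * ((real n)\<^sup>2 * K)"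
      using mult_right_mono[OF _ v(2)] by (simp only: mult.assoc[symmetric])
    then have "(1 / 2) * (1 + (real (Suc n))\<^sup>2 * K) \<le> 3 / 4 * (1 + (real n)\<^sup>2 * K)" by simp
    then have "(1 / 2) ^ n * ((1 / 2) * (1 + (real (Suc n))\<^sup>2 * K)) \<le> (1 / 2) ^ n * (3 / 4 * (1 + (real n)\<^sup>2 * K))"
      by (rule mult_left_mono) simp
    then show "norm ((1 / 2) ^ Suc n * (1 + (real (Suc n))\<^sup>2 * K)) \<le> 3 / 4 * norm ((1 / 2) ^ n * (1 + (real n)\<^sup>2 * K))"
      using v(2) by (simp add: abs_mult mult_ac)
  qed simp
  then have rs: "summable (\<lambda>n. r ^ n /\<^sub>R real n)"
  proof (rule summable_comparison_test'[where N = 0])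
    fix n :: nat
    have "norm (r ^ n /\<^sub>R real n) \<le> norm (r ^ n)" by (cases n) (auto simp: field_simps)
    then show "norm (r ^ n /\<^sub>R real n) \<le> (1 / 2) ^ n * (1 + (real n)\<^sup>2 * K)" using rn[of n] by simp
  qed
  \<comment> \<open>R is -log(1 - r) = log(q/A). The term n = 0 vanishes because the inverse of 0 is
    0.\<close>
  define R where "R = (\<Sum>n. r ^ n /\<^sub>R real n)"
  have evr: "ev r t = 1 - ev A t / ev q t" if "t \<in> circle" for t
    using that qnz[OF that] by (simp add: r_def ev_mult ev_simps v field_simps)
  have expR: "exp (ev R t) = ev q t / ev A t" if t: "t \<in> circle" for t
  proof -
    have "norm (ev r t) = norm (ev (q - A) t) / norm (ev q t)"
      using t by (simp add: r_def ev_mult v norm_mult norm_inverse divide_inverse)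
    also have "\<dots> \<le> (d / 3) / (1 / s)"
      using norm_ev_le[OF t, of "q - A"] qA lower[OF t] s d by (intro frac_le) auto
    also have "\<dots> < 1" using d by (simp add: s_def)
    finally have "(\<lambda>n. - (ev r t ^ n) / of_nat n) sums ln (1 - ev r t)"
      using Ln_series'[of "- ev r t"] by simp
    then have 1: "(\<lambda>n. - (ev r t ^ n / of_nat n)) sums ln (1 - ev r t)" by simp
    have "(\<lambda>n. ev (r ^ n /\<^sub>R real n) t) sums ev R t"
      unfolding R_def by (rule bounded_linear.sums[OF bounded_linear_ev[OF t] summable_sums[OF rs]])
    then have "(\<lambda>n. ev r t ^ n / of_nat n) sums ev R t"
      unfolding ev_simps(5)[OF t] ev_power[OF t] by (simp add: scaleR_conv_of_real divide_inverse mult.commute)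
    then have "ln (1 - ev r t) = - ev R t" using 1 sums_minus sums_unique2 by blast
    moreover have "1 - ev r t \<noteq> 0" using Anz[OF t] qnz[OF t] by (simp add: evr[OF t])
    ultimately have "exp (- ev R t) = ev A t / ev q t"
      using exp_Ln[of "1 - ev r t"] evr[OF t] by simp
    moreover have "exp (ev R t) = inverse (exp (- ev R t))" by (simp add: exp_minus)
    ultimately show ?thesis by simp
  qed
  \<comment> \<open>A continuous logarithm of the trigonometric polynomial q. As a function of the
    angle it is twice differentiable, so it belongs to the algebra, and so does L = l - R.\<close>
  define l where "l t = L t + ev R t" for t
  have lc: "continuous_on circle l"
    unfolding l_def by (intro continuous_intros L(1) continuous_on_ev)
  have el: "exp (l t) = ev q t" if "t \<in> circle" for t
    using Anz[OF that] by (simp add: l_def exp_add L(2)[OF that] expR[OF that])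
  define Q Q1 Q2 where "Q = trig_sum F (coef A)" and "Q1 = trig_sum F (dcoef (coef A))"
    and "Q2 = trig_sum F (dcoef (dcoef (coef A)))"
  have Q: "(Q has_vector_derivative Q1 x) (at x)" "(Q1 has_vector_derivative Q2 x) (at x)" for x
    unfolding Q_def Q1_def Q2_def by (rule has_vector_derivative_trig_sum)+
  have per: "Q (2*pi) = Q 0" "Q1 (2*pi) = Q1 0" unfolding Q_def Q1_def by (rule trig_sum_periodic)+
  have evQ: "exp (l (cis x)) = Q x" for x
    by (simp add: el) (simp add: q_def Q_def trig_sum_def ev_restr_finite F cis_powi)
  have Qnz: "Q x \<noteq> 0" for x using evQ[of x] by auto
  have ld: "((\<lambda>x. l (cis x)) has_vector_derivative Q1 x / Q x) (at x)" for x
    by (rule has_vector_derivative_log[OF continuous_on_cis_comp[OF lc] evQ Q(1)])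
  define G where "G x = Q2 x / Q x - (Q1 x / Q x)\<^sup>2" for x
  have gd: "((\<lambda>x. Q1 x / Q x) has_vector_derivative G x) (at x)" for x
  proof -
    have "((\<lambda>x. inverse (Q x)) has_vector_derivative Q1 x * - (inverse (Q x))\<^sup>2) (at x)"
    proof -
      have "(inverse has_field_derivative - (inverse (Q x))\<^sup>2) (at (Q x))"
        using DERIV_inverse[OF Qnz[of x]] by (simp add: numeral_2_eq_2)
      from field_vector_diff_chain_at[OF Q(1) this] show ?thesis by (simp add: o_def)
    qed
    from has_vector_derivative_mult[OF Q(2) this] show ?thesis
      by (simp add: G_def divide_inverse power2_eq_square algebra_simps)
  qed
  have Qc: "continuous_on UNIV Q" "continuous_on UNIV Q1" "continuous_on UNIV Q2"
    unfolding Q_def Q1_def Q2_def by (rule continuous_on_trig_sum)+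
  have Gc: "continuous_on UNIV G"
    unfolding G_def[abs_def] by (intro continuous_intros Qc) (auto simp: Qnz)
  obtain B1 B2 where B: "\<And>x. norm (Q1 x) \<le> B1" "\<And>x. norm (Q2 x) \<le> B2"
    unfolding Q1_def Q2_def using norm_trig_sum_le by meson
  have Ql: "1 / s \<le> norm (Q x)" for x using lower[of "cis x"] el[of "cis x"] evQ[of x] by simp
  have Gb: "norm (G x) \<le> B2 / (1 / s) + (B1 / (1 / s))\<^sup>2" for x
  proof -
    have "norm (G x) \<le> norm (Q2 x) / norm (Q x) + (norm (Q1 x) / norm (Q x))\<^sup>2"
      unfolding G_def using norm_triangle_ineq4[of "Q2 x / Q x" "(Q1 x / Q x)\<^sup>2"]
      by (simp add: norm_divide norm_power power_divide)
    also have "\<dots> \<le> B2 / (1 / s) + (B1 / (1 / s))\<^sup>2"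
      using s order.trans[OF norm_ge_zero B(1)] order.trans[OF norm_ge_zero B(2)]
      by (intro add_mono power_mono frac_le B Ql) auto
    finally show ?thesis .
  qed
  obtain u where "\<And>t. t \<in> circle \<Longrightarrow> ev u t = l t" using C2_imp_ev[OF lc ld gd _ Gc Gb] per by auto
  then have "ev (u - R) t = L t" if "t \<in> circle" for t using that by (simp add: ev_simps l_def)
  then show ?thesis using that by blast
qed

section \<open>Factors with one-sided spectrum\<close>

text \<open>A path avoiding 0 has a continuous logarithm along the parameter interval; its end
  values differ by the winding number times 2 pi i, so index 0 lets it descend to the
  circle.\<close>

lemma continuous_log_exists:
  assumes a: "continuous_on circle a" "\<And>t. t \<in> circle \<Longrightarrow> a t \<noteq> 0" and ind: "cind a = 0"
  obtains L where "continuous_on circle L" "\<And>t. t \<in> circle \<Longrightarrow> exp (L t) = a t"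
proof -
  define p where "p s = a (cis (2 * pi * s))" for s
  have "path p" unfolding path_def p_def
    by (rule continuous_on_compose2[OF a(1)]) (auto intro!: continuous_intros)
  moreover have "0 \<notin> path_image p" unfolding path_image_def p_def using a(2) cis_circle by fastforce
  ultimately obtain q where q: "path q"
      "pathfinish q - pathstart q = 2 * of_real pi * \<i> * winding_number p 0"
      "\<And>s. s \<in> {0..1} \<Longrightarrow> p s = 0 + exp (q s)" using winding_number_as_continuous_log by blast
  have "winding_number p 0 = 0" using ind by (simp add: cind_def p_def[abs_def])
  then have q01: "q 1 = q 0" using q(2) by (simp add: pathfinish_def pathstart_def)
  define L where "L t = q (Arg2pi t / (2 * pi))" for t
  have L: "L (cis x) = q (x / (2 * pi))" if "x \<in> {0..2*pi}" for x
  proof (cases "x = 2 * pi")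
    case True
    then show ?thesis using q01 by (simp add: L_def Arg2pi_of_real[of 1, simplified])
  next
    case False
    then have "Arg2pi (cis x) = x"
      using that by (intro Arg2pi_unique[of 1]) (auto simp: cis_conv_exp)
    then show ?thesis by (simp add: L_def)
  qed
  have qc: "continuous_on {0..2*pi} (\<lambda>x. q (x / (2 * pi)))" using q(1) unfolding path_def
    by (rule continuous_on_compose2) (auto intro!: continuous_intros simp: field_simps)
  have "continuous_on circle L"
  \<comment> \<open>\<open>Arg2pi\<close> jumps at t = 1, so continuity is not visible from the
    definition of L. But the graph of L is the continuous image of a compact interval, thus
    closed.\<close>
  proof (rule continuous_from_closed_graph)
    have "compact ((\<lambda>x. (cis x, q (x / (2 * pi)))) ` {0..2*pi})"
      by (intro compact_continuous_image continuous_intros qc) simp_all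
    moreover have "(\<lambda>x. (cis x, q (x / (2 * pi)))) ` {0..2*pi} = (\<lambda>t. (t, L t)) ` circle"
    proof -
      have "(\<lambda>x. (cis x, q (x / (2 * pi)))) ` {0..2*pi} = (\<lambda>x. (cis x, L (cis x))) ` {0..2*pi}"
        by (rule image_cong) (use L in auto)
      also have "\<dots> = (\<lambda>t. (t, L t)) ` cis ` {0..2*pi}" by (simp add: image_image)
      also have "cis ` {0..2*pi} = circle" using circle_eq_cis by blast
      finally show ?thesis .
    qed
    ultimately show "closed ((\<lambda>t. (t, L t)) ` circle)" by (simp add: compact_imp_closed)
    show "compact ((\<lambda>x. q (x / (2 * pi))) ` {0..2*pi})" by (intro compact_continuous_image qc) simp
    show "L \<in> circle \<rightarrow> (\<lambda>x. q (x / (2 * pi))) ` {0..2*pi}" by (auto simp: circle_eq_cis L)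
  qed
  moreover have "exp (L t) = a t" if t: "t \<in> circle" for t
  proof -
    obtain x where x: "x \<in> {0..2*pi}" "t = cis x" using t circle_eq_cis by blast
    have "p (x / (2 * pi)) = exp (q (x / (2 * pi)))"
      using q(3)[of "x / (2 * pi)"] x(1) by (simp add: field_simps)
    then show ?thesis using x by (simp add: L p_def)
  qed
  ultimately show ?thesis using that by blast
qed

section \<open>Spectral supports and mean values\<close>

definition supported :: "int set \<Rightarrow> l1z \<Rightarrow> bool" where
  "supported S w \<longleftrightarrow> (\<forall>k. k \<notin> S \<longrightarrow> coef w k = 0)"

lemma supported_restr [simp]: "supported S (restr S w)" by (simp add: supported_def)

lemma supported_one: "0 \<in> S \<Longrightarrow> supported S 1" by (auto simp: supported_def coef_one)

lemma supported_uminus: "supported S w \<Longrightarrow> supported S (- w)" by (simp add: supported_def)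

lemma supported_mult:
  assumes "supported S v" "supported T w" "\<And>i j. i \<in> S \<Longrightarrow> j \<in> T \<Longrightarrow> i + j \<in> R"
  shows "supported R (v * w)" unfolding supported_def
proof (intro allI impI)
  fix n assume n: "n \<notin> R"
  have "coef v k * coef w (n - k) = 0" for k
  proof (cases "k \<in> S \<and> n - k \<in> T")
    case True
    then show ?thesis using assms(3)[of k "n - k"] n by simp
  qed (use assms in \<open>auto simp: supported_def\<close>)
  then show "coef (v * w) n = 0" unfolding coef_mult by (simp only: infsum_0_simp)
qed

lemma supported_power:
  assumes "supported S w" "0 \<in> S" "\<And>i j. i \<in> S \<Longrightarrow> j \<in> S \<Longrightarrow> i + j \<in> S"
  shows "supported S (w ^ n)" by (induction n) (auto intro: supported_one supported_mult assms)

lemma supported_exp: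
  assumes "supported S w" "0 \<in> S" "\<And>i j. i \<in> S \<Longrightarrow> j \<in> S \<Longrightarrow> i + j \<in> S"
  shows "supported S (exp w)" unfolding supported_def
proof (intro allI impI)
  fix k assume k: "k \<notin> S"
  have "(\<lambda>n. coef (w ^ n /\<^sub>R fact n) k) sums coef (exp w) k"
    by (rule bounded_linear.sums[OF bounded_linear_coef exp_converges])
  moreover have "coef (w ^ n /\<^sub>R fact n) k = 0" for n
    using supported_power[OF assms, of n] k by (simp add: supported_def)
  ultimately have "(\<lambda>n. 0) sums coef (exp w) k" by simp
  then show "coef (exp w) k = 0" by (simp add: sums_iff)
qed

text \<open>For spectra on the same side of 0 only k = 0 contributes to the convolution.\<close>

lemma coef_mult_0:
  assumes "supported {0..} v \<and> supported {0..} w \<or> supported {..0} v \<and> supported {..0} w"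
  shows "coef (v * w) 0 = coef v 0 * coef w 0"
proof -
  have "coef v k * coef w (0 - k) = 0" if "k \<noteq> 0" for k
    using assms that by (cases "k < 0") (auto simp: supported_def)
  then have "coef (v * w) 0 = (\<Sum>\<^sub>\<infinity>k\<in>{0}. coef v k * coef w (0 - k))"
    unfolding coef_mult by (intro infsum_cong_neutral) auto
  then show ?thesis by simp
qed

lemma coef_exp_0:
  assumes "supported {0..} w \<or> supported {..0} w"
  shows "coef (exp w) 0 = exp (coef w 0)"
proof -
  have sp: "supported {0..} (w ^ n) \<or> supported {..0} (w ^ n)" for n
    using assms supported_power[of "{0..}" w n] supported_power[of "{..0}" w n] by auto
  have "coef (w ^ n) 0 = coef w 0 ^ n" for n
  proof (induction n)
    case (Suc n)
    have "coef (w * w ^ n) 0 = coef w 0 * coef (w ^ n) 0"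
      using assms supported_power[of "{0..}" w n] supported_power[of "{..0}" w n]
      by (intro coef_mult_0) auto
    then show ?case using Suc by simp
  qed (simp add: coef_one)
  moreover have "(\<lambda>n. coef (w ^ n /\<^sub>R fact n) 0) sums coef (exp w) 0"
    by (rule bounded_linear.sums[OF bounded_linear_coef exp_converges])
  ultimately have "(\<lambda>n. coef w 0 ^ n /\<^sub>R fact n) sums coef (exp w) 0" by simp
  then show ?thesis using exp_converges sums_unique2 by blast
qed

lemma fc_eq_coef: "(\<And>t. t \<in> circle \<Longrightarrow> f t = ev w t) \<Longrightarrow> fc f k = coef w k" using fc_cong fc_ev by metis

lemma LinfT_continuous:
  assumes "continuous_on circle f"
  shows "LinfT f"
proof -
  have c: "continuous_on {0..2*pi} (\<lambda>x. f (cis x))" by (rule continuous_on_cis_comp[OF assms])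
  then have "(\<lambda>x. f (cis x)) \<in> borel_measurable (restrict_space borel {0..2*pi})"
    by (rule borel_measurable_continuous_on_restrict)
  moreover obtain B where "\<And>t. t \<in> circle \<Longrightarrow> norm (f t) \<le> B" using circle_bounded[OF assms] by metis
  then have "AE x in lborel. x \<in> {0..2*pi} \<longrightarrow> norm (f (cis x)) \<le> B" by (intro AE_I2) auto
  ultimately show ?thesis
    unfolding LinfT_def by (auto simp: measurable_def space_restrict_space sets_restrict_space)
qed

lemma Hplus_iff:
  assumes "\<And>t. t \<in> circle \<Longrightarrow> f t = ev w t"
  shows "f \<in> Hplus \<longleftrightarrow> supported {0..} w"
proof -
  have "continuous_on circle f" using continuous_on_ev assms continuous_on_cong by blast
  then show ?thesis unfolding Hplus_def supported_def mem_Collect_eq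
  proof (intro iffI conjI allI impI)
    fix k :: int assume H: "LinfT f \<and> (\<forall>n::nat\<ge>1. fc f (- int n) = 0)" and k: "k \<notin> {0..}"
    show "coef w k = 0"
      using H[THEN conjunct2, rule_format, of "nat (- k)"] k by (simp add: fc_eq_coef[OF assms])
  qed (auto simp: LinfT_continuous fc_eq_coef[OF assms])
qed

lemma Hminus_iff:
  assumes "\<And>t. t \<in> circle \<Longrightarrow> f t = ev w t"
  shows "f \<in> Hminus \<longleftrightarrow> supported {..0} w"
proof -
  have "continuous_on circle f" using continuous_on_ev assms continuous_on_cong by blast
  then show ?thesis unfolding Hminus_def supported_def mem_Collect_eq
  proof (intro iffI conjI allI impI)
    fix k :: int assume H: "LinfT f \<and> (\<forall>n::nat\<ge>1. fc f (int n) = 0)" and k: "k \<notin> {..0}"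
    show "coef w k = 0"
      using H[THEN conjunct2, rule_format, of "nat k"] k by (simp add: fc_eq_coef[OF assms])
  qed (auto simp: LinfT_continuous fc_eq_coef[OF assms])
qed

text \<open>\<open>clog\<close> is an arbitrary choice. Any two continuous logarithms differ by a
  continuous function with values in the discrete set of multiples of 2 pi i, hence by a constant,
  which the outer exponential removes.\<close>

lemma Gc_eq:
  assumes "\<And>t. t \<in> circle \<Longrightarrow> a t = ev (exp w) t"
  shows "Gc a = exp (coef w 0)"
proof -
  define L where "L = clog a"
  have "continuous_on circle (ev w) \<and> (\<forall>z\<in>circle. exp (ev w z) = a z)"
    using assms by (simp add: continuous_on_ev ev_exp)
  then have L: "continuous_on circle L" "\<And>z. z \<in> circle \<Longrightarrow> exp (L z) = a z"
    using someI[where P = "\<lambda>L. continuous_on circle L \<and> (\<forall>z\<in>circle. exp (L z) = a z)"]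
    unfolding L_def clog_def by auto
  define d where "d z = L z - ev w z" for z
  have dc: "continuous_on circle d"
    unfolding d_def by (intro continuous_intros L(1) continuous_on_ev)
  have ed: "exp (d z) = 1" if "z \<in> circle" for z
    using that L(2)[OF that] assms[OF that] by (simp add: d_def exp_diff ev_exp)
  have "d constant_on circle"
  proof (rule continuous_discrete_range_constant[OF _ dc])
    show "connected circle" unfolding circle_def by (rule connected_sphere) simp
    fix x assume x: "x \<in> circle"
    have "2 * pi \<le> norm (d y - d x)" if "y \<in> circle" "d y \<noteq> d x" for y
    proof -
      have "exp (d y - d x) = 1" using ed x that by (simp add: exp_diff)
      then obtain n :: int where n: "Re (d y - d x) = 0" "Im (d y - d x) = of_int (2 * n) * pi"
        unfolding exp_eq_1 by auto
      then have "n \<noteq> 0" using that(2) by (auto simp: complex_eq_iff)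
      then have "1 \<le> \<bar>real_of_int n\<bar>" by linarith
      then have "2 * pi \<le> \<bar>Im (d y - d x)\<bar>" unfolding n(2) by (simp add: abs_mult)
      then show ?thesis using abs_Im_le_cmod order.trans by blast
    qed
    then show "\<exists>e>0. \<forall>y. y \<in> circle \<and> d y \<noteq> d x \<longrightarrow> e \<le> norm (d y - d x)"
      by (intro exI[of _ "2 * pi"]) auto
  qed
  then obtain c where c: "\<And>z. z \<in> circle \<Longrightarrow> d z = c" unfolding constant_on_def by blast
  have "fc L 0 = coef (w + monomial c 0) 0"
    by (rule fc_eq_coef) (use c in \<open>simp add: ev_simps d_def algebra_simps\<close>)
  moreover have "exp c = 1" using ed[of 1] c[of 1] by (simp add: circle_def)
  ultimately show ?thesis by (simp add: Gc_def L_def exp_add)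
qed

text \<open>Part (c) speaks about arbitrary factors, not those built from the logarithm. With w_+
  and w_- the two halves of w, a_+ exp(-w_+) = a_-^(-1) exp(w_-); both sides are products of
  elements with spectra on one side, so their zeroth coefficients can be compared factor by
  factor.\<close>

lemma factor_coef_0:
  assumes A: "Am * Ap = exp w" and inv: "Am * V = 1"
    and sp: "supported {..0} Am" "supported {..0} V" "supported {0..} Ap"
  shows "coef Am 0 * coef Ap 0 = exp (coef w 0)"
proof -
  define wp where "wp = restr {0..} w"
  define wm where "wm = restr {..<0} w"
  have w: "wm + wp = w" unfolding wm_def wp_def by (rule l1z_eqI) auto
  have swp: "supported {0..} (- wp)" by (simp add: wp_def supported_uminus)
  have swm: "supported {..0} wm" by (auto simp: wm_def supported_def)
  have "Ap * exp (- wp) = (Am * V) * (Ap * exp (- wp))" using inv by simp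
  also have "\<dots> = V * exp (wm + wp) * exp (- wp)" unfolding w A[symmetric] by (simp only: mult_ac)
  also have "\<dots> = V * exp wm * (exp wp * exp (- wp))"
    by (simp only: exp_add_commuting[OF mult.commute] mult_ac)
  also have "\<dots> = V * exp wm" by (simp add: exp_minus_inverse)
  finally have "coef (Ap * exp (- wp)) 0 = coef (V * exp wm) 0" by simp
  moreover have "supported {0..} (exp (- wp))" "supported {..0} (exp wm)"
    by (rule supported_exp; use swp swm in auto)+
  moreover have "coef (exp (- wp)) 0 = exp (- coef wp 0)" "coef (exp wm) 0 = exp (coef wm 0)"
    using coef_exp_0 swp swm by auto
  ultimately have "coef Ap 0 * exp (- coef wp 0) = coef V 0 * exp (coef wm 0)"
    using sp coef_mult_0 by auto
  moreover have "coef Am 0 * coef V 0 = 1" using coef_mult_0[of Am V] sp inv by (simp add: coef_one)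
  ultimately have "coef Am 0 * coef Ap 0 * exp (- coef wp 0) = exp (coef wm 0)"
    by (simp add: mult.assoc)
  moreover have "coef w 0 = coef wm 0 + coef wp 0" by (simp flip: w)
  ultimately show ?thesis by (simp add: exp_add exp_minus field_simps)
qed

text \<open>The substitution t -> 1/t. It turns conditions on negative frequencies into conditions
  on positive ones and exchanges the two Hardy spaces.\<close>

lift_definition reflect :: "l1z \<Rightarrow> l1z" is "\<lambda>f k. f (- k)"
  subgoal for f
    using summable_on_reindex_bij_witness[of UNIV uminus uminus UNIV "\<lambda>k. norm (f k)" "\<lambda>k. norm (f (- k))"] by simp
  done

lemma coef_reflect [simp]: "coef (reflect w) k = coef w (- k)" by transfer simp

lemma ev_reflect: "ev (reflect w) t = ev w (inverse t)" unfolding ev_def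
  by (rule infsum_reindex_bij_witness[of _ uminus uminus]) (auto simp: power_int_minus power_int_inverse)

lemma reflect_mult: "reflect (v * w) = reflect v * reflect w"
proof (rule ev_inject)
  fix t assume "t \<in> circle"
  moreover from this have "inverse t \<in> circle" by (simp add: circle_def norm_inverse)
  ultimately show "ev (reflect (v * w)) t = ev (reflect v * reflect w) t"
    by (simp add: ev_mult ev_reflect)
qed

lemma reflect_one [simp]: "reflect 1 = 1" by (rule l1z_eqI) (simp add: coef_one)

lemma supported_reflect:
  "supported {0..} (reflect w) \<longleftrightarrow> supported {..0} w"
  "supported {..0} (reflect w) \<longleftrightarrow> supported {0..} w"
proof -
  have all: "(\<forall>k::int. P k) \<longleftrightarrow> (\<forall>k. P (- k))" for P using minus_minus by metis
  show "supported {0..} (reflect w) \<longleftrightarrow> supported {..0} w" unfolding supported_def by (subst all) simp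
  show "supported {..0} (reflect w) \<longleftrightarrow> supported {0..} w" unfolding supported_def by (subst all) simp
qed

section \<open>N-functions\<close>

text \<open>The common properties of Phi and Psi that the estimates use: lines of support with
  nonnegative slope, and doubling close to 0. The second is enough because terms of convergent
  series are eventually small.\<close>

definition gauge :: "(real \<Rightarrow> real) \<Rightarrow> bool" where
  "gauge F \<longleftrightarrow> F 0 = 0 \<and> (\<forall>x>0. F x > 0) \<and>
     (\<exists>f. (\<forall>x\<ge>0. f x \<ge> 0) \<and> (\<forall>x\<ge>0. \<forall>y\<ge>0. F x + f x * (y - x) \<le> F y)) \<and>
     (\<exists>\<delta>>0. \<exists>C. \<forall>x. 0 < x \<and> x < \<delta> \<longrightarrow> F (2 * x) \<le> C * F x)"

lemma integral_subgradient:
  fixes f F :: "real \<Rightarrow> real"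
  assumes f: "mono_on {0..} f" and F: "\<And>x. x \<ge> 0 \<Longrightarrow> F x = integral {0..x} f"
    and xy: "x \<ge> 0" "y \<ge> 0"
  shows "F x + f x * (y - x) \<le> F y"
proof -
  have int: "f integrable_on {u..v}" if "u \<ge> 0" for u v
    by (rule integrable_on_mono_on, rule mono_on_subset[OF f]) (use that in auto)
  have split: "F v = F u + integral {u..v} f" if "0 \<le> u" "u \<le> v" for u v
    using Henstock_Kurzweil_Integration.integral_combine[OF that int[of 0 v]] that by (simp add: F)
  show ?thesis
  proof (cases "x \<le> y")
    case True
    have "integral {x..y} (\<lambda>_. f x) \<le> integral {x..y} f"
      by (rule integral_le) (use xy mono_onD[OF f] in \<open>auto intro: int\<close>)
    then show ?thesis using split[OF xy(1) True] True by (simp add: mult.commute)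
  next
    case False
    have "integral {y..x} f \<le> integral {y..x} (\<lambda>_. f x)"
      by (rule integral_le) (use xy mono_onD[OF f] in \<open>auto intro: int\<close>)
    then show ?thesis using split[of y x] False xy by (simp add: algebra_simps)
  qed
qed

lemma gauge_integral:
  fixes f F :: "real \<Rightarrow> real"
  assumes f: "mono_on {0..} f" "\<And>x. x > 0 \<Longrightarrow> f x > 0" "f 0 = 0"
    and F: "\<And>x. x \<ge> 0 \<Longrightarrow> F x = integral {0..x} f" and D: "Delta2_0 F"
  shows "gauge F"
proof -
  note sub = integral_subgradient[OF f(1) F]
  have nonneg: "f x \<ge> 0" if "x \<ge> 0" for x using f(2)[of x] f(3) that by (cases "x = 0") auto
  have F0: "F 0 = 0" using F[of 0] by simp
  have pos: "F x > 0" if x: "x > 0" for x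
  proof -
    have "F (x / 2) \<ge> 0" using sub[of 0 "x / 2"] x F0 f(3) by simp
    moreover have "f (x / 2) * (x - x / 2) > 0" using f(2)[of "x / 2"] x by simp
    ultimately show ?thesis using sub[of "x / 2" x] x by simp
  qed
  obtain C :: nat where C: "Limsup (at_right 0) (\<lambda>x. ereal (F (2 * x) / F x)) < ereal (real C)"
    using D less_PInf_Ex_of_nat unfolding Delta2_0_def by auto
  then have "eventually (\<lambda>x. ereal (F (2 * x) / F x) < ereal (real C)) (at_right 0)"
    by (rule Limsup_lessD)
  then obtain d where d: "d > 0" "\<And>x. 0 < x \<Longrightarrow> x < d \<Longrightarrow> F (2 * x) / F x < real C"
    unfolding eventually_at_right_field by auto
  have "F (2 * x) \<le> real C * F x" if "0 < x" "x < d" for x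
    using d(2)[OF that] pos[OF that(1)] by (simp add: field_simps)
  then show ?thesis unfolding gauge_def using F0 pos nonneg sub d(1) by blast
qed

text \<open>Young's inequality up to a factor 2: if y <= p x, then x y <= x p(x) <= Phi(2x) - Phi(x)
  by the line of support at x; otherwise x <= q y, and the same argument applies to Psi.\<close>

lemma N_pairD:
  assumes N: "N_pair p Phi Psi" and D: "Delta2_0 Phi" "Delta2_0 Psi"
  shows "gauge Phi" "gauge Psi" "\<And>x y. x \<ge> 0 \<Longrightarrow> y \<ge> 0 \<Longrightarrow> x * y \<le> Phi (2 * x) + Psi (2 * y)"
proof -
  define S where "S s = {t. t \<ge> 0 \<and> p t \<le> s}" for s
  define q where "q s = Sup (S s)" for s
  have p: "mono_on {0..} p" "p 0 = 0" "\<And>t. t > 0 \<Longrightarrow> p t > 0" "filterlim p at_top at_top"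
    "\<And>x. x \<ge> 0 \<Longrightarrow> Phi x = integral {0..x} p" "\<And>x. x \<ge> 0 \<Longrightarrow> Psi x = integral {0..x} q"
    using N unfolding N_pair_def q_def[abs_def] S_def by blast+
  show Phi: "gauge Phi" by (rule gauge_integral[OF p(1,3,2,5) D(1)])
  have bdd: "bdd_above (S s)" for s
  proof -
    obtain T where T: "\<And>t. t \<ge> T \<Longrightarrow> p t > s"
      using p(4) unfolding filterlim_at_top_dense eventually_at_top_linorder by blast
    have "t \<le> T" if "t \<in> S s" for t using T[of t] that unfolding S_def by force
    then show ?thesis by (rule bdd_aboveI)
  qed
  have ub: "t \<le> q s" if "t \<ge> 0" "p t \<le> s" for t s
    unfolding q_def by (rule cSup_upper[OF _ bdd]) (use that in \<open>simp add: S_def\<close>)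
  have q0: "q 0 = 0"
  proof -
    have "t \<in> S 0 \<longleftrightarrow> t = 0" for t using p(2) p(3)[of t] by (cases "t > 0") (auto simp: S_def)
    then have "S 0 = {0}" by blast
    then show ?thesis by (simp add: q_def)
  qed
  have qpos: "q s > 0" if s: "s > 0" for s
  proof -
    \<comment> \<open>Right continuity at 0 keeps \<open>p\<close> below s on some interval to the
      right of 0, and half of that interval already bounds q s from below.\<close>
    have "continuous (at_right 0) p" using N unfolding N_pair_def by auto
    then have "eventually (\<lambda>t. p t < s) (at_right 0)"
      using s p(2) by (intro order_tendstoD) (auto simp: continuous_within)
    then obtain b where b: "b > 0" "\<And>t. 0 < t \<Longrightarrow> t < b \<Longrightarrow> p t < s"
      unfolding eventually_at_right_field by auto
    have "b / 2 \<le> q s" by (rule ub) (use b(1) b(2)[of "b / 2"] in auto)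
    then show ?thesis using b(1) by simp
  qed
  have qmono: "mono_on {0..} q"
  proof (rule mono_onI)
    fix r s :: real assume rs: "r \<in> {0..}" "s \<in> {0..}" "r \<le> s"
    show "q r \<le> q s" unfolding q_def
    proof (rule cSup_subset_mono[OF _ bdd])
      show "S r \<noteq> {}" using rs p(2) by (auto simp: S_def)
      show "S r \<subseteq> S s" using rs by (auto simp: S_def)
    qed
  qed
  show Psi: "gauge Psi" by (rule gauge_integral[OF qmono qpos q0 p(6) D(2)])
  fix x y :: real assume xy: "x \<ge> 0" "y \<ge> 0"
  have nonneg: "Phi z \<ge> 0" "Psi z \<ge> 0" if "z \<ge> 0" for z
    using that Phi Psi unfolding gauge_def by (metis less_eq_real_def)+
  show "x * y \<le> Phi (2 * x) + Psi (2 * y)"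
  proof (cases "y \<le> p x")
    case True
    have "x * y \<le> p x * (2 * x - x)"
      using mult_right_mono[OF True xy(1)] by (simp add: mult.commute)
    also have "\<dots> \<le> Phi (2 * x) - Phi x"
      using integral_subgradient[OF p(1,5), of x "2 * x"] xy by simp
    finally show ?thesis using nonneg(1)[of x] nonneg(2)[of "2 * y"] xy by simp
  next
    case False
    have "x * y \<le> q y * (2 * y - y)" using mult_right_mono[OF ub[of x y] xy(2)] False xy by simp
    also have "\<dots> \<le> Psi (2 * y) - Psi y"
      using integral_subgradient[OF qmono p(6), of y "2 * y"] xy by simp
    finally show ?thesis using nonneg(2)[of y] nonneg(1)[of "2 * x"] xy by simp
  qed
qed

lemma gauge_0: "gauge F \<Longrightarrow> F 0 = 0" by (simp add: gauge_def)

lemma gauge_pos: "gauge F \<Longrightarrow> x > 0 \<Longrightarrow> F x > 0" by (simp add: gauge_def)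

lemma gauge_nonneg: "gauge F \<Longrightarrow> x \<ge> 0 \<Longrightarrow> F x \<ge> 0"
  using gauge_0[of F] gauge_pos[of F x] by (cases "x = 0") auto

lemma gauge_subgradient:
  assumes "gauge F" "m \<ge> 0"
  shows "\<exists>c\<ge>0. \<forall>y\<ge>0. F m + c * (y - m) \<le> F y"
proof -
  obtain f where f: "\<forall>x\<ge>0. f x \<ge> 0" "\<forall>x\<ge>0. \<forall>y\<ge>0. F x + f x * (y - x) \<le> F y"
    using assms(1) unfolding gauge_def by (elim conjE exE)
  show ?thesis by (rule exI[of _ "f m"]) (use f assms(2) in auto)
qed

lemma gauge_mono:
  assumes "gauge F" "0 \<le> x" "x \<le> y"
  shows "F x \<le> F y"
proof -
  have y: "0 \<le> y" using assms by linarith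
  obtain c where c: "c \<ge> 0" "\<forall>y\<ge>0. F x + c * (y - x) \<le> F y"
    using gauge_subgradient[OF assms(1,2)] by auto
  have "c * (y - x) \<ge> 0" using c(1) assms by simp
  moreover have "F x + c * (y - x) \<le> F y" using c(2) y by simp
  ultimately show ?thesis by linarith
qed

lemma gauge_add:
  assumes "gauge F" "0 \<le> x" "0 \<le> y"
  shows "F (x + y) \<le> F (2 * x) + F (2 * y)"
proof -
  have "F (x + y) \<le> F (2 * max x y)" by (rule gauge_mono[OF assms(1)]) (use assms in auto)
  also have "\<dots> \<le> F (2 * x) + F (2 * y)"
    using gauge_nonneg[OF assms(1)] assms by (auto simp: max_def)
  finally show ?thesis .
qed

lemma gauge_summable_tendsto:
  assumes F: "gauge F" and x: "\<And>n. x n \<ge> 0" and s: "summable (\<lambda>n. F (x n))"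
  shows "x \<longlonglongrightarrow> 0"
proof (rule order_tendstoI)
  fix e :: real assume e: "e < 0"
  show "\<forall>\<^sub>F n in sequentially. e < x n" using x e by (auto intro: always_eventually less_le_trans)
next
  fix e :: real assume e: "0 < e"
  have "\<forall>\<^sub>F n in sequentially. F (x n) < F e"
    by (rule order_tendstoD(2)[OF summable_LIMSEQ_zero[OF s] gauge_pos[OF F e]])
  then show "\<forall>\<^sub>F n in sequentially. x n < e"
  proof eventually_elim
    case (elim n)
    then show ?case using gauge_mono[OF F, of e "x n"] e by (meson linorder_not_less less_imp_le)
  qed
qed

text \<open>The arguments tend to 0, so local doubling applies to all but finitely many terms; it is
  iterated until the power of 2 exceeds c.\<close>

lemma gauge_summable_scale:
  assumes F: "gauge F" and x: "\<And>n. x n \<ge> 0" and s: "summable (\<lambda>n. F (x n))" and c: "c \<ge> 0"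
  shows "summable (\<lambda>n. F (c * x n))"
proof -
  have dbl: "summable (\<lambda>n. F (2 * y n))" if y: "\<And>n. y n \<ge> 0" "summable (\<lambda>n. F (y n))" for y :: "nat \<Rightarrow> real"
  proof -
    obtain d C where d: "d > 0" "\<And>x. 0 < x \<Longrightarrow> x < d \<Longrightarrow> F (2 * x) \<le> C * F x"
      using F unfolding gauge_def by (elim conjE exE) (rule that, auto)
    have "\<forall>\<^sub>F n in sequentially. y n < d"
      by (rule order_tendstoD(2)[OF gauge_summable_tendsto[OF F y] d(1)])
    then have "\<forall>\<^sub>F n in sequentially. norm (F (2 * y n)) \<le> C * F (y n)"
    proof eventually_elim
      case (elim n)
      then show ?case using d(2)[of "y n"] y(1)[of n] gauge_0[OF F] gauge_nonneg[OF F, of "2 * y n"]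
        by (cases "y n = 0") auto
    qed
    then show ?thesis by (rule summable_comparison_test_ev) (intro summable_mult y)
  qed
  have pow: "summable (\<lambda>n. F (2 ^ m * x n))" for m
  proof (induction m)
    case (Suc m)
    then show ?case using dbl[of "\<lambda>n. 2 ^ m * x n"] x by (simp add: mult.assoc)
  qed (simp add: s)
  obtain m :: nat where m: "c < 2 ^ m" using real_arch_pow[of 2 c] by auto
  show ?thesis
  proof (rule summable_comparison_test[OF _ pow[of m]], intro exI allI impI)
    fix n
    have "F (c * x n) \<le> F (2 ^ m * x n)"
      using m c x by (intro gauge_mono[OF F] mult_right_mono) auto
    then show "norm (F (c * x n)) \<le> F (2 ^ m * x n)"
      using gauge_nonneg[OF F, of "c * x n"] c x by simp
  qed
qed

lemma weighted_coef_summable: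
  assumes "\<And>j. 0 \<le> H j" "\<And>j. H j \<le> (B :: real)"
  shows "(\<lambda>k. norm (coef v k) * H (n - k)) summable_on A"
proof (rule summable_on_comparison_test)
  show "(\<lambda>k. norm (coef v k) * B) summable_on A" by (intro summable_on_cmult_left) simp
  show "norm (coef v k) * H (n - k) \<le> norm (coef v k) * B" for k
    by (intro mult_left_mono assms norm_ge_zero)
  show "0 \<le> norm (coef v k) * H (n - k)" for k by (intro mult_nonneg_nonneg assms norm_ge_zero)
qed

text \<open>Jensen's inequality with weights of total mass at most 1, from the line of support of F
  at the weighted sum m.\<close>

lemma gauge_jensen:
  assumes F: "gauge F" and v: "norm v \<le> 1"
    and G: "\<And>j. 0 \<le> G j" "\<And>j. G j \<le> B"
  shows "F (\<Sum>\<^sub>\<infinity>k. norm (coef v k) * G (n - k)) \<le> (\<Sum>\<^sub>\<infinity>k. norm (coef v k) * F (G (n - k)))"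
proof -
  define m where "m = (\<Sum>\<^sub>\<infinity>k. norm (coef v k) * G (n - k))"
  have m0: "m \<ge> 0" unfolding m_def by (intro infsum_nonneg) (simp add: G)
  obtain c where c0: "c \<ge> 0" "\<forall>y\<ge>0. F m + c * (y - m) \<le> F y"
    using gauge_subgradient[OF F m0] by auto
  have c: "F m + c * (y - m) \<le> F y" if "y \<ge> 0" for y using c0(2) that by simp
  have B: "B \<ge> 0" using G order_trans by blast
  have s1: "(\<lambda>k. norm (coef v k) * G (n - k)) summable_on UNIV"
    by (rule weighted_coef_summable[OF G])
  have s2: "(\<lambda>k. norm (coef v k) * F (G (n - k))) summable_on UNIV"
    by (rule weighted_coef_summable[of "\<lambda>j. F (G j)" "F B"])
      (rule gauge_nonneg[OF F G(1)], rule gauge_mono[OF F G])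
  have h1: "((\<lambda>k. norm (coef v k)) has_sum norm v) UNIV"
    unfolding norm_l1z_def by (rule has_sum_infsum) simp
  have h2: "((\<lambda>k. norm (coef v k) * G (n - k)) has_sum m) UNIV"
    unfolding m_def by (rule has_sum_infsum[OF s1])
  have h3: "((\<lambda>k. (F m - c * m) * norm (coef v k) + c * (norm (coef v k) * G (n - k))) has_sum
      (F m - c * m) * norm v + c * m) UNIV"
    by (rule has_sum_add[OF has_sum_cmult_right[OF h1] has_sum_cmult_right[OF h2]])
  have "(F m - c * m) * norm v + c * m \<le> (\<Sum>\<^sub>\<infinity>k. norm (coef v k) * F (G (n - k)))"
  proof (rule has_sum_mono[OF h3 has_sum_infsum[OF s2]])
    fix k
    have "norm (coef v k) * (F m + c * (G (n - k) - m)) \<le> norm (coef v k) * F (G (n - k))"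
      by (intro mult_left_mono c G) simp
    then show "(F m - c * m) * norm (coef v k) + c * (norm (coef v k) * G (n - k)) \<le> norm (coef v k) * F (G (n - k))"
      by (simp add: algebra_simps)
  qed
  \<comment> \<open>Here the missing mass is accounted for: the line of support at y = 0, where F
    vanishes, gives F m <= c m.\<close>
  moreover have "F m \<le> (F m - c * m) * norm v + c * m"
  proof -
    have "F m \<le> c * m" using c[of 0] gauge_0[OF F] by simp
    then have "(c * m - F m) * norm v \<le> (c * m - F m) * 1" using v by (intro mult_left_mono) auto
    then show ?thesis by (simp add: algebra_simps)
  qed
  ultimately show ?thesis unfolding m_def by linarith
qed

lemma has_sum_finite_sum:
  fixes f :: "'i \<Rightarrow> 'k \<Rightarrow> 'a :: {topological_comm_monoid_add}"
  assumes "finite T" "\<And>n. n \<in> T \<Longrightarrow> (f n has_sum s n) A"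
  shows "((\<lambda>k. \<Sum>n\<in>T. f n k) has_sum (\<Sum>n\<in>T. s n)) A"
  using assms by (induction T rule: finite_induct) (simp_all add: has_sum_add)

text \<open>Jensen for each n, then summation over n first: for fixed k the inner sum is a
  translate, bounded by S. The factor norm v is kept because it serves as a contraction constant in
  the treatment of inverses.\<close>

lemma gauge_convolution:
  assumes F: "gauge F" and v: "norm v \<le> 1"
    and G: "\<And>j. 0 \<le> G j" "\<And>j. G j \<le> B" and S: "\<And>T. finite T \<Longrightarrow> (\<Sum>j\<in>T. F (G j)) \<le> S"
    and T: "finite T"
  shows "(\<Sum>n\<in>T. F (\<Sum>\<^sub>\<infinity>k. norm (coef v k) * G (n - k))) \<le> norm v * S"
proof -
  have B: "B \<ge> 0" using G order_trans by blast
  have s2: "(\<lambda>k. norm (coef v k) * F (G (n - k))) summable_on UNIV" for n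
    by (rule weighted_coef_summable[of "\<lambda>j. F (G j)" "F B"])
      (rule gauge_nonneg[OF F G(1)], rule gauge_mono[OF F G])
  have "(\<Sum>n\<in>T. F (\<Sum>\<^sub>\<infinity>k. norm (coef v k) * G (n - k))) \<le> (\<Sum>n\<in>T. \<Sum>\<^sub>\<infinity>k. norm (coef v k) * F (G (n - k)))"
    by (intro sum_mono gauge_jensen[OF F v G])
  also have "\<dots> \<le> norm v * S"
  proof (rule has_sum_mono)
    show "((\<lambda>k. \<Sum>n\<in>T. norm (coef v k) * F (G (n - k))) has_sum
        (\<Sum>n\<in>T. \<Sum>\<^sub>\<infinity>k. norm (coef v k) * F (G (n - k)))) UNIV"
      by (rule has_sum_finite_sum[OF T has_sum_infsum[OF s2]])
    show "((\<lambda>k. norm (coef v k) * S) has_sum norm v * S) UNIV"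
      unfolding norm_l1z_def by (rule has_sum_cmult_left[OF has_sum_infsum]) simp
    fix k
    have "(\<Sum>n\<in>T. F (G (n - k))) = (\<Sum>j\<in>(\<lambda>n. n - k) ` T. F (G j))"
      by (simp add: sum.reindex inj_on_def)
    also have "\<dots> \<le> S" using T by (intro S) simp
    finally show "(\<Sum>n\<in>T. norm (coef v k) * F (G (n - k))) \<le> norm (coef v k) * S"
      by (simp add: mult_left_mono flip: sum_distrib_left)
  qed
  finally show ?thesis .
qed

section \<open>Weighted coefficient classes\<close>

text \<open>One half of the condition in \<open>Fl\<close>; the other half is expressed through
  \<open>reflect\<close>. The index 0 then occurs in both halves, which changes only one term of a
  series.\<close>

definition wfin :: "(real \<Rightarrow> real) \<Rightarrow> (nat \<Rightarrow> real) \<Rightarrow> l1z \<Rightarrow> bool" where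
  "wfin F \<psi> w \<longleftrightarrow> summable (\<lambda>n. F (norm (coef w (int n)) * \<psi> n))"

text \<open>Extended by 0 to negative frequencies, so that convolutions can run over all
  integers.\<close>

definition wcoef :: "(nat \<Rightarrow> real) \<Rightarrow> l1z \<Rightarrow> int \<Rightarrow> real" where
  "wcoef \<psi> w j = (if 0 \<le> j then norm (coef w j) * \<psi> (nat j) else 0)"

abbreviation wconv :: "(nat \<Rightarrow> real) \<Rightarrow> l1z \<Rightarrow> l1z \<Rightarrow> int \<Rightarrow> real" where
  "wconv \<psi> v w n \<equiv> (\<Sum>\<^sub>\<infinity>k. norm (coef v k) * wcoef \<psi> w (n - k))"

lemma weights_pos: "\<psi> \<in> weights \<Longrightarrow> \<psi> n > 0" by (simp add: weights_def)

lemma weights_nonneg: "\<psi> \<in> weights \<Longrightarrow> \<psi> n \<ge> 0" using weights_pos[of \<psi> n] by simp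

lemma weights_mono:
  assumes "\<psi> \<in> weights" "m \<le> n"
  shows "\<psi> m \<le> \<psi> n"
proof -
  have "\<psi> k \<le> \<psi> (Suc k)" for k
    using assms(1) unfolding weights_def by (auto dest: spec[of _ "Suc k"])
  then show ?thesis using lift_Suc_mono_le[of \<psi>] assms(2) by blast
qed

lemma weights_ge_1:
  assumes "\<psi> \<in> weights"
  shows "\<psi> n \<ge> 1" using weights_mono[OF assms, of 0 n] assms by (simp add: weights_def)

lemma weights_doubling:
  assumes "\<psi> \<in> weights"
  obtains C where "C \<ge> 1" "\<And>i j. \<psi> (i + j) \<le> C * (\<psi> i + \<psi> j)" "\<And>n. \<psi> (2 * n) \<le> C * \<psi> n"
proof -
  obtain C0 where C0: "\<forall>k\<ge>1. \<psi> (2 * k) \<le> C0 * \<psi> k" using assms unfolding weights_def by blast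
  define C where "C = max 1 C0"
  note pos = weights_nonneg[OF assms]
  have dbl: "\<psi> (2 * n) \<le> C * \<psi> n" for n
  proof (cases "n = 0")
    case True
    then show ?thesis using pos[of 0] by (simp add: C_def mult_le_cancel_right1)
  next
    case False
    then have "\<psi> (2 * n) \<le> C0 * \<psi> n" using C0 by simp
    also have "\<dots> \<le> C * \<psi> n" by (intro mult_right_mono pos) (simp add: C_def)
    finally show ?thesis .
  qed
  have "\<psi> (i + j) \<le> C * (\<psi> i + \<psi> j)" for i j
  proof -
    have "\<psi> (i + j) \<le> \<psi> (2 * max i j)" by (rule weights_mono[OF assms]) simp
    also have "\<dots> \<le> C * \<psi> (max i j)" by (rule dbl)
    also have "\<dots> \<le> C * (\<psi> i + \<psi> j)"
      using pos[of i] pos[of j] by (intro mult_left_mono) (auto simp: C_def max_def)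
    finally show ?thesis .
  qed
  then show ?thesis using that[of C] dbl by (simp add: C_def)
qed

lemma wcoef_nonneg: "\<psi> \<in> weights \<Longrightarrow> wcoef \<psi> w j \<ge> 0"
  using weights_pos[of \<psi>] by (simp add: wcoef_def less_imp_le)

lemma wfin_scaled:
  assumes F: "gauge F" and \<psi>: "\<psi> \<in> weights" and w: "wfin F \<psi> w" and c: "c \<ge> 0"
  shows "summable (\<lambda>n. F (c * wcoef \<psi> w (int n)))"
  using gauge_summable_scale[OF F _ _ c, of "\<lambda>n. norm (coef w (int n)) * \<psi> n"] w
    weights_nonneg[OF \<psi>] by (simp add: wfin_def wcoef_def)

lemma wfin_tendsto:
  assumes "gauge F" "\<psi> \<in> weights" "wfin F \<psi> w"
  shows "(\<lambda>n. norm (coef w (int n)) * \<psi> n) \<longlonglongrightarrow> 0"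
  using gauge_summable_tendsto[OF assms(1), of "\<lambda>n. norm (coef w (int n)) * \<psi> n"] assms(3)
    weights_nonneg[OF assms(2)] by (simp add: wfin_def)

lemma wcoef_bounded:
  assumes "gauge F" "\<psi> \<in> weights" "wfin F \<psi> w"
  obtains B where "\<And>j. wcoef \<psi> w j \<le> B"
proof -
  have "Bseq (\<lambda>n. norm (coef w (int n)) * \<psi> n)"
    using wfin_tendsto[OF assms] by (intro convergent_imp_Bseq convergentI)
  then obtain K where K: "K > 0" "\<And>n. norm (norm (coef w (int n)) * \<psi> n) \<le> K"
    unfolding Bseq_def by blast
  have "wcoef \<psi> w j \<le> K" for j using K(1) K(2)[of "nat j"] by (auto simp: wcoef_def)
  then show ?thesis by (rule that)
qed

lemma wfin_finite_sums:
  assumes F: "gauge F" and \<psi>: "\<psi> \<in> weights" and w: "wfin F \<psi> w" and c: "c \<ge> 0" and T: "finite T"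
  shows "(\<Sum>j\<in>T. F (c * wcoef \<psi> w j)) \<le> (\<Sum>n. F (c * wcoef \<psi> w (int n)))"
proof -
  have nn: "F (c * wcoef \<psi> w j) \<ge> 0" for j
    by (intro gauge_nonneg[OF F] mult_nonneg_nonneg c wcoef_nonneg[OF \<psi>])
  have "(\<Sum>j\<in>T. F (c * wcoef \<psi> w j)) = (\<Sum>j\<in>T \<inter> {0..}. F (c * wcoef \<psi> w j))"
    using T by (intro sum.mono_neutral_right) (auto simp: wcoef_def gauge_0[OF F])
  also have "\<dots> = (\<Sum>n\<in>nat ` (T \<inter> {0..}). F (c * wcoef \<psi> w (int n)))"
    by (rule sum.reindex_cong[of int]) (auto simp: image_image)
  also have "\<dots> \<le> (\<Sum>n. F (c * wcoef \<psi> w (int n)))"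
    using T by (intro sum_le_suminf[OF wfin_scaled[OF F \<psi> w c]]) (auto simp: nn)
  finally show ?thesis .
qed

lemma wfin_convolution:
  assumes F: "gauge F" and \<psi>: "\<psi> \<in> weights" and w: "wfin F \<psi> w" and c: "c \<ge> 0"
  shows "summable (\<lambda>n. F (c * wconv \<psi> v w (int n)))"
proof -
  \<comment> \<open>Division by g makes \<open>v\<close> admissible for Jensen, even if v = 0; the
    factor g moves to the other side, where scaling preserves summability.\<close>
  define g where "g = norm v + 1"
  have g: "g > 0" unfolding g_def by (rule add_nonneg_pos) auto
  define v' where "v' = v /\<^sub>R g"
  have v': "norm v' \<le> 1" using g by (simp add: v'_def g_def field_simps)
  obtain B where B: "\<And>j. wcoef \<psi> w j \<le> B" using wcoef_bounded[OF F \<psi> w] by metis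
  define S where "S = (\<Sum>n. F ((c * g) * wcoef \<psi> w (int n)))"
  have cg: "c * g \<ge> 0" using c g by simp
  have eq: "c * wconv \<psi> v w (int n) =
      (\<Sum>\<^sub>\<infinity>k. norm (coef v' k) * (c * g * wcoef \<psi> w (int n - k)))" for n
    using g unfolding infsum_cmult_right'[symmetric]
    by (intro infsum_cong) (simp add: v'_def field_simps)
  show ?thesis unfolding eq
  proof (rule summableI_nonneg_bounded[where x = "norm v' * S"])
    fix n
    have "(\<Sum>j\<in>int ` {..<n}. F (\<Sum>\<^sub>\<infinity>k. norm (coef v' k) * (c * g * wcoef \<psi> w (j - k)))) \<le> norm v' * S"
    proof (rule gauge_convolution[OF F v'])
      show "0 \<le> c * g * wcoef \<psi> w j" for j by (rule mult_nonneg_nonneg[OF cg wcoef_nonneg[OF \<psi>]])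
      show "c * g * wcoef \<psi> w j \<le> c * g * B" for j by (rule mult_left_mono[OF B cg])
      show "(\<Sum>j\<in>T. F (c * g * wcoef \<psi> w j)) \<le> S" if "finite T" for T
        unfolding S_def by (rule wfin_finite_sums[OF F \<psi> w cg that])
    qed simp
    then show "(\<Sum>i<n. F (\<Sum>\<^sub>\<infinity>k. norm (coef v' k) * (c * g * wcoef \<psi> w (int i - k)))) \<le> norm v' * S"
      by (simp add: sum.reindex)
    show "0 \<le> F (\<Sum>\<^sub>\<infinity>k. norm (coef v' k) * (c * g * wcoef \<psi> w (int n - k)))"
      by (intro gauge_nonneg[OF F] infsum_nonneg mult_nonneg_nonneg cg wcoef_nonneg[OF \<psi>] norm_ge_zero)
  qed
qed

lemma wfin_comparison:
  assumes F: "gauge F" and \<psi>: "\<psi> \<in> weights"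
    and s: "summable (\<lambda>n. F (x n))" and le: "\<And>n. norm (coef w (int n)) * \<psi> n \<le> x n"
  shows "wfin F \<psi> w" unfolding wfin_def
proof (rule summable_comparison_test[OF _ s], intro exI allI impI)
  fix n
  have nn: "0 \<le> norm (coef w (int n)) * \<psi> n" using weights_pos[OF \<psi>, of n] by simp
  show "norm (F (norm (coef w (int n)) * \<psi> n)) \<le> F (x n)"
    using gauge_nonneg[OF F nn] gauge_mono[OF F nn le] by simp
qed

text \<open>The n-th coefficient of the product sees w only at frequencies n - k >= n, where the
  weight is at least \<open>\<psi> n\<close>; the weight may thus be moved inside the
  convolution.\<close>

lemma wfin_mult_nonpos:
  assumes F: "gauge F" and \<psi>: "\<psi> \<in> weights" and w: "wfin F \<psi> w" and v: "supported {..0} v"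
  shows "wfin F \<psi> (v * w)"
proof (rule wfin_comparison[OF F \<psi> wfin_convolution[OF F \<psi> w, of 1 v, unfolded mult_1]])
  fix n
  obtain B where B: "\<And>j. wcoef \<psi> w j \<le> B" using wcoef_bounded[OF F \<psi> w] by metis
  have s: "(\<lambda>k. norm (coef v k) * norm (coef w (int n - k))) summable_on UNIV"
    using coef_mult_abs_summable[of v w "int n" UNIV] by (simp add: norm_mult)
  have "norm (coef (v * w) (int n)) * \<psi> n \<le> (\<Sum>\<^sub>\<infinity>k. norm (coef v k) * norm (coef w (int n - k))) * \<psi> n"
    using weights_pos[OF \<psi>, of n] by (intro mult_right_mono norm_coef_mult_le) simp
  also have "\<dots> = (\<Sum>\<^sub>\<infinity>k. norm (coef v k) * norm (coef w (int n - k)) * \<psi> n)"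
    by (simp add: infsum_cmult_left')
  also have "\<dots> \<le> wconv \<psi> v w (int n)"
  proof (rule infsum_mono)
    show "(\<lambda>k. norm (coef v k) * norm (coef w (int n - k)) * \<psi> n) summable_on UNIV"
      by (rule summable_on_cmult_left[OF s])
    show "(\<lambda>k. norm (coef v k) * wcoef \<psi> w (int n - k)) summable_on UNIV"
      by (rule weighted_coef_summable[OF wcoef_nonneg[OF \<psi>] B])
    fix k
    show "norm (coef v k) * norm (coef w (int n - k)) * \<psi> n \<le> norm (coef v k) * wcoef \<psi> w (int n - k)"
    proof (cases "k \<le> 0")
      case True
      then have "n \<le> nat (int n - k)" by simp
      then show ?thesis using True weights_mono[OF \<psi>]
        by (auto simp: wcoef_def mult.assoc intro!: mult_left_mono)
    next
      case False
      then show ?thesis using v by (simp add: supported_def)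
    qed
  qed
  finally show "norm (coef (v * w) (int n)) * \<psi> n \<le> wconv \<psi> v w (int n)" .
qed simp

text \<open>By doubling, the weight at n is at most C times the sum of the weights at k and n - k,
  so it can be charged to one factor or the other.\<close>

lemma weighted_coef_mult_le:
  assumes \<psi>: "\<psi> \<in> weights" and C: "\<And>i j. \<psi> (i + j) \<le> C * (\<psi> i + \<psi> j)"
    and v: "supported {0..} v" and w: "supported {0..} w"
  shows "norm (coef (v * w) (int n)) * \<psi> n \<le>
    C * wconv \<psi> w v (int n) + C * wconv \<psi> v w (int n)"
proof -
  have fin: "(\<lambda>k. norm (coef v k) * wcoef \<psi> w (int n - k)) summable_on UNIV" if "supported {0..} v" for v w
    by (rule finite_nonzero_values_imp_summable_on, rule finite_subset[of _ "{0..int n}"])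
      (use that in \<open>auto simp: supported_def wcoef_def split: if_splits\<close>)
  have s: "(\<lambda>k. norm (coef v k) * norm (coef w (int n - k))) summable_on UNIV"
    using coef_mult_abs_summable[of v w "int n" UNIV] by (simp add: norm_mult)
  have 1: "((\<lambda>k. norm (coef w k) * wcoef \<psi> v (int n - k)) has_sum wconv \<psi> w v (int n)) UNIV"
    by (rule has_sum_infsum[OF fin[OF w]])
  have 2: "((\<lambda>k. norm (coef w (int n - k)) * wcoef \<psi> v k) has_sum wconv \<psi> w v (int n)) UNIV"
    by (rule iffD2[OF has_sum_reindex_bij_witness[of _ "\<lambda>k. int n - k" "\<lambda>k. int n - k"] 1]) auto
  have 3: "((\<lambda>k. norm (coef v k) * wcoef \<psi> w (int n - k)) has_sum wconv \<psi> v w (int n)) UNIV"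
    by (rule has_sum_infsum[OF fin[OF v]])
  have "norm (coef (v * w) (int n)) * \<psi> n \<le> (\<Sum>\<^sub>\<infinity>k. norm (coef v k) * norm (coef w (int n - k))) * \<psi> n"
    using weights_pos[OF \<psi>, of n] by (intro mult_right_mono norm_coef_mult_le) simp
  also have "\<dots> \<le> C * wconv \<psi> w v (int n) + C * wconv \<psi> v w (int n)"
  proof (rule has_sum_mono[OF has_sum_cmult_left[OF has_sum_infsum[OF s]] has_sum_add[OF has_sum_cmult_right[OF 2] has_sum_cmult_right[OF 3]]])
    fix k
    show "norm (coef v k) * norm (coef w (int n - k)) * \<psi> n \<le>
      C * (norm (coef w (int n - k)) * wcoef \<psi> v k) + C * (norm (coef v k) * wcoef \<psi> w (int n - k))"
    proof (cases "0 \<le> k \<and> k \<le> int n")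
      case True
      then have "\<psi> n \<le> C * (\<psi> (nat k) + \<psi> (nat (int n - k)))"
        using C[of "nat k" "nat (int n - k)"] by (simp flip: nat_add_distrib)
      then have "norm (coef v k) * norm (coef w (int n - k)) * \<psi> n \<le>
          norm (coef v k) * norm (coef w (int n - k)) * (C * (\<psi> (nat k) + \<psi> (nat (int n - k))))"
        by (rule mult_left_mono) simp
      then show ?thesis using True by (simp add: wcoef_def algebra_simps)
    next
      case False
      then have "coef v k = 0 \<or> coef w (int n - k) = 0" using v w by (auto simp: supported_def)
      moreover have "C * (norm (coef w (int n - k)) * wcoef \<psi> v k) + C * (norm (coef v k) * wcoef \<psi> w (int n - k)) = 0"
        using False v w by (auto simp: supported_def wcoef_def)
      ultimately show ?thesis by auto
    qed
  qed
  finally show ?thesis .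
qed

lemma wfin_add:
  assumes F: "gauge F" and \<psi>: "\<psi> \<in> weights" and v: "wfin F \<psi> v" and w: "wfin F \<psi> w"
  shows "wfin F \<psi> (v + w)" unfolding wfin_def
proof (rule summable_comparison_test[OF _ summable_add[OF wfin_scaled[OF F \<psi> v, of 2] wfin_scaled[OF F \<psi> w, of 2]]], intro exI allI impI)
  fix n
  have p: "\<psi> n \<ge> 0" using weights_pos[OF \<psi>, of n] by simp
  have nn: "0 \<le> norm (coef (v + w) (int n)) * \<psi> n" using p by simp
  have "norm (coef (v + w) (int n)) * \<psi> n \<le> norm (coef v (int n)) * \<psi> n + norm (coef w (int n)) * \<psi> n"
    unfolding distrib_right[symmetric] coef_simps by (intro mult_right_mono norm_triangle_ineq p)
  then have "F (norm (coef (v + w) (int n)) * \<psi> n) \<le> F (norm (coef v (int n)) * \<psi> n + norm (coef w (int n)) * \<psi> n)"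
    by (rule gauge_mono[OF F nn])
  also have "\<dots> \<le> F (2 * (norm (coef v (int n)) * \<psi> n)) + F (2 * (norm (coef w (int n)) * \<psi> n))"
    by (rule gauge_add[OF F]) (use p in auto)
  finally show "norm (F (norm (coef (v + w) (int n)) * \<psi> n)) \<le> F (2 * wcoef \<psi> v (int n)) + F (2 * wcoef \<psi> w (int n))"
    using gauge_nonneg[OF F nn] by (simp add: wcoef_def)
qed simp_all

lemma wfin_uminus: "wfin F \<psi> (- w) \<longleftrightarrow> wfin F \<psi> w" by (simp add: wfin_def)

lemma wfin_finite:
  assumes "gauge F" "finite S" "supported S w"
  shows "wfin F \<psi> w" unfolding wfin_def
proof (rule summable_finite[of "nat ` S"])
  fix n assume "n \<notin> nat ` S"
  then have "int n \<notin> S" by force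
  then show "F (norm (coef w (int n)) * \<psi> n) = 0"
    using assms(3) gauge_0[OF assms(1)] by (simp add: supported_def)
qed (use assms in simp)

lemma wfin_nonpos:
  assumes "gauge F" "supported {..0} w"
  shows "wfin F \<psi> w" unfolding wfin_def
proof (rule summable_finite[of "{0}"])
  fix n :: nat assume "n \<notin> {0}"
  then show "F (norm (coef w (int n)) * \<psi> n) = 0"
    using assms(2) gauge_0[OF assms(1)] by (simp add: supported_def)
qed simp

lemma wfin_mult_nonneg:
  assumes F: "gauge F" and \<psi>: "\<psi> \<in> weights" and v: "wfin F \<psi> v" "supported {0..} v"
    and w: "wfin F \<psi> w" "supported {0..} w"
  shows "wfin F \<psi> (v * w)"
proof -
  obtain C where C: "C \<ge> 1" "\<And>i j. \<psi> (i + j) \<le> C * (\<psi> i + \<psi> j)"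
    using weights_doubling[OF \<psi>] by metis
  define X where "X n = C * wconv \<psi> w v (int n)" for n
  define Y where "Y n = C * wconv \<psi> v w (int n)" for n
  have nn: "X n \<ge> 0" "Y n \<ge> 0" for n unfolding X_def Y_def using C(1)
    by (auto intro!: mult_nonneg_nonneg infsum_nonneg wcoef_nonneg[OF \<psi>])
  have s: "summable (\<lambda>n. F (2 * X n) + F (2 * Y n))" unfolding X_def Y_def mult.assoc[symmetric]
    by (intro summable_add wfin_convolution[OF F \<psi>] v w) (use C in auto)
  have "summable (\<lambda>n. F (X n + Y n))" by (rule summable_comparison_test[OF _ s])
      (use gauge_add[OF F nn] gauge_nonneg[OF F add_nonneg_nonneg[OF nn]] in auto)
  then show ?thesis by (rule wfin_comparison[OF F \<psi>])
      (use weighted_coef_mult_le[OF \<psi> C(2) v(2) w(2)] in \<open>simp add: X_def Y_def\<close>)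
qed

text \<open>A finite part p of u gives u = p + e u with e = 1 - v p of small norm and in the
  weighted class. In the product e u the weight falls on e, which is summable, or on u, where
  convolution with e is a contraction whose result is absorbed into the left side.\<close>

lemma wfin_inverse:
  assumes F: "gauge F" and \<psi>: "\<psi> \<in> weights" and v: "wfin F \<psi> v" "supported {0..} v"
    and u: "supported {0..} u" and inv: "v * u = 1"
  shows "wfin F \<psi> u"
proof -
  obtain C where C: "C \<ge> 1" "\<And>i j. \<psi> (i + j) \<le> C * (\<psi> i + \<psi> j)"
    using weights_doubling[OF \<psi>] by metis
  \<comment> \<open>Chosen so that 2 C e has norm at most 1/2: the factor C comes from splitting the
    weight, the 2 from splitting F over a sum.\<close>
  define d where "d = 1 / (4 * C * (norm v + 1))"
  have nv: "norm v + 1 > 0" by (rule add_nonneg_pos) auto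
  have d: "d > 0" unfolding d_def using C(1) nv by simp
  obtain S where S: "finite S" "\<And>A. S \<inter> A = {} \<Longrightarrow> norm (restr A u) < d"
    using restr_approx[of d "{}" u] d by auto
  define p where "p = restr S u"
  have p: "supported {0..} p" "supported S p" using u by (auto simp: p_def supported_def)
  have up: "u - p = restr (-S) u" unfolding p_def by (rule l1z_eqI) simp
  define e where "e = 1 - v * p"
  have "e = v * (u - p)" by (simp add: e_def right_diff_distrib inv)
  then have ue: "u = p + e * u" by (simp add: e_def algebra_simps)
  have "norm e \<le> norm v * norm (u - p)" unfolding \<open>e = v * (u - p)\<close> by (rule norm_mult_ineq)
  also have "\<dots> \<le> (norm v + 1) * d" using S(2)[of "-S"] up nv by (intro mult_mono) auto
  also have "\<dots> = 1 / (4 * C)" using nv by (simp add: d_def)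
  finally have ne: "norm ((2 * C) *\<^sub>R e) \<le> 1 / 2" using C(1) by (simp add: field_simps)
  have e: "supported {0..} e" "wfin F \<psi> e" unfolding e_def diff_conv_add_uminus
  proof -
    have "supported {0..} (v * p)" by (rule supported_mult[OF v(2) p(1)]) simp
    then show "supported {0..} (1 + - (v * p))" by (auto simp: supported_def coef_one)
    have "wfin F \<psi> 1" by (rule wfin_finite[OF F, of "{0}"]) (auto simp: supported_def coef_one)
    moreover have "wfin F \<psi> p" by (rule wfin_finite[OF F S(1) p(2)])
    ultimately show "wfin F \<psi> (1 + - (v * p))"
      by (intro wfin_add[OF F \<psi>]) (auto simp: wfin_uminus intro: wfin_mult_nonneg[OF F \<psi> v] p)
  qed
  define X where "X n = norm (coef u (int n)) * \<psi> n" for n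
  define H1 where "H1 n = norm (coef p (int n)) * \<psi> n" for n
  define H2 where "H2 n = C * wconv \<psi> u e (int n)" for n
  define E where "E n = C * wconv \<psi> e u (int n)" for n
  have pn: "\<psi> n \<ge> 0" for n using weights_pos[OF \<psi>, of n] by simp
  have X0: "X n \<ge> 0" for n using pn by (simp add: X_def)
  have XH: "X n \<le> H1 n + H2 n + E n" for n
  proof -
    have "X n \<le> (norm (coef p (int n)) + norm (coef (e * u) (int n))) * \<psi> n"
      unfolding X_def using norm_triangle_ineq[of "coef p (int n)" "coef (e * u) (int n)"]
      by (intro mult_right_mono pn) (subst ue, simp)
    then show ?thesis
      using weighted_coef_mult_le[OF \<psi> C(2) e(1) u, of n] by (simp add: H1_def H2_def E_def algebra_simps)
  qed
  have H1: "summable (\<lambda>n. F (4 * H1 n))"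
    using wfin_scaled[OF F \<psi> wfin_finite[OF F S(1) p(2)], of 4] by (simp add: H1_def wcoef_def)
  have H2: "summable (\<lambda>n. F (4 * H2 n))"
    unfolding H2_def mult.assoc[symmetric] by (rule wfin_convolution[OF F \<psi> e(2)]) (use C in simp)
  have nn: "H1 n \<ge> 0" "H2 n \<ge> 0" "E n \<ge> 0" for n unfolding H1_def H2_def E_def using C(1) pn
    by (auto intro!: mult_nonneg_nonneg infsum_nonneg wcoef_nonneg[OF \<psi>])
  define K where "K = (\<Sum>n. F (4 * H1 n) + F (4 * H2 n))"
  have FX: "F (X n) \<le> (F (4 * H1 n) + F (4 * H2 n)) + F (2 * E n)" for n
  proof -
    have "F (X n) \<le> F ((H1 n + H2 n) + E n)" by (rule gauge_mono[OF F X0 XH])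
    also have "\<dots> \<le> F (2 * (H1 n + H2 n)) + F (2 * E n)" by (rule gauge_add[OF F]) (use nn in auto)
    also have "F (2 * (H1 n + H2 n)) \<le> F (2 * (2 * H1 n)) + F (2 * (2 * H2 n))"
      unfolding distrib_left by (rule gauge_add[OF F]) (use nn in auto)
    finally show ?thesis by simp
  qed
  have "(\<Sum>n<N. F (X n)) \<le> 2 * K" for N
  proof -
    \<comment> \<open>Truncation makes the sum to be absorbed finite beforehand. It does not alter E
      n for n < N, as e has nonnegative spectrum and so only coefficients of u up to n
      occur.\<close>
    define G where "G j = (if j < int N then wcoef \<psi> u j else 0)" for j
    have G0: "G j \<ge> 0" for j by (simp add: G_def wcoef_nonneg[OF \<psi>])
    have GX: "G j = (if 0 \<le> j \<and> j < int N then X (nat j) else 0)" for j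
      by (simp add: G_def wcoef_def X_def)
    have Gb: "G j \<le> (\<Sum>n<N. X n)" for j
    proof (cases "0 \<le> j \<and> j < int N")
      case True
      then show ?thesis using member_le_sum[of "nat j" "{..<N}" X] X0 by (simp add: GX nat_less_iff)
    qed (use X0 in \<open>auto simp: GX intro: sum_nonneg\<close>)
    have GS: "(\<Sum>j\<in>T. F (G j)) \<le> (\<Sum>n<N. F (X n))" if "finite T" for T
    proof -
      have "(\<Sum>j\<in>T. F (G j)) = (\<Sum>j\<in>T \<inter> int ` {..<N}. F (G j))"
        using that by (intro sum.mono_neutral_right) (auto simp: GX gauge_0[OF F] image_iff Bex_def dest!: zero_le_imp_eq_int)
      also have "\<dots> \<le> (\<Sum>j\<in>int ` {..<N}. F (G j))"
        by (rule sum_mono2) (auto intro: gauge_nonneg[OF F] G0)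
      also have "\<dots> = (\<Sum>n<N. F (X n))" by (simp add: sum.reindex GX)
      finally show ?thesis .
    qed
    have E: "2 * E n = (\<Sum>\<^sub>\<infinity>k. norm (coef ((2 * C) *\<^sub>R e) k) * G (int n - k))" if "n < N" for n
    proof -
      have "2 * E n = (\<Sum>\<^sub>\<infinity>k. 2 * C * (norm (coef e k) * wcoef \<psi> u (int n - k)))"
        by (simp add: E_def infsum_cmult_right' mult.assoc)
      also have "\<dots> = (\<Sum>\<^sub>\<infinity>k. norm (coef ((2 * C) *\<^sub>R e) k) * G (int n - k))"
      proof (rule infsum_cong)
        fix k
        show "2 * C * (norm (coef e k) * wcoef \<psi> u (int n - k)) = norm (coef ((2 * C) *\<^sub>R e) k) * G (int n - k)"
          using e(1) that C(1) by (cases "k \<ge> 0") (auto simp: G_def supported_def)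
      qed
      finally show ?thesis .
    qed
    have "(\<Sum>j\<in>int ` {..<N}. F (\<Sum>\<^sub>\<infinity>k. norm (coef ((2 * C) *\<^sub>R e) k) * G (j - k))) \<le>
        norm ((2 * C) *\<^sub>R e) * (\<Sum>n<N. F (X n))"
      by (rule gauge_convolution[OF F _ G0 Gb GS]) (use ne in auto)
    also have "\<dots> \<le> 1 / 2 * (\<Sum>n<N. F (X n))"
      by (intro mult_right_mono ne sum_nonneg gauge_nonneg[OF F X0])
    also have "(\<Sum>j\<in>int ` {..<N}. F (\<Sum>\<^sub>\<infinity>k. norm (coef ((2 * C) *\<^sub>R e) k) * G (j - k))) = (\<Sum>n<N. F (2 * E n))"
      by (simp add: sum.reindex E del: coef_simps)
    finally have 1: "(\<Sum>n<N. F (2 * E n)) \<le> 1 / 2 * (\<Sum>n<N. F (X n))" .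
    have "(\<Sum>n<N. F (X n)) \<le> (\<Sum>n<N. F (4 * H1 n) + F (4 * H2 n)) + (\<Sum>n<N. F (2 * E n))"
      unfolding sum.distrib[symmetric] by (rule sum_mono) (use FX in simp)
    also have "(\<Sum>n<N. F (4 * H1 n) + F (4 * H2 n)) \<le> K" unfolding K_def
      by (rule sum_le_suminf[OF summable_add[OF H1 H2]]) (auto intro!: add_nonneg_nonneg gauge_nonneg[OF F] nn)
    finally show ?thesis using 1 by simp
  qed
  then have "summable (\<lambda>n. F (X n))"
    by (intro summableI_nonneg_bounded[where x = "2 * K"] gauge_nonneg[OF F X0])
  then show ?thesis by (simp add: wfin_def X_def)
qed

lemma Fl_iff:
  assumes f: "\<And>t. t \<in> circle \<Longrightarrow> f t = ev w t"
  shows "f \<in> Fl Phi Psi \<phi> \<psi> \<longleftrightarrow> wfin Phi \<phi> (reflect w) \<and> wfin Psi \<psi> w"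
proof -
  have "L1T f" by (rule L1T_continuous) (use continuous_on_ev f continuous_on_cong in blast)
  moreover have "summable (\<lambda>k. Phi (norm (coef w (- int (Suc k))) * \<phi> (Suc k))) \<longleftrightarrow> wfin Phi \<phi> (reflect w)"
    unfolding wfin_def coef_reflect
    using summable_Suc_iff[of "\<lambda>k. Phi (norm (coef w (- int k)) * \<phi> k)"] by simp
  ultimately show ?thesis unfolding Fl_def by (simp add: fc_eq_coef[OF f] wfin_def)
qed

lemma wfin_factorization:
  assumes gauge: "gauge Phi" "gauge Psi" and wt: "\<phi> \<in> weights" "\<psi> \<in> weights"
    and A: "wfin Phi \<phi> (reflect A)" "wfin Psi \<psi> A"
    and sp: "supported {..0} Am" "supported {..0} V" "supported {0..} Ap" "supported {0..} U"
    and eq: "Am * Ap = A" "Am * V = 1" "Ap * U = 1"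
  shows "wfin Psi \<psi> Ap" "wfin Psi \<psi> U" "wfin Phi \<phi> (reflect Am)" "wfin Phi \<phi> (reflect V)"
proof -
  have Ap: "V * A = Ap" using eq by (metis mult.assoc mult.commute mult_1)
  have Am: "U * A = Am" using eq by (metis mult.assoc mult.commute mult_1)
  show 1: "wfin Psi \<psi> Ap" using wfin_mult_nonpos[OF gauge(2) wt(2) A(2) sp(2)] by (simp add: Ap)
  show "wfin Psi \<psi> U" by (rule wfin_inverse[OF gauge(2) wt(2) 1 sp(3,4) eq(3)])
  have "wfin Phi \<phi> (reflect U * reflect A)"
    by (rule wfin_mult_nonpos[OF gauge(1) wt(1) A(1)]) (simp add: supported_reflect sp)
  then show 2: "wfin Phi \<phi> (reflect Am)" by (simp add: Am flip: reflect_mult)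
  show "wfin Phi \<phi> (reflect V)" by (rule wfin_inverse[OF gauge(1) wt(1) 2])
      (simp_all add: supported_reflect sp eq flip: reflect_mult)
qed

section \<open>Solutions of finite Toeplitz systems\<close>

lemma supported_mono: "supported S w \<Longrightarrow> S \<subseteq> T \<Longrightarrow> supported T w" by (auto simp: supported_def)

lemma restr_add: "restr S (v + w) = restr S v + restr S w" by (rule l1z_eqI) simp

lemma restr_eq_0: "supported S w \<Longrightarrow> S \<inter> T = {} \<Longrightarrow> restr T w = 0"
  by (rule l1z_eqI) (auto simp: supported_def)

lemma coef_mult_sup_bound:
  assumes v: "supported S v" and w: "\<And>k. k \<in> S \<Longrightarrow> norm (coef w (j - k)) \<le> \<epsilon>"
  shows "norm (coef (v * w) j) \<le> norm v * \<epsilon>"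
proof (rule norm_infsum_le[OF coef_mult_has_sum])
  show "((\<lambda>k. norm (coef v k) * \<epsilon>) has_sum norm v * \<epsilon>) UNIV"
    unfolding norm_l1z_def by (rule has_sum_cmult_left[OF has_sum_infsum]) simp
  show "norm (coef v k * coef w (j - k)) \<le> norm (coef v k) * \<epsilon>" for k
    using v w by (cases "k \<in> S") (auto simp: supported_def norm_mult intro!: mult_left_mono)
qed

text \<open>\<open>V\<close> and \<open>U\<close> are the inverses of the factors a_- and a_+. The
  locale is used twice, for a(t) and for a(1/t).\<close>

locale wiener_hopf =
  fixes Am Ap V U :: l1z
  assumes sp: "supported {..0} Am" "supported {..0} V" "supported {0..} Ap" "supported {0..} U"
    and AmV: "Am * V = 1" and ApU: "Ap * U = 1"
begin

definition a :: l1z where "a = Am * Ap"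
definition b :: l1z where "b = Am * U"
definition c :: l1z where "c = Ap * V"

text \<open>\<open>xi\<close> and \<open>zeta\<close> encode the parts of a x below 0 and above n
  that a finite system ignores, divided by the factor of a whose inverse preserves the respective
  half-line.\<close>

definition xi :: "l1z \<Rightarrow> l1z" where "xi x = V * restr {..<0} (a * x)"
definition zeta :: "int \<Rightarrow> l1z \<Rightarrow> l1z" where "zeta n x = U * restr {n<..} (a * x)"

definition solves :: "int \<Rightarrow> l1z \<Rightarrow> l1z \<Rightarrow> bool" where
  "solves n x y \<longleftrightarrow> 0 \<le> n \<and> supported {0..n} x \<and> supported {0..n} y \<and>
     (\<forall>j\<in>{0..n}. coef (a * x) j = coef y j)"

lemma xi_supported: "supported {..<0} (xi x)"
  unfolding xi_def by (rule supported_mult[OF sp(2) supported_restr]) auto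

lemma zeta_supported: "supported {n<..} (zeta n x)"
  unfolding zeta_def by (rule supported_mult[OF sp(4) supported_restr]) auto

context
  fixes n :: int and x y :: l1z
  assumes sol: "solves n x y"
begin

lemma ax_eq: "a * x = y + Am * xi x + Ap * zeta n x"
proof -
  have "a * x = y + restr {..<0} (a * x) + restr {n<..} (a * x)"
    by (rule l1z_eqI) (use sol in \<open>auto simp: solves_def supported_def\<close>)
  moreover have "Am * xi x = (Am * V) * restr {..<0} (a * x)" by (simp add: xi_def mult.assoc)
  moreover have "Ap * zeta n x = (Ap * U) * restr {n<..} (a * x)" by (simp add: zeta_def mult.assoc)
  ultimately show ?thesis by (simp add: AmV ApU)
qed

text \<open>Here and in \<open>Amx_eq\<close> one unknown is freed of its factor. Since
  \<open>Ap * x\<close> has no frequencies below 0 and \<open>Am * x\<close> none above n, the two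
  identities become equations for \<open>xi\<close> and \<open>zeta\<close>.\<close>

lemma Apx_eq: "Ap * x = V * y + xi x + c * zeta n x"
proof -
  have "Ap * x = (Am * V) * (Ap * x)" by (simp add: AmV)
  also have "\<dots> = V * (a * x)" by (simp add: a_def mult_ac)
  also have "\<dots> = V * y + (Am * V) * xi x + c * zeta n x"
    unfolding ax_eq c_def by (simp only: distrib_left mult_ac)
  finally show ?thesis by (simp add: AmV)
qed

lemma Amx_eq: "Am * x = U * y + b * xi x + zeta n x"
proof -
  have "Am * x = (Ap * U) * (Am * x)" by (simp add: ApU)
  also have "\<dots> = U * (a * x)" by (simp add: a_def mult_ac)
  also have "\<dots> = U * y + b * xi x + (Ap * U) * zeta n x"
    unfolding ax_eq b_def by (simp only: distrib_left mult_ac)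
  finally show ?thesis by (simp add: ApU)
qed

lemma x_eq: "x = U * V * y + U * xi x + V * zeta n x"
proof -
  have "x = (Ap * U) * x" by (simp add: ApU)
  also have "\<dots> = U * (Ap * x)" by (simp only: mult_ac)
  also have "\<dots> = U * V * y + U * xi x + (Ap * U) * V * zeta n x"
    unfolding Apx_eq c_def by (simp only: distrib_left mult_ac)
  finally show ?thesis by (simp add: ApU)
qed

lemma x_sp: "supported {0..n} x" using sol by (simp add: solves_def)

lemma coef_xi: "j < 0 \<Longrightarrow> coef (xi x) j = - coef (V * y) j - coef (c * zeta n x) j"
proof -
  assume j: "j < 0"
  have "supported {0..} (Ap * x)" by (rule supported_mult[OF sp(3) x_sp]) auto
  then have "coef (Ap * x) j = 0" using j by (simp add: supported_def)
  then show ?thesis unfolding Apx_eq coef_simps by (simp add: algebra_simps eq_neg_iff_add_eq_0)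
qed

lemma Amx_supported: "supported {..n} (Am * x)" by (rule supported_mult[OF sp(1) x_sp]) auto

lemma coef_zeta: "j > n \<Longrightarrow> coef (zeta n x) j = - coef (U * y) j - coef (b * xi x) j"
proof -
  assume j: "j > n"
  then have "coef (Am * x) j = 0" using Amx_supported by (simp add: supported_def)
  then show ?thesis unfolding Amx_eq coef_simps by (simp add: algebra_simps eq_neg_iff_add_eq_0)
qed

text \<open>\<open>zeta\<close> lives above n, so only frequencies of \<open>c\<close> below -n can
  bring it back to negative ones: the coupling is a tail of \<open>c\<close>.\<close>

lemma norm_xi_le: "norm (xi x) \<le> norm V * norm y + norm (restr {..< -n} c) * norm (zeta n x)"
proof -
  have c: "restr {..< -n} c + restr {-n..} c = c" by (rule l1z_eqI) auto
  have "restr {..<0} (c * zeta n x) = restr {..<0} (restr {..< -n} c * zeta n x) + restr {..<0} (restr {-n..} c * zeta n x)"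
    unfolding restr_add[symmetric] distrib_right[symmetric] c ..
  also have "restr {..<0} (restr {-n..} c * zeta n x) = 0"
    by (rule restr_eq_0[of "{0..}"], rule supported_mult[OF supported_restr zeta_supported]) auto
  finally have 1: "restr {..<0} (c * zeta n x) = restr {..<0} (restr {..< -n} c * zeta n x)" by simp
  have "xi x = - (restr {..<0} (V * y) + restr {..<0} (c * zeta n x))"
    by (rule l1z_eqI) (use xi_supported in \<open>auto simp: coef_xi supported_def\<close>)
  then have "norm (xi x) \<le> norm (restr {..<0} (V * y)) + norm (restr {..<0} (c * zeta n x))"
    using norm_triangle_ineq[of "restr {..<0} (V * y)" "restr {..<0} (c * zeta n x)"] by (metis norm_minus_cancel)
  also have "\<dots> \<le> norm V * norm y + norm (restr {..< -n} c) * norm (zeta n x)"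
    unfolding 1 by (intro add_mono order.trans[OF norm_restr_le norm_mult_ineq])
  finally show ?thesis .
qed

lemma norm_zeta_le: "norm (zeta n x) \<le> norm U * norm y + norm (restr {n<..} b) * norm (xi x)"
proof -
  have c: "restr {n<..} b + restr {..n} b = b" by (rule l1z_eqI) auto
  have "restr {n<..} (b * xi x) = restr {n<..} (restr {n<..} b * xi x) + restr {n<..} (restr {..n} b * xi x)"
    unfolding restr_add[symmetric] distrib_right[symmetric] c ..
  also have "restr {n<..} (restr {..n} b * xi x) = 0"
    by (rule restr_eq_0[of "{..n}"], rule supported_mult[OF supported_restr xi_supported]) auto
  finally have 1: "restr {n<..} (b * xi x) = restr {n<..} (restr {n<..} b * xi x)" by simp
  have "zeta n x = - (restr {n<..} (U * y) + restr {n<..} (b * xi x))"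
    by (rule l1z_eqI) (use zeta_supported in \<open>auto simp: coef_zeta supported_def\<close>)
  then have "norm (zeta n x) \<le> norm (restr {n<..} (U * y)) + norm (restr {n<..} (b * xi x))"
    using norm_triangle_ineq[of "restr {n<..} (U * y)" "restr {n<..} (b * xi x)"] by (metis norm_minus_cancel)
  also have "\<dots> \<le> norm U * norm y + norm (restr {n<..} b) * norm (xi x)"
    unfolding 1 by (intro add_mono order.trans[OF norm_restr_le norm_mult_ineq])
  finally show ?thesis .
qed

lemma solution_bounds:
  assumes "norm (restr {..< -n} c) \<le> 1 / 2" "norm (restr {n<..} b) \<le> 1 / 2"
  shows "norm (xi x) \<le> 2 * (norm V + norm U) * norm y" "norm (zeta n x) \<le> 2 * (norm V + norm U) * norm y"
proof -
  have "norm (xi x) \<le> norm V * norm y + 1 / 2 * norm (zeta n x)"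
    using norm_xi_le mult_right_mono[OF assms(1), of "norm (zeta n x)"] by simp
  moreover have "norm (zeta n x) \<le> norm U * norm y + 1 / 2 * norm (xi x)"
    using norm_zeta_le mult_right_mono[OF assms(2), of "norm (xi x)"] by simp
  moreover have "norm V * norm y \<ge> 0" "norm U * norm y \<ge> 0" by simp_all
  moreover have "2 * (norm V + norm U) * norm y = 2 * (norm V * norm y) + 2 * (norm U * norm y)"
    by (simp add: algebra_simps)
  ultimately show "norm (xi x) \<le> 2 * (norm V + norm U) * norm y" "norm (zeta n x) \<le> 2 * (norm V + norm U) * norm y"
    by linarith+
qed

text \<open>For entries far below the diagonal of the inverse Toeplitz matrix. As \<open>V\<close>
  has nonpositive spectrum, the j-th entry of x = V (Am x) depends on \<open>Am * x\<close> from j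
  upwards. There it vanishes above n, and up to n the \<open>zeta\<close> term is absent, leaving
  \<open>U\<close> and \<open>b\<close> at indices at least j - k.\<close>

lemma solution_top_coef_bound:
  assumes tails: "norm (restr {..< -n} c) \<le> 1 / 2" "norm (restr {n<..} b) \<le> 1 / 2"
    and y: "y = monomial 1 k" "k \<ge> 0"
    and e: "\<And>s. s \<ge> j - k \<Longrightarrow> norm (coef U s) \<le> \<epsilon>" "\<And>s. s \<ge> j - k \<Longrightarrow> norm (coef b s) \<le> \<epsilon>" "\<epsilon> \<ge> 0"
  shows "norm (coef x j) \<le> norm V * ((1 + 2 * (norm V + norm U)) * \<epsilon>)"
proof -
  have "x = V * (Am * x)" using AmV by (metis mult.assoc mult.commute mult_1)
  moreover have "norm (coef (V * (Am * x)) j) \<le> norm V * ((1 + 2 * (norm V + norm U)) * \<epsilon>)"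
  proof (rule coef_mult_sup_bound[OF sp(2)])
    fix d :: int assume d: "d \<in> {..0}"
    define i where "i = j - d"
    have i: "i \<ge> j" using d by (simp add: i_def)
    have D: "(1 + 2 * (norm V + norm U)) * \<epsilon> = 1 * \<epsilon> + 2 * (norm V + norm U) * \<epsilon>"
      by (simp add: algebra_simps)
    show "norm (coef (Am * x) (j - d)) \<le> (1 + 2 * (norm V + norm U)) * \<epsilon>"
    proof (cases "i \<le> n")
      case True
      then have "coef (zeta n x) i = 0" using zeta_supported by (simp add: supported_def)
      then have "coef (Am * x) i = coef (monomial 1 k * U) i + coef (xi x * b) i"
        by (simp add: Amx_eq y mult.commute)
      moreover have "norm (coef (monomial 1 k * U) i) \<le> norm (monomial 1 k) * \<epsilon>"
        by (rule coef_mult_sup_bound[of "{k}"]) (use i in \<open>auto simp: supported_def intro!: e(1)\<close>)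
      moreover have "norm (coef (xi x * b) i) \<le> norm (xi x) * \<epsilon>"
        by (rule coef_mult_sup_bound[OF xi_supported]) (use i y(2) in \<open>auto intro!: e(2)\<close>)
      moreover have "norm (xi x) * \<epsilon> \<le> 2 * (norm V + norm U) * \<epsilon>"
        using solution_bounds(1)[OF tails] y(1) e(3) by (intro mult_right_mono) auto
      ultimately show ?thesis
        unfolding D i_def[symmetric] using norm_triangle_ineq[of "coef (monomial 1 k * U) i" "coef (xi x * b) i"]
        by simp
    next
      case False
      then have "coef (Am * x) i = 0" using Amx_supported by (simp add: supported_def)
      then show ?thesis using e(3) by (simp add: i_def)
    qed
  qed
  ultimately show ?thesis by metis
qed

text \<open>For y = 1 the zeroth entry of x is D_(n-1)(a) / D_n(a), and the product of the mean
  values is G(a); the last summand is thus the error e_n.\<close>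

lemma solution_coef_0:
  assumes "y = 1" "n \<ge> 0"
  shows "coef Am 0 * coef Ap 0 * coef x 0 = 1 + coef Am 0 * coef (c * zeta n x) 0"
proof -
  have "supported {0..} x" using x_sp by (rule supported_mono) auto
  then have "coef Ap 0 * coef x 0 = coef (Ap * x) 0" using sp by (simp add: coef_mult_0)
  also have "\<dots> = coef V 0 + coef (c * zeta n x) 0"
    using xi_supported by (simp add: Apx_eq assms supported_def)
  finally have "coef Am 0 * (coef Ap 0 * coef x 0) = coef Am 0 * coef V 0 + coef Am 0 * coef (c * zeta n x) 0"
    by (simp add: distrib_left)
  moreover have "coef Am 0 * coef V 0 = 1" using coef_mult_0[of Am V] sp AmV by (simp add: coef_one)
  ultimately show ?thesis by (simp add: mult.assoc)
qed

end

lemma solves_0_imp: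
  assumes "solves n x 0" "norm (restr {..< -n} c) \<le> 1 / 2" "norm (restr {n<..} b) \<le> 1 / 2"
  shows "x = 0"
proof -
  have "xi x = 0" "zeta n x = 0" using solution_bounds[OF assms] by simp_all
  then show ?thesis using x_eq[OF assms(1)] by simp
qed

lemma tails_small:
  obtains n0 :: nat where "\<And>n. n \<ge> int n0 \<Longrightarrow> norm (restr {..< -n} c) \<le> 1 / 2"
    "\<And>n. n \<ge> int n0 \<Longrightarrow> norm (restr {n<..} b) \<le> 1 / 2"
proof -
  obtain F where F: "finite F" "\<And>A. F \<inter> A = {} \<Longrightarrow> norm (restr A c) < 1 / 2"
    using restr_approx[of "1 / 2" "{}" c] by auto
  obtain G where G: "finite G" "\<And>A. G \<inter> A = {} \<Longrightarrow> norm (restr A b) < 1 / 2"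
    using restr_approx[of "1 / 2" "{}" b] by auto
  define n0 where "n0 = nat (Max (insert 0 (abs ` (F \<union> G))))"
  have n0: "\<bar>k\<bar> \<le> int n0" if "k \<in> F \<union> G" for k
    unfolding n0_def using F(1) G(1) that Max_ge[of "insert 0 (abs ` (F \<union> G))" "\<bar>k\<bar>"] by simp
  show ?thesis
  proof (rule that)
    fix n assume n: "n \<ge> int n0"
    have "F \<inter> {..< -n} = {}" using n0 n by fastforce
    then show "norm (restr {..< -n} c) \<le> 1 / 2" using F(2) less_imp_le by blast
    have "G \<inter> {n<..} = {}" using n0 n by fastforce
    then show "norm (restr {n<..} b) \<le> 1 / 2" using G(2) less_imp_le by blast
  qed
qed

end

section \<open>Summability of the errors e_n\<close>

context wiener_hopf
begin

text \<open>Insert the equation for \<open>xi\<close> into the one for \<open>zeta\<close>, with y =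
  1: this majorizes, independently of n, the part at frequency p that does not involve
  \<open>zeta\<close> again.\<close>

definition Ubar :: "int \<Rightarrow> real" where
  "Ubar p = norm (coef U p) + (\<Sum>\<^sub>\<infinity>k. norm (coef b k) * (if p - k < 0 then norm (coef V (p - k)) else 0))"

text \<open>Summation over n comes before any supremum over frequencies. At p only the n < p
  contribute, so the source adds up to at most p times \<open>Ubar p\<close>; the feedback passes
  through tails of \<open>b\<close> and \<open>c\<close> and returns at most a quarter of B. From B
  <= K + B/4 follows the constant 4/3.\<close>

lemma zeta_error_sum:
  fixes x :: "nat \<Rightarrow> l1z"
  assumes tails: "\<And>n. n \<ge> int n0 \<Longrightarrow> norm (restr {..< -n} c) \<le> 1 / 2"
      "\<And>n. n \<ge> int n0 \<Longrightarrow> norm (restr {n<..} b) \<le> 1 / 2"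
    and sol: "\<And>n. n \<ge> n0 \<Longrightarrow> solves (int n) (x n) 1"
    and W: "\<And>p. 0 \<le> W p" "\<And>p. p > 0 \<Longrightarrow> of_int p * Ubar p \<le> W p"
    and K: "\<And>m T. m \<le> 0 \<Longrightarrow> finite T \<Longrightarrow> (\<Sum>k\<in>T. norm (coef c k) * W (m - k)) \<le> K"
  shows "(\<Sum>n=n0..N. norm (coef (c * zeta (int n) (x n)) 0)) \<le> 4 / 3 * K"
proof -
  define Z where "Z n p = norm (coef (zeta (int n) (x n)) p)" for n p
  define X where "X n p = norm (coef (xi (x n)) p)" for n p
  define s where "s n m = (\<Sum>\<^sub>\<infinity>k. norm (coef c k) * Z n (m - k))" for n m
  define \<sigma> where "\<sigma> m = (\<Sum>n=n0..N. s n m)" for m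
  define Vn where "Vn q = (if q < 0 then norm (coef V q) else 0)" for q
  define Sn where "Sn n q = (if q < 0 then s n q else 0)" for n q
  define R where "R n p = (\<Sum>\<^sub>\<infinity>k. norm (coef b k) * Sn n (p - k))" for n p
  define z where "z p = (\<Sum>n=n0..N. Z n p)" for p
  have Z: "0 \<le> Z n p" "Z n p \<le> norm (zeta (int n) (x n))" for n p
    by (simp_all add: Z_def norm_coef_le)
  have sh: "((\<lambda>k. norm (coef c k) * Z n (m - k)) has_sum s n m) UNIV" for n m
    unfolding s_def by (rule has_sum_infsum[OF weighted_coef_summable[OF Z]])
  have s0: "0 \<le> s n m" for n m unfolding s_def by (rule infsum_nonneg) (simp add: Z)
  have sb: "s n m \<le> norm c * norm (zeta (int n) (x n))" for n m
  proof (rule has_sum_mono[OF sh])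
    show "((\<lambda>k. norm (coef c k) * norm (zeta (int n) (x n))) has_sum norm c * norm (zeta (int n) (x n))) UNIV"
      unfolding norm_l1z_def[of c] by (rule has_sum_cmult_left[OF has_sum_infsum]) simp
  qed (simp add: Z mult_left_mono)
  have cz: "norm (coef (c * zeta (int n) (x n)) m) \<le> s n m" for n m
    unfolding s_def Z_def by (rule norm_coef_mult_le)
  have Xle: "X n q \<le> Vn q + Sn n q" if n: "n \<ge> n0" for n q
  proof (cases "q < 0")
    case True
    then have "X n q \<le> norm (coef V q) + norm (coef (c * zeta (int n) (x n)) q)"
      using norm_triangle_ineq4[of "- coef V q" "coef (c * zeta (int n) (x n)) q"]
      by (simp add: X_def coef_xi[OF sol[OF n] True])
    then show ?thesis using cz[of n q] True by (simp add: Vn_def Sn_def)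
  next
    case False
    then show ?thesis using xi_supported[of "x n"] by (simp add: X_def Vn_def Sn_def supported_def)
  qed
  have Vn: "0 \<le> Vn q" "Vn q \<le> norm V" for q by (simp_all add: Vn_def norm_coef_le)
  have Sn: "0 \<le> Sn n q" "Sn n q \<le> norm c * norm (zeta (int n) (x n))" for n q
    using s0 sb by (simp_all add: Sn_def)
  have Rh: "((\<lambda>k. norm (coef b k) * Sn n (p - k)) has_sum R n p) UNIV" for n p
    unfolding R_def by (rule has_sum_infsum[OF weighted_coef_summable[OF Sn]])
  have R0: "0 \<le> R n p" for n p unfolding R_def by (rule infsum_nonneg) (simp add: Sn)
  have Uh: "Ubar p = norm (coef U p) + (\<Sum>\<^sub>\<infinity>k. norm (coef b k) * Vn (p - k))" for p
    by (simp add: Ubar_def Vn_def)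
  have U0: "0 \<le> Ubar p" for p
    unfolding Uh by (intro add_nonneg_nonneg infsum_nonneg) (simp_all add: Vn)
  have Zle: "Z n p \<le> (if int n < p then Ubar p + R n p else 0)" if n: "n \<ge> n0" for n p
  proof (cases "int n < p")
    case True
    have "Z n p \<le> norm (coef U p) + norm (coef (b * xi (x n)) p)"
      using norm_triangle_ineq4[of "- coef U p" "coef (b * xi (x n)) p"]
      by (simp add: Z_def coef_zeta[OF sol[OF n] True])
    also have "norm (coef (b * xi (x n)) p) \<le> (\<Sum>\<^sub>\<infinity>k. norm (coef b k) * X n (p - k))"
      unfolding X_def by (rule norm_coef_mult_le)
    also have "\<dots> \<le> (\<Sum>\<^sub>\<infinity>k. norm (coef b k) * Vn (p - k)) + R n p"
    proof (rule has_sum_mono[OF has_sum_infsum has_sum_add[OF has_sum_infsum Rh]])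
      show "(\<lambda>k. norm (coef b k) * X n (p - k)) summable_on UNIV"
        by (rule weighted_coef_summable[of _ "norm (xi (x n))"]) (simp_all add: X_def norm_coef_le)
      show "(\<lambda>k. norm (coef b k) * Vn (p - k)) summable_on UNIV"
        by (rule weighted_coef_summable[OF Vn])
      show "norm (coef b k) * X n (p - k) \<le> norm (coef b k) * Vn (p - k) + norm (coef b k) * Sn n (p - k)" for k
        unfolding distrib_left[symmetric] by (rule mult_left_mono[OF Xle[OF n]]) simp
    qed
    finally show ?thesis using True by (simp add: Uh)
  next
    case False
    then show ?thesis using zeta_supported[of "int n" "x n"] by (simp add: Z_def supported_def)
  qed
  have \<sigma>b: "\<sigma> m \<le> (\<Sum>n=n0..N. norm c * norm (zeta (int n) (x n)))" for m
    unfolding \<sigma>_def by (intro sum_mono sb)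
  then have bdd: "bdd_above (\<sigma> ` {..0})" by (intro bdd_aboveI2)
  \<comment> \<open>For the finite range n0..N this supremum is finite, so it can be absorbed at the
    end. The index m = 0 is included because the claim concerns it; the feedback uses m < 0.\<close>
  define B where "B = (SUP m\<in>{..0}. \<sigma> m)"
  have \<sigma>B: "\<sigma> m \<le> B" if "m \<le> 0" for m
    unfolding B_def by (rule cSUP_upper[OF _ bdd]) (use that in simp)
  have \<sigma>0: "0 \<le> \<sigma> m" for m unfolding \<sigma>_def by (intro sum_nonneg s0)
  have B0: "0 \<le> B" using \<sigma>0[of 0] \<sigma>B[of 0] by simp
  \<comment> \<open>In R n p the index p - k must be negative, so only the tail k > p of
    \<open>b\<close> acts; this is the first factor 1/2.\<close>
  have Rsum: "(\<Sum>n=n0..N. R n p) \<le> B / 2" if p: "p \<ge> int n0" for p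
  proof -
    have "(\<Sum>n=n0..N. R n p) \<le> norm (restr {p<..} b) * B"
    proof (rule has_sum_mono)
      show "((\<lambda>k. \<Sum>n=n0..N. norm (coef b k) * Sn n (p - k)) has_sum (\<Sum>n=n0..N. R n p)) UNIV"
        by (rule has_sum_finite_sum) (simp_all add: Rh)
      show "((\<lambda>k. norm (coef (restr {p<..} b) k) * B) has_sum norm (restr {p<..} b) * B) UNIV"
        unfolding norm_l1z_def[of "restr {p<..} b"] by (rule has_sum_cmult_left[OF has_sum_infsum[OF coef_abs_summable]])
      fix k
      have "(\<Sum>n=n0..N. norm (coef b k) * Sn n (p - k)) = norm (coef b k) * (if p - k < 0 then \<sigma> (p - k) else 0)"
        by (simp add: Sn_def \<sigma>_def sum_distrib_left)
      also have "\<dots> \<le> norm (coef (restr {p<..} b) k) * B"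
        using \<sigma>B[of "p - k"] by (auto intro: mult_left_mono)
      finally show "(\<Sum>n=n0..N. norm (coef b k) * Sn n (p - k)) \<le> norm (coef (restr {p<..} b) k) * B" .
    qed
    also have "\<dots> \<le> 1 / 2 * B" by (rule mult_right_mono[OF tails(2)[OF p] B0])
    finally show ?thesis by simp
  qed
  have zle: "z p \<le> W p + (if int n0 < p then B / 2 else 0)" for p
  proof (cases "int n0 < p")
    case True
    have "z p \<le> (\<Sum>n=n0..N. (if int n < p then Ubar p else 0) + R n p)"
      unfolding z_def using Zle R0 by (intro sum_mono order.trans[OF Zle]) auto
    also have "\<dots> = of_nat (card ({n0..N} \<inter> {n. int n < p})) * Ubar p + (\<Sum>n=n0..N. R n p)"
      by (simp add: sum.distrib sum.If_cases)
    also have "card ({n0..N} \<inter> {n. int n < p}) \<le> card {..<nat p}" by (rule card_mono) auto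
    then have "of_nat (card ({n0..N} \<inter> {n. int n < p})) * Ubar p \<le> of_int p * Ubar p"
      using True by (intro mult_right_mono U0) simp
    also have "\<dots> \<le> W p" using W(2)[of p] True by simp
    also have "(\<Sum>n=n0..N. R n p) \<le> B / 2" using Rsum[of p] True by simp
    finally show ?thesis using True by simp
  next
    case False
    have "z p = 0" unfolding z_def
    proof (rule sum.neutral, rule ballI)
      fix n assume "n \<in> {n0..N}"
      then show "Z n p = 0" using Zle[of n p] Z(1)[of n p] False by auto
    qed
    then show ?thesis using W(1)[of p] False by simp
  qed
  \<comment> \<open>For m <= 0 the feedback, present only above n0, is reached through the tail of
    \<open>c\<close> below -n0; this is the second factor 1/2.\<close>
  have \<sigma>K: "\<sigma> m \<le> K + B / 4" if m: "m \<le> 0" for m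
  proof -
    have nn: "norm (coef c k) * W (m - k) \<ge> 0" for k by (simp add: W)
    have ks: "(\<lambda>k. norm (coef c k) * W (m - k)) summable_on UNIV"
      by (rule nonneg_bdd_above_summable_on) (auto intro!: bdd_aboveI2 K m simp: nn)
    have kK: "(\<Sum>\<^sub>\<infinity>k. norm (coef c k) * W (m - k)) \<le> K"
      by (rule infsum_le_finite_sums[OF ks]) (rule K[OF m])
    have "\<sigma> m \<le> (\<Sum>\<^sub>\<infinity>k. norm (coef c k) * W (m - k)) + norm (restr {..< - int n0} c) * (B / 2)"
    proof (rule has_sum_mono)
      show "((\<lambda>k. \<Sum>n=n0..N. norm (coef c k) * Z n (m - k)) has_sum \<sigma> m) UNIV"
        unfolding \<sigma>_def by (rule has_sum_finite_sum) (simp_all add: sh)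
      show "((\<lambda>k. norm (coef c k) * W (m - k) + norm (coef (restr {..< - int n0} c) k) * (B / 2)) has_sum
          (\<Sum>\<^sub>\<infinity>k. norm (coef c k) * W (m - k)) + norm (restr {..< - int n0} c) * (B / 2)) UNIV"
        unfolding norm_l1z_def[of "restr {..< - int n0} c"]
        by (rule has_sum_add[OF has_sum_infsum[OF ks] has_sum_cmult_left[OF has_sum_infsum[OF coef_abs_summable]]])
      fix k
      have "(\<Sum>n=n0..N. norm (coef c k) * Z n (m - k)) = norm (coef c k) * z (m - k)"
        by (simp add: z_def sum_distrib_left)
      also have "\<dots> \<le> norm (coef c k) * (W (m - k) + (if int n0 < m - k then B / 2 else 0))"
        by (rule mult_left_mono[OF zle]) simp
      also have "\<dots> \<le> norm (coef c k) * W (m - k) + norm (coef (restr {..< - int n0} c) k) * (B / 2)"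
        using m B0 by (auto simp: distrib_left)
      finally show "(\<Sum>n=n0..N. norm (coef c k) * Z n (m - k)) \<le>
        norm (coef c k) * W (m - k) + norm (coef (restr {..< - int n0} c) k) * (B / 2)" .
    qed
    also have "\<dots> \<le> K + 1 / 2 * (B / 2)"
      by (intro add_mono kK mult_right_mono tails(1)) (use B0 in auto)
    finally show ?thesis by simp
  qed
  have "B \<le> K + B / 4" unfolding B_def by (rule cSUP_least) (use \<sigma>K in \<open>auto simp: B_def\<close>)
  then have "B \<le> 4 / 3 * K" by simp
  moreover have "(\<Sum>n=n0..N. norm (coef (c * zeta (int n) (x n)) 0)) \<le> \<sigma> 0"
    unfolding \<sigma>_def by (intro sum_mono cz)
  ultimately show ?thesis using \<sigma>B[of 0] by simp
qed

end

section \<open>Minors of Toeplitz matrices\<close>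

lemma ldet_eq_det: "ldet n A = Determinant.det (Matrix.mat n n (\<lambda>(i, j). A i j))"
  unfolding ldet_def by (subst det_def'[of _ n]) (auto simp: lessThan_atLeast0 intro!: sum.cong prod.cong)

lemma ldet_transpose: "ldet n (\<lambda>i j. A j i) = ldet n A"
proof -
  have "Matrix.mat n n (\<lambda>(i, j). A j i) = transpose_mat (Matrix.mat n n (\<lambda>(i, j). A i j))"
    by (rule eq_matI) auto
  then show ?thesis unfolding ldet_eq_det by (simp add: Determinant.det_transpose[of _ n])
qed

lemma ldet_solutions:
  fixes A X Y :: "nat \<Rightarrow> nat \<Rightarrow> complex"
  assumes "\<And>i j. i < N \<Longrightarrow> j < N \<Longrightarrow> (\<Sum>l<N. A i l * X l j) = Y i j"
  shows "ldet N Y = ldet N A * ldet N X"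
proof -
  have "Matrix.mat N N (\<lambda>(i, j). Y i j) = Matrix.mat N N (\<lambda>(i, j). A i j) * Matrix.mat N N (\<lambda>(i, j). X i j)"
    by (rule eq_matI) (auto simp: scalar_prod_def lessThan_atLeast0 assms[symmetric])
  then show ?thesis unfolding ldet_eq_det by (simp add: Determinant.det_mult[of _ N])
qed

lemma ldet_block_lower_left_zero:
  assumes zero: "\<And>i j. k \<le> i \<Longrightarrow> i < k + m \<Longrightarrow> j < k \<Longrightarrow> A i j = 0"
    and B: "\<And>i j. i < k \<Longrightarrow> j < k \<Longrightarrow> A i j = B i j"
    and D: "\<And>i j. i < m \<Longrightarrow> j < m \<Longrightarrow> A (k + i) (k + j) = D i j"
  shows "ldet (k + m) A = ldet k B * ldet m D"
proof -
  have "Matrix.mat (k + m) (k + m) (\<lambda>(i, j). A i j) =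
    four_block_mat (Matrix.mat k k (\<lambda>(i, j). B i j)) (Matrix.mat k m (\<lambda>(i, j). A i (k + j)))
      (0\<^sub>m m k) (Matrix.mat m m (\<lambda>(i, j). D i j))"
    by (rule eq_matI) (auto simp: not_less zero B D[symmetric])
  then show ?thesis
    unfolding ldet_eq_det by (simp add: det_four_block_mat_lower_left_zero[of _ k _ m])
qed

lemma ldet_one: "ldet n (\<lambda>i j. if i = j then 1 else 0) = 1"
proof -
  have "Matrix.mat n n (\<lambda>(i, j). if i = j then 1 else 0) = (1\<^sub>m n :: complex mat)"
    by (rule eq_matI) auto
  then show ?thesis unfolding ldet_eq_det by simp
qed

lemma ldet_rotate_cols:
  "norm (ldet (k + m) A) = norm (ldet (k + m) (\<lambda>i j. A i (if j < k then j + m else j - k)))"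
proof -
  have "Determinant.det (Matrix.mat (k + m) (k + m) (\<lambda>(i, j). A i j)) = (-1) ^ (k * m) *
      Determinant.det (Matrix.mat (k + m) (k + m) (\<lambda>(i, j). Matrix.mat (k + m) (k + m) (\<lambda>(i, j). A i j) $$ (i, if j < k then j + m else j - k)))"
    by (rule det_swap_cols) simp
  also have "Matrix.mat (k + m) (k + m) (\<lambda>(i, j). Matrix.mat (k + m) (k + m) (\<lambda>(i, j). A i j) $$ (i, if j < k then j + m else j - k)) =
      Matrix.mat (k + m) (k + m) (\<lambda>(i, j). A i (if j < k then j + m else j - k))"
    by (rule eq_matI) auto
  finally show ?thesis unfolding ldet_eq_det by (simp add: norm_mult norm_power)
qed

text \<open>Jacobi's formula for complementary minors. Multiplying A by a matrix made of r columns
  of its inverse and m unit vectors gives r unit vectors followed by the columns of A chosen by s, a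
  block triangular matrix.\<close>

lemma ldet_partial_solutions:
  fixes A X :: "nat \<Rightarrow> nat \<Rightarrow> complex"
  assumes sol: "\<And>i k. i < r + m \<Longrightarrow> k < r \<Longrightarrow> (\<Sum>l<r + m. A i l * X l k) = (if i = k then 1 else 0)"
    and s: "\<And>j. j < r + m \<Longrightarrow> s j < r + m"
  shows "ldet m (\<lambda>i j. A (r + i) (s (r + j))) =
    ldet (r + m) A * ldet (r + m) (\<lambda>l j. if j < r then X l j else if l = s j then 1 else 0)"
proof -
  define Z where "Z i j = (if j < r then if i = j then 1 else 0 else A i (s j))" for i j
  have "ldet (r + m) Z = ldet (r + m) A * ldet (r + m) (\<lambda>l j. if j < r then X l j else if l = s j then 1 else 0)"
  proof (rule ldet_solutions)
    fix i j assume ij: "i < r + m" "j < r + m"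
    have "(\<Sum>l<r + m. A i l * (if l = s j then 1 else 0)) = (\<Sum>l<r + m. if l = s j then A i l else 0)"
      by (rule sum.cong) auto
    then show "(\<Sum>l<r + m. A i l * (if j < r then X l j else if l = s j then 1 else 0)) = Z i j"
      using s[OF ij(2)] ij by (cases "j < r") (simp_all add: Z_def sol)
  qed
  moreover have "ldet (r + m) Z = ldet r (\<lambda>i j. if i = j then 1 else 0) * ldet m (\<lambda>i j. A (r + i) (s (r + j)))"
    by (rule ldet_block_lower_left_zero) (auto simp: Z_def)
  ultimately show ?thesis by (simp add: ldet_one)
qed

text \<open>For a Toeplitz matrix and r = 1 the lower right block is the same matrix of one size
  less, so the corner entry of the inverse is a quotient of consecutive determinants.\<close>

lemma ldet_leading_minor:
  fixes A X :: "nat \<Rightarrow> nat \<Rightarrow> complex"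
  assumes sol: "\<And>i k. i < r + m \<Longrightarrow> k < r \<Longrightarrow> (\<Sum>l<r + m. A i l * X l k) = (if i = k then 1 else 0)"
  shows "ldet m (\<lambda>i j. A (r + i) (r + j)) = ldet (r + m) A * ldet r X"
proof -
  define Y where "Y l j = (if j < r then X l j else if l = j then 1 else 0)" for l j
  have "ldet (r + m) (\<lambda>i j. Y j i) = ldet r (\<lambda>i j. X j i) * ldet m (\<lambda>i j. if i = j then 1 else 0)"
    by (rule ldet_block_lower_left_zero) (auto simp: Y_def)
  then have "ldet (r + m) Y = ldet r X"
    by (simp only: ldet_transpose[where A = Y] ldet_transpose[where A = X] ldet_one mult_1_right)
  then show ?thesis
    using ldet_partial_solutions[OF sol, where s = "\<lambda>j. j"] by (simp add: Y_def[abs_def])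
qed

text \<open>The last m rows and first m columns of the Toeplitz matrix of a form that of a(t)
  t^(-r). The complementary minor of the inverse is its r by r lower left corner. For j < r the
  truncated j - r is 0, which keeps the selection in range.\<close>

lemma norm_ldet_shifted_minor:
  fixes A X :: "nat \<Rightarrow> nat \<Rightarrow> complex"
  assumes sol: "\<And>i k. i < r + m \<Longrightarrow> k < r \<Longrightarrow> (\<Sum>l<r + m. A i l * X l k) = (if i = k then 1 else 0)"
  shows "norm (ldet m (\<lambda>i j. A (r + i) j)) = norm (ldet (r + m) A) * norm (ldet r (\<lambda>i k. X (m + i) k))"
proof -
  define Y where "Y l j = (if j < r then X l j else if l = j - r then 1 else 0)" for l j
  have "norm (ldet (m + r) Y) = norm (ldet (m + r) (\<lambda>i j. Y i (if j < m then j + r else j - m)))"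
    by (rule ldet_rotate_cols)
  also have "ldet (m + r) (\<lambda>i j. Y i (if j < m then j + r else j - m)) =
      ldet m (\<lambda>i j. if i = j then 1 else 0) * ldet r (\<lambda>i k. X (m + i) k)"
    by (rule ldet_block_lower_left_zero) (auto simp: Y_def)
  finally have "norm (ldet (r + m) Y) = norm (ldet r (\<lambda>i k. X (m + i) k))"
    by (simp add: ldet_one add.commute)
  then show ?thesis
    using ldet_partial_solutions[OF sol, where s = "\<lambda>j. j - r"] by (simp add: Y_def[abs_def] norm_mult)
qed

lemma injective_imp_solutions:
  fixes A :: "nat \<Rightarrow> nat \<Rightarrow> complex"
  assumes inj: "\<And>v l. (\<And>i. i < N \<Longrightarrow> (\<Sum>l<N. A i l * v l) = 0) \<Longrightarrow> l < N \<Longrightarrow> v l = 0"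
  obtains X where "\<And>i k. i < N \<Longrightarrow> k < N \<Longrightarrow> (\<Sum>l<N. A i l * X l k) = (if i = k then 1 else 0)"
proof -
  define T where "T = Matrix.mat N N (\<lambda>(i, j). A i j)"
  have T: "T \<in> carrier_mat N N" by (simp add: T_def)
  have dT: "Determinant.det T \<noteq> 0"
  proof
    assume "Determinant.det T = 0"
    then obtain v where v: "v \<in> carrier_vec N" "v \<noteq> 0\<^sub>v N" "T *\<^sub>v v = 0\<^sub>v N"
      using det_0_iff_vec_prod_zero[OF T] by blast
    have "(\<Sum>l<N. A i l * vec_index v l) = 0" if "i < N" for i
    proof -
      have "(\<Sum>l<N. A i l * vec_index v l) = vec_index (T *\<^sub>v v) i"
        using that v(1) by (simp add: T_def scalar_prod_def lessThan_atLeast0)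
      then show ?thesis using v(3) that by simp
    qed
    then have "vec_index v l = 0" if "l < N" for l using inj[of "vec_index v" l] that by blast
    then have "v = 0\<^sub>v N" using v(1) by (intro eq_vecI) auto
    then show False using v(2) by blast
  qed
  define X where "X l k = (adj_mat T $$ (l, k)) / Determinant.det T" for l k
  have "(\<Sum>l<N. A i l * X l k) = (if i = k then 1 else 0)" if "i < N" "k < N" for i k
  proof -
    have "(\<Sum>l<N. A i l * adj_mat T $$ (l, k)) = (T * adj_mat T) $$ (i, k)"
      using that adj_mat(1)[OF T] by (simp add: T_def scalar_prod_def lessThan_atLeast0)
    also have "\<dots> = Determinant.det T * (if i = k then 1 else 0)" using adj_mat(2)[OF T] that by simp
    finally show ?thesis using dT by (simp add: X_def flip: sum_divide_distrib)
  qed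
  then show ?thesis by (rule that)
qed

text \<open>In each Leibniz product one factor takes the weight and the others tend to 0, the
  weights being at least 1; k >= 1 provides the factor that takes it.\<close>

lemma ldet_weighted_tendsto_0:
  fixes E :: "nat \<Rightarrow> nat \<Rightarrow> nat \<Rightarrow> complex" and w :: "nat \<Rightarrow> real"
  assumes w: "\<And>n. w n \<ge> 1" and k: "k \<ge> 1"
    and E: "\<And>i j. i < k \<Longrightarrow> j < k \<Longrightarrow> (\<lambda>n. norm (E n i j) * w n) \<longlonglongrightarrow> 0"
  shows "(\<lambda>n. norm (ldet k (E n)) * w n) \<longlonglongrightarrow> 0"
proof -
  have E0: "(\<lambda>n. norm (E n i j)) \<longlonglongrightarrow> 0" if "i < k" "j < k" for i j
  proof (rule Lim_null_comparison[OF always_eventually E[OF that]], rule allI)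
    fix n
    show "norm (norm (E n i j)) \<le> norm (E n i j) * w n"
      using mult_left_mono[OF w[of n], of "norm (E n i j)"] by simp
  qed
  have P: "(\<lambda>n. (\<Prod>i<k. norm (E n i (p i))) * w n) \<longlonglongrightarrow> 0" if p: "p permutes {..<k}" for p
  proof -
    have pk: "p i < k" if "i < k" for i using permutes_in_image[OF p, of i] that by simp
    obtain m where m: "k = Suc m" using k by (cases k) auto
    have "(\<lambda>n. (norm (E n 0 (p 0)) * w n) * (\<Prod>i<m. norm (E n (Suc i) (p (Suc i))))) \<longlonglongrightarrow> 0 * (\<Prod>i<m. 0)"
      by (intro tendsto_mult tendsto_prod E E0 pk) (auto simp: m)
    then show ?thesis by (simp add: m prod.lessThan_Suc_shift mult_ac del: prod.lessThan_Suc)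
  qed
  have "(\<lambda>n. \<Sum>p | p permutes {..<k}. (\<Prod>i<k. norm (E n i (p i))) * w n) \<longlonglongrightarrow> (\<Sum>p | p permutes {..<k}. 0)"
    by (rule tendsto_sum) (simp add: P)
  then have lim: "(\<lambda>n. \<Sum>p | p permutes {..<k}. (\<Prod>i<k. norm (E n i (p i))) * w n) \<longlonglongrightarrow> 0" by simp
  show ?thesis
  proof (rule Lim_null_comparison[OF always_eventually lim], rule allI)
    fix n
    have w0: "w n \<ge> 0" using w[of n] by linarith
    have "norm (ldet k (E n)) \<le> (\<Sum>p | p permutes {..<k}. (\<Prod>i<k. norm (E n i (p i))))"
      unfolding ldet_def
    proof (rule sum_norm_le)
      fix p :: "nat \<Rightarrow> nat"
      have "norm (of_int (sign p) :: complex) = 1" by (simp add: sign_def)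
      then show "norm (of_int (sign p) * (\<Prod>i<k. E n i (p i))) \<le> (\<Prod>i<k. norm (E n i (p i)))"
        by (simp add: norm_mult prod_norm)
    qed
    from mult_right_mono[OF this w0]
    show "norm (norm (ldet k (E n)) * w n) \<le> (\<Sum>p | p permutes {..<k}. (\<Prod>i<k. norm (E n i (p i))) * w n)"
      using w0 by (simp add: sum_distrib_right)
  qed
qed

section \<open>Vectors as trigonometric polynomials\<close>

definition trig_poly :: "nat \<Rightarrow> (nat \<Rightarrow> complex) \<Rightarrow> l1z" where
  "trig_poly N v = (\<Sum>l<N. monomial (v l) (int l))"

lemma coef_mult_monomial: "coef (w * monomial z m) j = coef w (j - m) * z"
proof -
  have "coef (w * monomial z m) j = (\<Sum>\<^sub>\<infinity>k\<in>{j - m}. coef w k * z)"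
    unfolding coef_mult by (rule infsum_cong_neutral) auto
  then show ?thesis by simp
qed

lemma coef_mult_trig_poly: "coef (w * trig_poly N v) j = (\<Sum>l<N. coef w (j - int l) * v l)"
  by (simp add: trig_poly_def sum_distrib_left coef_mult_monomial)

lemma coef_trig_poly: "coef (trig_poly N v) (int l) = (if l < N then v l else 0)"
  by (simp add: trig_poly_def eq_commute)

lemma supported_trig_poly: "supported {0..<int N} (trig_poly N v)"
  by (auto simp: supported_def trig_poly_def intro!: sum.neutral)

section \<open>Determinants of shifted symbols\<close>

context wiener_hopf
begin

lemma solves_trig_poly:
  assumes "\<And>i. i < Suc n \<Longrightarrow> (\<Sum>l<Suc n. coef a (int i - int l) * v l) = coef y (int i)"
    and "supported {0..int n} y"
  shows "solves (int n) (trig_poly (Suc n) v) y" unfolding solves_def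
proof (intro conjI ballI)
  show "supported {0..int n} (trig_poly (Suc n) v)"
    by (rule supported_mono[OF supported_trig_poly]) auto
  fix j assume j: "j \<in> {0..int n}"
  then obtain i where i: "j = int i" "i < Suc n" using zero_le_imp_eq_int[of j] by auto
  show "coef (a * trig_poly (Suc n) v) j = coef y j"
    unfolding coef_mult_trig_poly i(1) by (rule assms(1)[OF i(2)])
qed (use assms(2) in auto)

lemma Ubar_nonneg: "Ubar p \<ge> 0"
  unfolding Ubar_def by (intro add_nonneg_nonneg infsum_nonneg) simp_all

text \<open>Provides the constant K of \<open>zeta_error_sum\<close>. With p = m - k <= -k, the
  weight \<open>\<phi> p\<close> is at most the weight at -k and goes to \<open>c\<close>, while
  \<open>\<psi> p\<close> goes to \<open>Ubar p\<close>; Young's inequality separates the two, and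
  each resulting series converges with a bound independent of m.\<close>

lemma young_bound:
  assumes gauge: "gauge Phi" "gauge Psi" and wt: "\<phi> \<in> weights" "\<psi> \<in> weights"
    and young: "\<And>x y. x \<ge> 0 \<Longrightarrow> y \<ge> 0 \<Longrightarrow> x * y \<le> Phi (2 * x) + Psi (2 * y)"
    and M: "M > 0" "\<And>k. real k \<le> M * \<phi> k * \<psi> k"
    and fin: "wfin Phi \<phi> (reflect c)" "wfin Psi \<psi> b" "wfin Psi \<psi> U"
  shows "\<exists>K. \<forall>m T. m \<le> 0 \<longrightarrow> finite T \<longrightarrow>
    (\<Sum>k\<in>T. norm (coef c k) * (if m - k > 0 then of_int (m - k) * Ubar (m - k) else 0)) \<le> K"
proof -
  define R where "R p = wcoef \<psi> U p + wconv \<psi> V b p" for p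
  obtain B where B: "\<And>j. wcoef \<psi> b j \<le> B" using wcoef_bounded[OF gauge(2) wt(2) fin(2)] by metis
  note nn = wcoef_nonneg[OF wt(2)] wcoef_nonneg[OF wt(1)]
  have conv0: "wconv \<psi> V b p \<ge> 0" for p by (intro infsum_nonneg mult_nonneg_nonneg nn norm_ge_zero)
  have R0: "R p \<ge> 0" for p unfolding R_def by (intro add_nonneg_nonneg nn conv0)
  \<comment> \<open>After the substitution k -> p - k only negative frequencies of \<open>V\<close>
    remain, so \<open>b\<close> is taken at p - k > p, where the weight is larger than or equal to
    the one at p.\<close>
  have UR: "\<psi> (nat p) * Ubar p \<le> R p" if p: "p > 0" for p
  proof -
    have pos: "\<psi> (nat p) \<ge> 0" using weights_pos[OF wt(2), of "nat p"] by simp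
    have "(\<Sum>\<^sub>\<infinity>k. norm (coef b k) * (if p - k < 0 then norm (coef V (p - k)) else 0)) =
        (\<Sum>\<^sub>\<infinity>k. norm (coef V k) * (if k < 0 then norm (coef b (p - k)) else 0))"
      by (rule infsum_reindex_bij_witness[of _ "\<lambda>k. p - k" "\<lambda>k. p - k"]) auto
    then have "\<psi> (nat p) * (\<Sum>\<^sub>\<infinity>k. norm (coef b k) * (if p - k < 0 then norm (coef V (p - k)) else 0)) =
        (\<Sum>\<^sub>\<infinity>k. \<psi> (nat p) * (norm (coef V k) * (if k < 0 then norm (coef b (p - k)) else 0)))"
      by (simp add: infsum_cmult_right')
    also have "\<dots> \<le> wconv \<psi> V b p"
    proof (rule infsum_mono)
      show "(\<lambda>k. \<psi> (nat p) * (norm (coef V k) * (if k < 0 then norm (coef b (p - k)) else 0))) summable_on UNIV"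
      proof (rule summable_on_cmult_right, rule summable_on_comparison_test)
        show "(\<lambda>k. norm (coef V k) * norm (coef b (p - k))) summable_on UNIV"
          using coef_mult_abs_summable[of V b p UNIV] by (simp add: norm_mult)
      qed auto
      show "(\<lambda>k. norm (coef V k) * wcoef \<psi> b (p - k)) summable_on UNIV"
        by (rule weighted_coef_summable[OF nn(1) B])
      fix k
      show "\<psi> (nat p) * (norm (coef V k) * (if k < 0 then norm (coef b (p - k)) else 0)) \<le> norm (coef V k) * wcoef \<psi> b (p - k)"
      proof (cases "k < 0")
        case True
        then have "\<psi> (nat p) \<le> \<psi> (nat (p - k))" by (intro weights_mono[OF wt(2)]) simp
        then have "norm (coef V k) * norm (coef b (p - k)) * \<psi> (nat p) \<le> norm (coef V k) * norm (coef b (p - k)) * \<psi> (nat (p - k))"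
          by (rule mult_left_mono) simp
        then show ?thesis using True p by (simp add: wcoef_def mult_ac)
      qed (simp add: nn)
    qed
    finally show ?thesis using p by (simp add: Ubar_def R_def wcoef_def distrib_left mult.commute)
  qed
  define S1 where "S1 = (\<Sum>n. Phi (2 * wcoef \<phi> (reflect c) (int n)))"
  have "summable (\<lambda>n. Psi (4 * wcoef \<psi> U (int n)) + Psi (4 * wconv \<psi> V b (int n)))"
    by (intro summable_add wfin_scaled[OF gauge(2) wt(2) fin(3)] wfin_convolution[OF gauge(2) wt(2) fin(2)]) simp_all
  then have RS: "summable (\<lambda>n. Psi (2 * R (int n)))"
  proof (rule summable_comparison_test[rotated], intro exI allI impI)
    fix n
    have "Psi (2 * wcoef \<psi> U (int n) + 2 * wconv \<psi> V b (int n))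
        \<le> Psi (2 * (2 * wcoef \<psi> U (int n))) + Psi (2 * (2 * wconv \<psi> V b (int n)))"
      by (rule gauge_add[OF gauge(2)]) (simp_all add: nn conv0)
    moreover have "Psi (2 * R (int n)) \<ge> 0" by (rule gauge_nonneg[OF gauge(2)]) (simp add: R0)
    ultimately show "norm (Psi (2 * R (int n))) \<le> Psi (4 * wcoef \<psi> U (int n)) + Psi (4 * wconv \<psi> V b (int n))"
      by (simp add: R_def distrib_left)
  qed
  define S2 where "S2 = (\<Sum>n. Psi (2 * R (int n)))"
  have "(\<Sum>k\<in>T. norm (coef c k) * (if m - k > 0 then of_int (m - k) * Ubar (m - k) else 0)) \<le> M * (S1 + S2)"
    if m: "m \<le> 0" and T: "finite T" for m :: int and T
  proof -
    define T' where "T' = {k \<in> T. m - k > 0}"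
    have T': "finite T'" using T by (simp add: T'_def)
    have "(\<Sum>k\<in>T. norm (coef c k) * (if m - k > 0 then of_int (m - k) * Ubar (m - k) else 0)) =
        (\<Sum>k\<in>T'. norm (coef c k) * (of_int (m - k) * Ubar (m - k)))"
      unfolding T'_def using T by (intro sum.mono_neutral_cong_right) auto
    also have "\<dots> \<le> (\<Sum>k\<in>T'. M * (Phi (2 * wcoef \<phi> (reflect c) (- k)) + Psi (2 * R (m - k))))"
    proof (rule sum_mono)
      fix k assume "k \<in> T'"
      then have p: "m - k > 0" by (simp add: T'_def)
      define p where "p = nat (m - k)"
      have pk: "m - k = int p" using p by (simp add: p_def)
      have pos: "\<phi> p \<ge> 0" "\<psi> p \<ge> 0" using weights_pos[OF wt(1), of p] weights_pos[OF wt(2), of p] by simp_all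
      have "norm (coef c k) * (of_int (m - k) * Ubar (m - k)) \<le> norm (coef c k) * ((M * \<phi> p * \<psi> p) * Ubar (m - k))"
        unfolding pk using M(2)[of p] by (intro mult_left_mono mult_right_mono Ubar_nonneg) simp_all
      also have "\<dots> = M * ((norm (coef c k) * \<phi> p) * (\<psi> p * Ubar (m - k)))" by (simp only: mult_ac)
      also have "\<dots> \<le> M * (wcoef \<phi> (reflect c) (- k) * R (m - k))"
      proof (intro mult_left_mono mult_mono)
        have "\<phi> p \<le> \<phi> (nat (- k))" using m by (intro weights_mono[OF wt(1)]) (simp add: p_def)
        then show "norm (coef c k) * \<phi> p \<le> wcoef \<phi> (reflect c) (- k)"
          using p m by (simp add: wcoef_def mult_left_mono)
        show "\<psi> p * Ubar (m - k) \<le> R (m - k)" using UR[OF p] by (simp add: p_def)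
      qed (use M pos in \<open>simp_all add: nn Ubar_nonneg\<close>)
      also have "\<dots> \<le> M * (Phi (2 * wcoef \<phi> (reflect c) (- k)) + Psi (2 * R (m - k)))"
        using M by (intro mult_left_mono young nn R0) simp
      finally show "norm (coef c k) * (of_int (m - k) * Ubar (m - k)) \<le> \<dots>" .
    qed
    also have "\<dots> = M * ((\<Sum>k\<in>T'. Phi (2 * wcoef \<phi> (reflect c) (- k))) + (\<Sum>k\<in>T'. Psi (2 * R (m - k))))"
      by (simp add: sum.distrib flip: sum_distrib_left)
    also have "\<dots> \<le> M * (S1 + S2)"
    proof (intro mult_left_mono add_mono)
      have "(\<Sum>k\<in>T'. Phi (2 * wcoef \<phi> (reflect c) (- k))) = (\<Sum>j\<in>uminus ` T'. Phi (2 * wcoef \<phi> (reflect c) j))"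
        by (simp add: sum.reindex)
      also have "\<dots> \<le> S1"
        unfolding S1_def by (rule wfin_finite_sums[OF gauge(1) wt(1) fin(1)]) (simp_all add: T')
      finally show "(\<Sum>k\<in>T'. Phi (2 * wcoef \<phi> (reflect c) (- k))) \<le> S1" .
      have "(\<Sum>k\<in>T'. Psi (2 * R (m - k))) = (\<Sum>n\<in>(\<lambda>k. nat (m - k)) ` T'. Psi (2 * R (int n)))"
        by (subst sum.reindex) (auto simp: inj_on_def T'_def intro!: sum.cong)
      also have "\<dots> \<le> S2"
        unfolding S2_def by (rule sum_le_suminf[OF RS]) (auto simp: T' R0 intro!: gauge_nonneg[OF gauge(2)])
      finally show "(\<Sum>k\<in>T'. Psi (2 * R (m - k))) \<le> S2" .
    qed (use M in simp)
    finally show ?thesis .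
  qed
  then show ?thesis by (intro exI[of _ "M * (S1 + S2)"] allI impI)
qed

theorem toeplitz_shift_tendsto:
  assumes \<psi>: "\<psi> \<in> weights"
    and U: "(\<lambda>n. norm (coef U (int n)) * \<psi> n) \<longlonglongrightarrow> 0"
    and b: "(\<lambda>n. norm (coef b (int n)) * \<psi> n) \<longlonglongrightarrow> 0"
    and K: "\<And>m T. m \<le> 0 \<Longrightarrow> finite T \<Longrightarrow>
      (\<Sum>k\<in>T. norm (coef c k) * (if m - k > 0 then of_int (m - k) * Ubar (m - k) else 0)) \<le> K"
    and \<kappa>: "\<kappa> \<ge> 1"
  shows "(\<lambda>n. norm (ldet (Suc n) (\<lambda>j k. coef a (int j - int k + int \<kappa>))) /
    norm (coef Am 0 * coef Ap 0) ^ (n + 1) * \<psi> n) \<longlonglongrightarrow> 0"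
proof -
  obtain n0 where n0: "\<And>n. n \<ge> int n0 \<Longrightarrow> norm (restr {..< -n} c) \<le> 1 / 2"
    "\<And>n. n \<ge> int n0 \<Longrightarrow> norm (restr {n<..} b) \<le> 1 / 2" using tails_small by metis
  define rinv where "rinv n X \<longleftrightarrow> (\<forall>i<Suc n. \<forall>k<Suc n.
      (\<Sum>l<Suc n. coef a (int i - int l) * X l k) = (if i = k then 1 else 0))" for n and X :: "nat \<Rightarrow> nat \<Rightarrow> complex"
  have "\<exists>X. n \<ge> n0 \<longrightarrow> rinv n X" for n
  proof (cases "n \<ge> n0")
    case True
    show ?thesis
    proof (rule injective_imp_solutions[of "Suc n" "\<lambda>i l. coef a (int i - int l)"])
      fix v l assume v: "\<And>i. i < Suc n \<Longrightarrow> (\<Sum>l<Suc n. coef a (int i - int l) * v l) = 0" and l: "l < Suc n"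
      have "solves (int n) (trig_poly (Suc n) v) 0"
        by (rule solves_trig_poly) (use v in \<open>auto simp: supported_def\<close>)
      then have "trig_poly (Suc n) v = 0" by (rule solves_0_imp) (use n0 True in auto)
      then show "v l = 0" using coef_trig_poly[of "Suc n" v l] l by simp
    next
      fix Y assume "\<And>i k. i < Suc n \<Longrightarrow> k < Suc n \<Longrightarrow> (\<Sum>l<Suc n. coef a (int i - int l) * Y l k) = (if i = k then 1 else 0)"
      then show ?thesis by (intro exI[of _ Y]) (simp add: rinv_def)
    qed
  qed simp
  then have "\<forall>n. \<exists>X. n \<ge> n0 \<longrightarrow> rinv n X" by blast
  from choice[OF this] obtain X where "\<forall>n. n \<ge> n0 \<longrightarrow> rinv n (X n)" ..
  then have X: "(\<Sum>l<Suc n. coef a (int i - int l) * X n l k) = (if i = k then 1 else 0)"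
    if "n \<ge> n0" "i < Suc n" "k < Suc n" for n i k using that unfolding rinv_def by blast
  define x where "x n k = trig_poly (Suc n) (\<lambda>l. X n l k)" for n k
  have sol: "solves (int n) (x n k) (monomial 1 (int k))" if "n \<ge> n0" "k \<le> n" for n k
    unfolding x_def by (rule solves_trig_poly) (use X[OF that(1)] that in \<open>auto simp: supported_def\<close>)
  have cx: "coef (x n k) (int l) = X n l k" if "l \<le> n" for n k l
    using that by (simp add: x_def coef_trig_poly)
  have m1: "monomial 1 0 = 1" by (rule l1z_eqI) (simp add: coef_one)
  have sol1: "solves (int n) (x n 0) 1" if "n \<ge> n0" for n using sol[OF that, of 0] by (simp add: m1)
  define D where "D n = ldet (Suc n) (\<lambda>j k. coef a (int j - int k))" for n
  define g where "g = coef Am 0 * coef Ap 0"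
  have "coef Am 0 * coef V 0 = 1" "coef Ap 0 * coef U 0 = 1"
    using coef_mult_0[of Am V] coef_mult_0[of Ap U] sp AmV ApU by (simp_all add: coef_one)
  then have g: "g \<noteq> 0" unfolding g_def by auto
  \<comment> \<open>The normalized determinants; the errors e_n below govern the quotients of
    consecutive ones.\<close>
  define d where "d n = norm (D n) / norm g ^ (n + 1)" for n
  define e where "e n = coef Am 0 * coef (c * zeta (int n) (x n 0)) 0" for n
  have rec: "d n = d (Suc n) * norm (1 + e (Suc n))" if n: "Suc n \<ge> n0" for n
  proof -
    have "D n = D (Suc n) * ldet 1 (X (Suc n))"
      using ldet_leading_minor[of 1 "Suc n" "\<lambda>i l. coef a (int i - int l)" "X (Suc n)"] X[OF n]
      by (simp add: D_def)
    also have "ldet 1 (X (Suc n)) = X (Suc n) 0 0" unfolding ldet_eq_det by (subst det_single) auto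
    finally have "D n = D (Suc n) * coef (x (Suc n) 0) 0" using cx[of 0 "Suc n" 0] by simp
    then have "g * D n = D (Suc n) * (1 + e (Suc n))"
      using solution_coef_0[OF sol1[OF n] refl] by (simp add: g_def e_def mult_ac)
    then have "norm g * norm (D n) = norm (D (Suc n)) * norm (1 + e (Suc n))"
      unfolding norm_mult[symmetric] by simp
    then show ?thesis using g by (simp add: d_def field_simps)
  qed
  define S where "S = norm (coef Am 0) * (4 / 3 * K)"
  have eS: "(\<Sum>n=n0..N. norm (e n)) \<le> S" for N
  proof -
    have "(\<Sum>n=n0..N. norm (coef (c * zeta (int n) (x n 0)) 0)) \<le> 4 / 3 * K"
      by (rule zeta_error_sum[OF n0 sol1 _ _ K]) (auto simp: Ubar_nonneg)
    then show ?thesis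
      unfolding e_def S_def norm_mult sum_distrib_left[symmetric] by (rule mult_left_mono) simp
  qed
  have "summable (\<lambda>n. norm (e (n + n0)))"
  proof (rule summableI_nonneg_bounded)
    fix n
    have "(\<Sum>i<n. norm (e (i + n0))) = (\<Sum>i\<in>{n0..<n + n0}. norm (e i))"
      using sum.shift_bounds_nat_ivl[of "\<lambda>i. norm (e i)" 0 n0 n] by (simp add: lessThan_atLeast0)
    also have "\<dots> \<le> (\<Sum>i=n0..n + n0. norm (e i))" by (rule sum_mono2) auto
    finally show "(\<Sum>i<n. norm (e (i + n0))) \<le> S" using eS[of "n + n0"] by simp
  qed simp
  then have "(\<lambda>n. norm (e (n + n0))) \<longlonglongrightarrow> 0" by (rule summable_LIMSEQ_zero)
  then have "(\<lambda>n. norm (e n)) \<longlonglongrightarrow> 0" by (rule LIMSEQ_offset)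
  then have "\<forall>\<^sub>F n in sequentially. norm (e n) < 1 / 2" by (rule order_tendstoD(2)) simp
  then obtain n1 where n1: "\<And>n. n \<ge> n1 \<Longrightarrow> norm (e n) < 1 / 2"
    unfolding eventually_sequentially by blast
  define N where "N = max n0 n1"
  have d0: "d n \<ge> 0" for n by (simp add: d_def)
  \<comment> \<open>For 0 <= t <= 1/2 one has (1 - t)(1 + 2t) >= 1, hence 1/|1 + e| <= exp(2|e|) for
    |e| = t; the product of these factors is bounded by the sum of the errors.\<close>
  have step: "d (Suc n) \<le> d n * exp (2 * norm (e (Suc n)))" if n: "n \<ge> N" for n
  proof -
    define t where "t = norm (e (Suc n))"
    have t: "0 \<le> t" "t < 1 / 2" using n1[of "Suc n"] n by (auto simp: t_def N_def)
    have "t * t \<le> t * (1 / 2)" using t by (intro mult_left_mono) auto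
    then have "1 \<le> (1 - t) * (1 + 2 * t)" by (simp add: algebra_simps)
    also have "\<dots> \<le> (1 - t) * exp (2 * t)"
      using t exp_ge_add_one_self[of "2 * t"] by (intro mult_left_mono) auto
    also have "\<dots> \<le> norm (1 + e (Suc n)) * exp (2 * t)"
      using norm_diff_ineq[of 1 "e (Suc n)"] by (intro mult_right_mono) (auto simp: t_def)
    finally have "d (Suc n) * 1 \<le> d (Suc n) * (norm (1 + e (Suc n)) * exp (2 * t))"
      by (rule mult_left_mono[OF _ d0])
    then show ?thesis using rec[of n] n by (simp add: t_def N_def mult.assoc)
  qed
  have "d (N + i) \<le> d N * exp (2 * (\<Sum>n=Suc N..N + i. norm (e n)))" for i
  proof (induction i)
    case (Suc i)
    have "d (N + Suc i) \<le> d (N + i) * exp (2 * norm (e (Suc (N + i))))" using step[of "N + i"] by simp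
    also have "\<dots> \<le> d N * exp (2 * (\<Sum>n=Suc N..N + i. norm (e n))) * exp (2 * norm (e (Suc (N + i))))"
      by (rule mult_right_mono[OF Suc]) simp
    also have "\<dots> = d N * exp (2 * (\<Sum>n=Suc N..N + Suc i. norm (e n)))"
      by (simp add: exp_add[symmetric] mult.assoc algebra_simps)
    finally show ?case .
  qed simp
  moreover have "d N * exp (2 * (\<Sum>n=Suc N..N + i. norm (e n))) \<le> d N * exp (2 * S)" for i
  proof -
    have "(\<Sum>n=Suc N..N + i. norm (e n)) \<le> (\<Sum>n=n0..N + i. norm (e n))"
      by (rule sum_mono2) (auto simp: N_def)
    then show ?thesis using eS[of "N + i"] by (intro mult_left_mono d0) auto
  qed
  ultimately have dB': "d (N + i) \<le> d N * exp (2 * S)" for i by (rule order.trans)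
  have dB: "d n \<le> d N * exp (2 * S)" if "n \<ge> N" for n using dB'[of "n - N"] that by simp
  obtain C where C: "C \<ge> 1" "\<And>n. \<psi> (2 * n) \<le> C * \<psi> n" using weights_doubling[OF \<psi>] by metis
  have pos: "\<psi> n > 0" for n by (rule weights_pos[OF \<psi>])
  \<comment> \<open>Rows n + 1 + i and columns k with i, k below \<open>\<kappa>\<close> form the
    lower left corner of the inverse of size n + \<open>\<kappa>\<close> + 1.\<close>
  have entry: "(\<lambda>n. norm (X (n + \<kappa>) (Suc n + i) k) * \<psi> n) \<longlonglongrightarrow> 0" if ik: "i < \<kappa>" "k < \<kappa>" for i k
  proof (rule LIMSEQ_I)
    fix \<eta> :: real assume \<eta>: "\<eta> > 0"
    define Q where "Q = norm V * (1 + 2 * (norm V + norm U))"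
    have Q: "Q \<ge> 0" by (simp add: Q_def)
    \<comment> \<open>Q is the constant of \<open>solution_top_coef_bound\<close> and C the doubling
      constant; Q + 1 replaces Q so that the divisor is positive. The final bound is
      \<open>\<eta>\<close> times Q / (2 (Q + 1)).\<close>
    define \<eta>' where "\<eta>' = \<eta> / (2 * (Q + 1) * C)"
    have \<eta>': "\<eta>' > 0" using \<eta> Q C by (simp add: \<eta>'_def)
    have "\<forall>\<^sub>F s in sequentially. norm (coef U (int s)) * \<psi> s < \<eta>' \<and> norm (coef b (int s)) * \<psi> s < \<eta>'"
      using order_tendstoD(2)[OF U \<eta>'] order_tendstoD(2)[OF b \<eta>'] by (rule eventually_conj)
    then obtain s0 where s0: "\<And>s. s \<ge> s0 \<Longrightarrow> norm (coef U (int s)) * \<psi> s < \<eta>'"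
        "\<And>s. s \<ge> s0 \<Longrightarrow> norm (coef b (int s)) * \<psi> s < \<eta>'" unfolding eventually_sequentially by blast
    have "norm (norm (X (n + \<kappa>) (Suc n + i) k) * \<psi> n - 0) < \<eta>" if n: "n \<ge> max n0 (2 * (s0 + \<kappa>))" for n
    proof -
      define \<epsilon> where "\<epsilon> = \<eta>' * C / \<psi> n"
      have \<epsilon>: "\<epsilon> \<ge> 0" using \<eta>' C pos[of n] by (simp add: \<epsilon>_def)
      \<comment> \<open>Indices s >= n/2 suffice, because the weight at n is at most the weight at
        2s, hence at most C times the weight at s.\<close>
      have small: "y \<le> \<epsilon>" if s: "y * \<psi> s < \<eta>'" "2 * s \<ge> n" for y s
      proof -
        have "\<psi> n \<le> C * \<psi> s" using weights_mono[OF \<psi> s(2)] C(2)[of s] by simp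
        then have "\<eta>' * \<psi> n \<le> \<eta>' * (C * \<psi> s)" using \<eta>' by simp
        then have "\<eta>' / \<psi> s \<le> \<epsilon>" using pos[of s] pos[of n] by (simp add: \<epsilon>_def field_simps)
        moreover have "y \<le> \<eta>' / \<psi> s" using s(1) pos[of s] by (simp add: field_simps)
        ultimately show ?thesis by simp
      qed
      have nk: "n + \<kappa> \<ge> n0" "k \<le> n + \<kappa>" "int (n + \<kappa>) \<ge> int n0" using n ik by auto
      have "norm (coef (x (n + \<kappa>) k) (int (Suc n + i))) \<le> norm V * ((1 + 2 * (norm V + norm U)) * \<epsilon>)"
      proof (rule solution_top_coef_bound[OF sol[OF nk(1,2)] n0(1)[OF nk(3)] n0(2)[OF nk(3)] refl])
        fix s assume s: "int (Suc n + i) - int k \<le> s"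
        define r where "r = nat s"
        have r: "s = int r" "r \<ge> s0" "2 * r \<ge> n" using s n ik by (auto simp: r_def)
        show "norm (coef U s) \<le> \<epsilon>" "norm (coef b s) \<le> \<epsilon>"
          unfolding r(1) using small[OF s0(1)[OF r(2)] r(3)] small[OF s0(2)[OF r(2)] r(3)] by auto
      qed (use \<epsilon> in auto)
      then have "norm (X (n + \<kappa>) (Suc n + i) k) * \<psi> n \<le> Q * \<epsilon> * \<psi> n"
        using cx[of "Suc n + i" "n + \<kappa>" k] ik pos[of n] by (simp add: Q_def mult.assoc)
      also have "\<dots> = Q * \<eta>' * C" using pos[of n] by (simp add: \<epsilon>_def)
      also have "\<dots> = \<eta> * (Q / (2 * (Q + 1)))"
      proof -
        have "\<eta>' * C = \<eta> / (2 * (Q + 1))"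
          unfolding \<eta>'_def divide_divide_eq_left[symmetric] using C(1) by simp
        then show ?thesis by (simp add: mult.assoc)
      qed
      also have "\<dots> < \<eta> * 1" using Q \<eta> by (intro mult_strict_left_mono) (simp_all add: field_simps)
      finally show ?thesis using pos[of n] by simp
    qed
    then show "\<exists>no. \<forall>n\<ge>no. norm (norm (X (n + \<kappa>) (Suc n + i) k) * \<psi> n - 0) < \<eta>" by blast
  qed
  have lim: "(\<lambda>n. norm (ldet \<kappa> (\<lambda>i k. X (n + \<kappa>) (Suc n + i) k)) * \<psi> n) \<longlonglongrightarrow> 0"
    by (rule ldet_weighted_tendsto_0[OF weights_ge_1[OF \<psi>] \<kappa> entry])
  \<comment> \<open>The determinant of size n + \<open>\<kappa>\<close> + 1 is normalized by
    \<open>\<kappa>\<close> more powers of |g| than the claim allows; they are moved into the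
    constant.\<close>
  define B where "B = d N * exp (2 * S) * norm g ^ \<kappa>"
  have lim': "(\<lambda>n. B * (norm (ldet \<kappa> (\<lambda>i k. X (n + \<kappa>) (Suc n + i) k)) * \<psi> n)) \<longlonglongrightarrow> 0"
    using tendsto_mult_left[OF lim, of B] by simp
  show ?thesis unfolding g_def[symmetric]
  proof (rule Lim_null_comparison[OF _ lim'])
    show "\<forall>\<^sub>F n in sequentially. norm (norm (ldet (Suc n) (\<lambda>j k. coef a (int j - int k + int \<kappa>))) / norm g ^ (n + 1) * \<psi> n)
        \<le> B * (norm (ldet \<kappa> (\<lambda>i k. X (n + \<kappa>) (Suc n + i) k)) * \<psi> n)"
      using eventually_ge_at_top[of N]
    proof eventually_elim
      case (elim n)
      define Dk where "Dk = norm (ldet (Suc n) (\<lambda>j k. coef a (int j - int k + int \<kappa>)))"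
      define L where "L = norm (ldet \<kappa> (\<lambda>i k. X (n + \<kappa>) (Suc n + i) k))"
      have "norm (ldet (Suc n) (\<lambda>i j. coef a (int (\<kappa> + i) - int j))) =
          norm (ldet (\<kappa> + Suc n) (\<lambda>i l. coef a (int i - int l))) * L" unfolding L_def
        by (rule norm_ldet_shifted_minor) (use X[of "n + \<kappa>"] elim in \<open>simp add: N_def add.commute\<close>)
      also have "norm (ldet (\<kappa> + Suc n) (\<lambda>i l. coef a (int i - int l))) = d (n + \<kappa>) * norm g ^ (n + 1) * norm g ^ \<kappa>"
        using g by (simp add: d_def D_def add.commute power_add)
      finally have "Dk / norm g ^ (n + 1) = d (n + \<kappa>) * (norm g ^ \<kappa> * L)"
        using g by (simp add: Dk_def algebra_simps)
      also have "\<dots> \<le> d N * exp (2 * S) * (norm g ^ \<kappa> * L)"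
        using dB[of "n + \<kappa>"] elim by (intro mult_right_mono) (auto simp: L_def)
      finally have "Dk / norm g ^ (n + 1) * \<psi> n \<le> d N * exp (2 * S) * (norm g ^ \<kappa> * L) * \<psi> n"
        by (intro mult_right_mono less_imp_le[OF pos])
      moreover have "Dk / norm g ^ (n + 1) * \<psi> n \<ge> 0"
        using less_imp_le[OF pos[of n]] by (simp add: Dk_def)
      ultimately show ?case by (simp only: B_def L_def Dk_def mult.assoc real_norm_def abs_of_nonneg)
    qed
  qed
qed

end

section \<open>The asymptotic formulas\<close>

text \<open>A bounded shift is harmless by doubling: n <= 2 (n + i) as soon as n >= 2 |i|.\<close>

lemma weighted_shift_tendsto_0:
  assumes \<psi>: "\<psi> \<in> weights" and b: "(\<lambda>n. norm (coef b (int n)) * \<psi> n) \<longlonglongrightarrow> 0"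
  shows "(\<lambda>n. norm (coef b (int n + i)) * \<psi> n) \<longlonglongrightarrow> 0"
proof -
  obtain C where C: "C \<ge> 1" "\<And>n. \<psi> (2 * n) \<le> C * \<psi> n" using weights_doubling[OF \<psi>] by metis
  define s where "s n = nat (int n + i)" for n
  have "filterlim s at_top sequentially" unfolding filterlim_at_top
  proof
    fix Z :: nat
    show "\<forall>\<^sub>F n in sequentially. Z \<le> s n"
      using eventually_ge_at_top[of "Z + nat \<bar>i\<bar>"] by eventually_elim (auto simp: s_def)
  qed
  from tendsto_mult_left[OF filterlim_compose[OF b this], of C]
  have lim: "(\<lambda>n. C * (norm (coef b (int (s n))) * \<psi> (s n))) \<longlonglongrightarrow> 0" by simp
  show ?thesis
  proof (rule Lim_null_comparison[OF _ lim])
    show "\<forall>\<^sub>F n in sequentially. norm (norm (coef b (int n + i)) * \<psi> n) \<le> C * (norm (coef b (int (s n))) * \<psi> (s n))"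
      using eventually_ge_at_top[of "2 * nat \<bar>i\<bar>"]
    proof eventually_elim
      case (elim n)
      then have s: "int (s n) = int n + i" "n \<le> 2 * s n" by (auto simp: s_def)
      have "\<psi> n \<le> C * \<psi> (s n)" using weights_mono[OF \<psi> s(2)] C(2)[of "s n"] by simp
      then have "norm (coef b (int n + i)) * \<psi> n \<le> norm (coef b (int n + i)) * (C * \<psi> (s n))"
        by (rule mult_left_mono) simp
      then show ?case unfolding s(1) using weights_nonneg[OF \<psi>, of n] by (simp add: mult_ac)
    qed
  qed
qed

text \<open>The correction is defined by solving the formula for it; its weighted size is controlled
  by those of D and L separately. The factor 1 + 0 matches the final formula with its first error
  term equal to 0.\<close>

lemma asymptotic_correction:
  fixes D L s :: "nat \<Rightarrow> complex" and w :: "nat \<Rightarrow> real"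
  assumes D: "(\<lambda>n. norm (D n) / norm g ^ (n + 1) * w n) \<longlonglongrightarrow> 0"
    and L: "(\<lambda>n. norm (L n) * w n) \<longlonglongrightarrow> 0"
    and w: "\<And>n. w n \<ge> 0" and nz: "g \<noteq> 0" "E \<noteq> 0" "H \<noteq> 0" and s: "\<And>n. norm (s n) = 1"
  shows "\<exists>\<delta>. (\<lambda>n. \<delta> n * of_real (w n)) \<longlonglongrightarrow> 0 \<and>
    (\<forall>n. D n = g ^ (n + 1) * E * (1 + 0) * s n * H * (L n + \<delta> n))"
proof -
  define \<delta> where "\<delta> n = D n / (g ^ (n + 1) * E * s n * H) - L n" for n
  have snz: "s n \<noteq> 0" for n using s[of n] by auto
  have eq: "\<forall>n. D n = g ^ (n + 1) * E * (1 + 0) * s n * H * (L n + \<delta> n)"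
    using nz snz by (simp add: \<delta>_def)
  have "(\<lambda>n. norm (D n) / norm g ^ (n + 1) * w n * (1 / (norm E * norm H)) + norm (L n) * w n) \<longlonglongrightarrow> 0 * (1 / (norm E * norm H)) + 0"
    by (intro tendsto_add tendsto_mult D L tendsto_const)
  then have lim: "(\<lambda>n. norm (D n) / norm g ^ (n + 1) * w n * (1 / (norm E * norm H)) + norm (L n) * w n) \<longlonglongrightarrow> 0"
    by simp
  have "(\<lambda>n. \<delta> n * of_real (w n)) \<longlonglongrightarrow> 0"
  proof (rule Lim_null_comparison[OF always_eventually lim], rule allI)
    fix n
    have "norm (\<delta> n * of_real (w n)) = norm (\<delta> n) * w n" using w[of n] by (simp add: norm_mult)
    also have "\<dots> \<le> (norm (D n / (g ^ (n + 1) * E * s n * H)) + norm (L n)) * w n"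
      unfolding \<delta>_def by (intro mult_right_mono norm_triangle_ineq4 w)
    also have "\<dots> = norm (D n) / norm g ^ (n + 1) * w n * (1 / (norm E * norm H)) + norm (L n) * w n"
      by (simp add: norm_divide norm_mult norm_power s algebra_simps)
    finally show "norm (\<delta> n * of_real (w n)) \<le> \<dots>" .
  qed
  with eq show ?thesis by blast
qed

context wiener_hopf
begin

text \<open>The products of the factors are written out because the names \<open>a\<close> and
  \<open>b\<close> denote different elements in the two instances of the locale.\<close>

lemma shifted_determinant_asymptotics:
  assumes gauge: "gauge Phi" "gauge Psi" and wt: "\<phi> \<in> weights" "\<psi> \<in> weights"
    and young: "\<And>x y. x \<ge> 0 \<Longrightarrow> y \<ge> 0 \<Longrightarrow> x * y \<le> Phi (2 * x) + Psi (2 * y)"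
    and M: "M > 0" "\<And>k. real k \<le> M * \<phi> k * \<psi> k"
    and fin: "wfin Phi \<phi> (reflect V)" "wfin Psi \<psi> U"
    and \<kappa>: "\<kappa> \<ge> 1" and nz: "E \<noteq> 0" "H \<noteq> 0" and g: "g = coef Am 0 * coef Ap 0" "g \<noteq> 0"
  shows "\<exists>\<delta>. (\<lambda>n. \<delta> n * of_real (\<psi> n)) \<longlonglongrightarrow> 0 \<and>
    (\<forall>n. ldet (Suc n) (\<lambda>j k. coef (Am * Ap) (int j - int k + int \<kappa>)) =
      g ^ (n + 1) * E * (1 + 0) * (-1) ^ ((n + \<kappa>) * \<kappa>) * H *
      (ldet \<kappa> (\<lambda>j k. coef (Am * U) (int n + 1 + int j - int k)) + \<delta> n))"
proof -
  have bfin: "wfin Psi \<psi> b"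
    unfolding b_def by (rule wfin_mult_nonpos[OF gauge(2) wt(2) fin(2) sp(1)])
  have "wfin Phi \<phi> (reflect Ap * reflect V)"
    by (rule wfin_mult_nonpos[OF gauge(1) wt(1) fin(1)]) (simp add: supported_reflect sp)
  then have cfin: "wfin Phi \<phi> (reflect c)" by (simp add: c_def reflect_mult)
  obtain K where "\<forall>m T. m \<le> 0 \<longrightarrow> finite T \<longrightarrow>
      (\<Sum>k\<in>T. norm (coef c k) * (if m - k > 0 then of_int (m - k) * Ubar (m - k) else 0)) \<le> K"
    using young_bound[OF gauge wt young M cfin bfin fin(2)] ..
  then have K: "(\<Sum>k\<in>T. norm (coef c k) * (if m - k > 0 then of_int (m - k) * Ubar (m - k) else 0)) \<le> K"
    if "m \<le> 0" "finite T" for m T using that by blast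
  have blim: "(\<lambda>n. norm (coef b (int n)) * \<psi> n) \<longlonglongrightarrow> 0" by (rule wfin_tendsto[OF gauge(2) wt(2) bfin])
  have D: "(\<lambda>n. norm (ldet (Suc n) (\<lambda>j k. coef (Am * Ap) (int j - int k + int \<kappa>))) / norm g ^ (n + 1) * \<psi> n) \<longlonglongrightarrow> 0"
    using toeplitz_shift_tendsto[OF wt(2) wfin_tendsto[OF gauge(2) wt(2) fin(2)] blim K \<kappa>]
    by (simp only: g(1) a_def)
  have L: "(\<lambda>n. norm (ldet \<kappa> (\<lambda>j k. coef (Am * U) (int n + 1 + int j - int k))) * \<psi> n) \<longlonglongrightarrow> 0"
  proof (rule ldet_weighted_tendsto_0[OF weights_ge_1[OF wt(2)] \<kappa>])
    fix j k
    show "(\<lambda>n. norm (coef (Am * U) (int n + 1 + int j - int k)) * \<psi> n) \<longlonglongrightarrow> 0"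
      using weighted_shift_tendsto_0[OF wt(2) blim, of "1 + int j - int k"]
      by (simp add: b_def algebra_simps)
  qed
  show ?thesis
    by (rule asymptotic_correction[OF D L weights_nonneg[OF wt(2)] g(2) nz]) (simp add: norm_power)
qed

end

theorem theorem1p4:
  fixes p Phi Psi :: "real \<Rightarrow> real" and \<phi> \<psi> :: "nat \<Rightarrow> real" and M :: real
    and a :: "complex \<Rightarrow> complex"
  assumes "N_pair p Phi Psi" and "Delta2_0 Phi" and "Delta2_0 Psi"
    and "\<phi> \<in> weights" and "\<psi> \<in> weights"
    and "0 < M" and "\<forall>k. real k \<le> M * \<phi> k * \<psi> k"
    and "a \<in> Wiener \<inter> Fl Phi Psi \<phi> \<psi>"
    and "\<forall>t\<in>circle. a t \<noteq> 0" and "cind a = 0"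
  shows "(\<exists>am ap. (\<forall>t\<in>circle. a t = am t * ap t) \<and>
            am \<in> Wiener \<inter> Fl Phi Psi \<phi> \<psi> \<inter> Hminus \<and>
            (\<lambda>t. inverse (am t)) \<in> Wiener \<inter> Fl Phi Psi \<phi> \<psi> \<inter> Hminus \<and>
            ap \<in> Wiener \<inter> Fl Phi Psi \<phi> \<psi> \<inter> Hplus \<and>
            (\<lambda>t. inverse (ap t)) \<in> Wiener \<inter> Fl Phi Psi \<phi> \<psi> \<inter> Hplus)
       \<and> (\<forall>am ap. (\<forall>t\<in>circle. a t = am t * ap t) \<and>
            am \<in> Wiener \<inter> Fl Phi Psi \<phi> \<psi> \<inter> Hminus \<and>
            (\<lambda>t. inverse (am t)) \<in> Wiener \<inter> Fl Phi Psi \<phi> \<psi> \<inter> Hminus \<and>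
            ap \<in> Wiener \<inter> Fl Phi Psi \<phi> \<psi> \<inter> Hplus \<and>
            (\<lambda>t. inverse (ap t)) \<in> Wiener \<inter> Fl Phi Psi \<phi> \<psi> \<inter> Hplus \<longrightarrow>
          (let b = (\<lambda>t. am t / ap t); c = (\<lambda>t. ap t / am t) in
           \<exists>\<delta>1 :: nat \<Rightarrow> complex. \<delta>1 \<longlonglongrightarrow> 0 \<and>
           (\<forall>\<kappa>::nat. \<kappa> \<ge> 1 \<longrightarrow>
             (\<exists>\<delta>2 \<delta>3 :: nat \<Rightarrow> complex.
                (\<lambda>n. \<delta>2 n * of_real (\<psi> n)) \<longlonglongrightarrow> 0 \<and>
                (\<lambda>n. \<delta>3 n * of_real (\<phi> n)) \<longlonglongrightarrow> 0 \<and>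
                (\<forall>\<^sub>F n in sequentially.
                   Dn n (\<lambda>t. a t * t powi (- int \<kappa>)) =
                     Gc a ^ (n+1) * Ec a * (1 + \<delta>1 n) * (-1) ^ ((n+\<kappa>)*\<kappa>) * Gc c ^ \<kappa> *
                     (ldet \<kappa> (\<lambda>j k. fc b (int n + 1 + int j - int k)) + \<delta>2 n)) \<and>
                (\<forall>\<^sub>F n in sequentially.
                   Dn n (\<lambda>t. a t * t powi (int \<kappa>)) =
                     Gc a ^ (n+1) * Ec a * (1 + \<delta>1 n) * (-1) ^ ((n+\<kappa>)*\<kappa>) * Gc b ^ \<kappa> *
                     (ldet \<kappa> (\<lambda>j k. fc c (- int n - 1 - int j + int k)) + \<delta>3 n))))))"
proof -
  note gauge = N_pairD(1,2)[OF assms(1-3)]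
  note young = N_pairD(3)[OF assms(1-3)]
  note wt = assms(4,5)
  obtain A where A: "\<And>t. t \<in> circle \<Longrightarrow> a t = ev A t" using assms(8) Wiener_iff by blast
  have Afin: "wfin Phi \<phi> (reflect A)" "wfin Psi \<psi> A" using assms(8) Fl_iff[OF A] by blast+
  have "continuous_on circle a" using continuous_on_ev A continuous_on_cong by blast
  then obtain L where L: "continuous_on circle L" "\<And>t. t \<in> circle \<Longrightarrow> exp (L t) = a t"
    using continuous_log_exists[of a] assms(9,10) by blast
  obtain w where w: "\<And>t. t \<in> circle \<Longrightarrow> ev w t = L t"
    using wiener_levy_log[OF L(1), of A] L(2) A by metis
  have Aw: "A = exp w" by (rule ev_inject) (metis A L(2) w ev_exp)
  have mem: "f \<in> Wiener \<inter> Fl Phi Psi \<phi> \<psi>"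
    if "\<And>t. t \<in> circle \<Longrightarrow> f t = ev v t" "wfin Phi \<phi> (reflect v)" "wfin Psi \<psi> v" for f v
    using that Wiener_iff[of f] Fl_iff[OF that(1)] by blast
  show ?thesis
  proof (intro conjI allI impI, goal_cases)
    case 1
    define wp where "wp = restr {0..} w"
    define wm where "wm = restr {..<0} w"
    have ww: "wm + wp = w" unfolding wm_def wp_def by (rule l1z_eqI) auto
    have swm: "supported {..0} wm" "supported {..0} (- wm)" by (auto simp: wm_def supported_def)
    have swp: "supported {0..} wp" "supported {0..} (- wp)" by (auto simp: wp_def supported_def)
    have sp: "supported {..0} (exp wm)" "supported {..0} (exp (- wm))"
      "supported {0..} (exp wp)" "supported {0..} (exp (- wp))"
      by (rule supported_exp; use swm swp in auto)+
    have eq: "exp wm * exp wp = A" "exp wm * exp (- wm) = 1" "exp wp * exp (- wp) = 1"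
      by (simp_all add: Aw exp_minus_inverse exp_add_commuting[OF mult.commute] flip: ww)
    note fin = wfin_factorization[OF gauge wt Afin sp eq]
    have fin': "wfin Psi \<psi> (exp wm)" "wfin Psi \<psi> (exp (- wm))"
      "wfin Phi \<phi> (reflect (exp wp))" "wfin Phi \<phi> (reflect (exp (- wp)))"
      using sp by (auto intro!: wfin_nonpos gauge simp: supported_reflect)
    have inv: "inverse (ev (exp wm) t) = ev (exp (- wm)) t" "inverse (ev (exp wp) t) = ev (exp (- wp)) t"
      if "t \<in> circle" for t using that by (simp_all add: ev_exp ev_simps exp_minus)
    have "\<forall>t\<in>circle. a t = ev (exp wm) t * ev (exp wp) t"
      using A eq(1) by (simp add: ev_mult[symmetric])
    moreover have "ev (exp wm) \<in> Wiener \<inter> Fl Phi Psi \<phi> \<psi> \<inter> Hminus"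
      using mem[of "ev (exp wm)", OF refl fin(3) fin'(1)] Hminus_iff[of "ev (exp wm)", OF refl] sp(1) by simp
    moreover have "(\<lambda>t. inverse (ev (exp wm) t)) \<in> Wiener \<inter> Fl Phi Psi \<phi> \<psi> \<inter> Hminus"
      using mem[OF inv(1) fin(4) fin'(2)] Hminus_iff[OF inv(1)] sp(2) by simp
    moreover have "ev (exp wp) \<in> Wiener \<inter> Fl Phi Psi \<phi> \<psi> \<inter> Hplus"
      using mem[of "ev (exp wp)", OF refl fin'(3) fin(1)] Hplus_iff[of "ev (exp wp)", OF refl] sp(3) by simp
    moreover have "(\<lambda>t. inverse (ev (exp wp) t)) \<in> Wiener \<inter> Fl Phi Psi \<phi> \<psi> \<inter> Hplus"
      using mem[OF inv(2) fin'(4) fin(2)] Hplus_iff[OF inv(2)] sp(4) by simp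
    ultimately show ?case
      by - (rule exI[of _ "ev (exp wm)"], rule exI[of _ "ev (exp wp)"], intro conjI)
  next
    case (2 am ap)
    then have fact: "\<forall>t\<in>circle. a t = am t * ap t"
      and am: "am \<in> Wiener \<inter> Fl Phi Psi \<phi> \<psi> \<inter> Hminus"
      and ami: "(\<lambda>t. inverse (am t)) \<in> Wiener \<inter> Fl Phi Psi \<phi> \<psi> \<inter> Hminus"
      and ap: "ap \<in> Wiener \<inter> Fl Phi Psi \<phi> \<psi> \<inter> Hplus"
      and api: "(\<lambda>t. inverse (ap t)) \<in> Wiener \<inter> Fl Phi Psi \<phi> \<psi> \<inter> Hplus" by blast+
    have nz: "am t \<noteq> 0" "ap t \<noteq> 0" if "t \<in> circle" for t using fact assms(9) that by auto
    obtain Am where Am: "\<And>t. t \<in> circle \<Longrightarrow> am t = ev Am t" using am Wiener_iff[of "\<lambda>t. am t"] by auto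
    obtain V where V: "\<And>t. t \<in> circle \<Longrightarrow> inverse (am t) = ev V t"
      using ami Wiener_iff[of "\<lambda>t. inverse (am t)"] by auto
    obtain Ap where Ap: "\<And>t. t \<in> circle \<Longrightarrow> ap t = ev Ap t" using ap Wiener_iff[of "\<lambda>t. ap t"] by auto
    obtain U where U: "\<And>t. t \<in> circle \<Longrightarrow> inverse (ap t) = ev U t"
      using api Wiener_iff[of "\<lambda>t. inverse (ap t)"] by auto
    have sp: "supported {..0} Am" "supported {..0} V" "supported {0..} Ap" "supported {0..} U"
      using Hminus_iff[OF Am] Hminus_iff[OF V] Hplus_iff[OF Ap] Hplus_iff[OF U] am ami ap api by blast+
    have eq: "Am * Ap = A" "Am * V = 1" "Ap * U = 1"
      by (rule ev_inject, use fact A nz in \<open>simp add: ev_mult flip: Am Ap V U\<close>)+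
    note fin = wfin_factorization[OF gauge wt Afin sp eq]
    interpret W1: wiener_hopf Am Ap V U by standard (use sp eq in auto)
    \<comment> \<open>a(1/t) has the reflected a_+ as its minus factor, so the two N-functions and
      the two weights change places in the second formula.\<close>
    interpret W2: wiener_hopf "reflect Ap" "reflect Am" "reflect U" "reflect V"
      by standard (simp_all add: supported_reflect sp eq flip: reflect_mult)
    define b where "b = (\<lambda>t. am t / ap t)"
    define c where "c = (\<lambda>t. ap t / am t)"
    have fb: "fc b k = coef (Am * U) k" for k
      by (rule fc_eq_coef) (simp add: b_def ev_mult divide_inverse flip: Am U)
    have fcc: "fc c k = coef (Ap * V) k" for k
      by (rule fc_eq_coef) (simp add: c_def ev_mult divide_inverse flip: Ap V)
    have fca: "fc a k = coef A k" for k by (rule fc_eq_coef) (rule A)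
    have G: "Gc a = coef Am 0 * coef Ap 0"
      using Gc_eq[of a w] factor_coef_0[of Am Ap w V] A Aw eq sp by simp
    have Gnz: "Gc f \<noteq> 0" for f by (simp add: Gc_def)
    have Enz: "Ec a \<noteq> 0" by (simp add: Ec_def)
    have D1: "Dn n (\<lambda>t. a t * t powi (- int \<kappa>)) =
        ldet (Suc n) (\<lambda>j k. coef (Am * Ap) (int j - int k + int \<kappa>))" for n \<kappa>
      by (simp add: Dn_def fc_mult_powi fca eq)
    \<comment> \<open>The matrix entries of a(t) t^\<open>\<kappa>\<close> are the coefficients at j
      - k - \<open>\<kappa>\<close>; transposition turns them into those of a(1/t) shifted by
      \<open>\<kappa>\<close> in the direction of the first formula.\<close>
    have D2: "Dn n (\<lambda>t. a t * t powi (int \<kappa>)) =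
        ldet (Suc n) (\<lambda>j k. coef (reflect Ap * reflect Am) (int j - int k + int \<kappa>))" for n \<kappa>
    proof -
      have "reflect Ap * reflect Am = reflect A"
        by (simp add: eq(1)[symmetric] mult.commute flip: reflect_mult)
      then have "ldet (Suc n) (\<lambda>j k. coef (reflect Ap * reflect Am) (int j - int k + int \<kappa>)) =
          ldet (Suc n) (\<lambda>j k. coef A (int k - int j - int \<kappa>))" by (simp add: algebra_simps)
      also have "\<dots> = ldet (Suc n) (\<lambda>j k. coef A (int j - int k - int \<kappa>))" by (rule ldet_transpose)
      finally show ?thesis unfolding Dn_def fc_mult_powi fca by (rule sym)
    qed
    show ?case unfolding b_def[symmetric] c_def[symmetric] Let_def
    proof (rule exI[of _ "\<lambda>_. 0"], intro conjI allI impI, goal_cases)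
      case 1
      show ?case by simp
    next
      case (2 \<kappa>)
      note \<kappa> = this
      have M: "real k \<le> M * \<phi> k * \<psi> k" "real k \<le> M * \<psi> k * \<phi> k" for k
        using assms(7) by (simp_all add: mult_ac)
      have young': "x * y \<le> Psi (2 * x) + Phi (2 * y)" if "x \<ge> 0" "y \<ge> 0" for x y
        using young[OF that(2,1)] by (simp add: mult.commute add.commute)
      have "reflect (reflect U) = U" by (rule l1z_eqI) simp
      then have f2: "wfin Psi \<psi> (reflect (reflect U))" using fin(2) by simp
      have H: "Gc c ^ \<kappa> \<noteq> 0" "Gc b ^ \<kappa> \<noteq> 0" using Gnz by simp_all
      have G': "Gc a = coef (reflect Ap) 0 * coef (reflect Am) 0" by (simp add: G mult.commute)
      have e2: "coef (reflect Ap * reflect V) (int n + 1 + int j - int k) = fc c (- int n - 1 - int j + int k)" for n j k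
        by (simp add: fcc algebra_simps flip: reflect_mult)
      obtain \<delta>2 where \<delta>2: "(\<lambda>n. \<delta>2 n * of_real (\<psi> n)) \<longlonglongrightarrow> 0 \<and>
        (\<forall>n. ldet (Suc n) (\<lambda>j k. coef (Am * Ap) (int j - int k + int \<kappa>)) =
          Gc a ^ (n + 1) * Ec a * (1 + 0) * (-1) ^ ((n + \<kappa>) * \<kappa>) * Gc c ^ \<kappa> *
          (ldet \<kappa> (\<lambda>j k. coef (Am * U) (int n + 1 + int j - int k)) + \<delta>2 n))"
        using W1.shifted_determinant_asymptotics[OF gauge wt young assms(6) M(1) fin(4,2) \<kappa> Enz H(1) G Gnz] ..
      obtain \<delta>3 where \<delta>3: "(\<lambda>n. \<delta>3 n * of_real (\<phi> n)) \<longlonglongrightarrow> 0 \<and>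
        (\<forall>n. ldet (Suc n) (\<lambda>j k. coef (reflect Ap * reflect Am) (int j - int k + int \<kappa>)) =
          Gc a ^ (n + 1) * Ec a * (1 + 0) * (-1) ^ ((n + \<kappa>) * \<kappa>) * Gc b ^ \<kappa> *
          (ldet \<kappa> (\<lambda>j k. coef (reflect Ap * reflect V) (int n + 1 + int j - int k)) + \<delta>3 n))"
        using W2.shifted_determinant_asymptotics[OF gauge(2,1) wt(2,1) young' assms(6) M(2) f2 fin(4) \<kappa> Enz H(2) G' Gnz] ..
      show ?case using \<delta>2 \<delta>3 unfolding D1 D2 e2 fb by (intro exI[of _ \<delta>2] exI[of _ \<delta>3]) simp
    qed
  qed
qed

end
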